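(* Let $\Omega\subset\mathbb{R}^N$ ($N\geq 3$) be a bounded domain with smooth boundary, let $p\in C^{0,\alpha}(\overline\Omega)$ for some $\alpha\in(0,1)$ with $p(x)>1$ for all $x\in\overline\Omega$, and let $1<\beta<\gamma<p^-$. Let $A$ and $a$ satisfy hypotheses (A1)–(A5) stated in the context. Assume moreover that $p^+<\min\{N, Np^-/(N-p^-)\}$. Then there exists $\lambda^\star>0$ such that for all $\lambda>\lambda^\star$ the problem $$-\mathrm{div}(a(x,\nabla u))=\lambda(u^{\gamma-1}-u^{\beta-1})\ \text{in }\Omega,\qquad u=0\ \text{on }\partial\Omega,\qquad u\geq 0\ \text{in }\Omega$$ has at least two distinct non-negative, nontrivial weak solutions.
   Context: Notation: $p^+=\sup_{x\in\Omega}p(x)$, $p^-=\inf_{x\in\Omega}p(x)$. $L^{p(x)}(\Omega)$ is the space of measurable real functions $u$ on $\Omega$ with $\int_\Omega|u(x)|^{p(x)}dx<\infty$, with the Luxemburg norm $|u|_{p(x)}=\inf\{\mu>0:\int_\Omega|u(x)/\mu|^{p(x)}dx\leq 1\}$. $E=W_0^{1,p(x)}(\Omega)$ is the closure of $C_0^\infty(\Omega)$ under the norm $\|u\|=|\nabla u|_{p(x)}$. The map $A:\overline\Omega\times\mathbb{R}^N\to\mathbb{R}$ is such that $a(x,\xi)=\frac{d}{d\xi}A(x,\xi)$ exists and $a:\overline\Omega\times\mathbb{R}^N\to\mathbb{R}^N$ is continuous, and: (A1) $A(x,0)=0$ for all $x\in\overline\Omega$; (A2) there is $c_1>0$ with $|a(x,\xi)|\leq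 c_1(1+|\xi|^{p(x)-1})$ for all $x\in\overline\Omega$, $\xi\in\mathbb{R}^N$; (A3) $0\leq (a(x,\xi)-a(x,\psi))\cdot(\xi-\psi)$ for all $x\in\overline\Omega$, $\xi,\psi\in\mathbb{R}^N$, with equality if and only if $\xi=\psi$; (A4) there is $k>0$ with $A(x,\frac{\xi+\psi}{2})\leq \frac12 A(x,\xi)+\frac12A(x,\psi)-k|\xi-\psi|^{p(x)}$ for all $x\in\overline\Omega$, $\xi,\psi\in\mathbb{R}^N$; (A5) $|\xi|^{p(x)}\leq a(x,\xi)\cdot\xi\leq p(x)A(x,\xi)$ for all $x\in\overline\Omega$, $\xi\in\mathbb{R}^N$. A weak solution is a $u\in E$ with $u\geq 0$ a.e. in $\Omega$ and $\int_\Omega a(x,\nabla u)\cdot\nabla\varphi\,dx-\lambda\int_\Omega u^{\gamma-1}\varphi\,dx+\lambda\int_\Omega u^{\beta-1}\varphi\,dx=0$ for all $\varphi\in E$. *)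

theory Defs
  imports "HOL-Analysis.Analysis"
begin

fun C_k :: "nat \<Rightarrow> ('a::euclidean_space \<Rightarrow> real) \<Rightarrow> bool" where
  "C_k 0 f = continuous_on UNIV f"
| "C_k (Suc k) f = (f differentiable_on UNIV \<and>
       (\<forall>b\<in>Basis. C_k k (\<lambda>x. frechet_derivative f (at x) b)))"

definition smooth_fun :: "('a::euclidean_space \<Rightarrow> real) \<Rightarrow> bool" where
  "smooth_fun f \<longleftrightarrow> (\<forall>k. C_k k f)"

definition grad :: "('a::euclidean_space \<Rightarrow> real) \<Rightarrow> 'a \<Rightarrow> 'a" where
  "grad f x = (\<Sum>b\<in>Basis. frechet_derivative f (at x) b *\<^sub>R b)"

definition smooth_bounded_domain :: "'a::euclidean_space set \<Rightarrow> bool" where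
  "smooth_bounded_domain \<Omega> \<longleftrightarrow> open \<Omega> \<and> connected \<Omega> \<and> bounded \<Omega> \<and> \<Omega> \<noteq> {} \<and>
     (\<exists>\<rho>. smooth_fun \<rho> \<and> \<Omega> = {x. \<rho> x < 0} \<and> (\<forall>x. \<rho> x = 0 \<longrightarrow> grad \<rho> x \<noteq> 0))"

definition holder_on :: "real \<Rightarrow> 'a::metric_space set \<Rightarrow> ('a \<Rightarrow> real) \<Rightarrow> bool" where
  "holder_on \<alpha> S f \<longleftrightarrow> (\<exists>C. \<forall>x\<in>S. \<forall>y\<in>S. \<bar>f x - f y\<bar> \<le> C * dist x y powr \<alpha>)"

definition test_fun :: "'a::euclidean_space set \<Rightarrow> ('a \<Rightarrow> real) \<Rightarrow> bool" where
  "test_fun \<Omega> \<phi> \<longleftrightarrow> smooth_fun \<phi> \<and> compact (closure {x. \<phi> x \<noteq> 0}) \<and>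
     closure {x. \<phi> x \<noteq> 0} \<subseteq> \<Omega>"

definition modular :: "('a::euclidean_space \<Rightarrow> real) \<Rightarrow> 'a set \<Rightarrow> ('a \<Rightarrow> real) \<Rightarrow> ennreal" where
  "modular p \<Omega> u = (\<integral>\<^sup>+ x. ennreal (\<bar>u x\<bar> powr p x) \<partial>(lebesgue_on \<Omega>))"

definition in_Lpx :: "('a::euclidean_space \<Rightarrow> real) \<Rightarrow> 'a set \<Rightarrow> ('a \<Rightarrow> real) \<Rightarrow> bool" where
  "in_Lpx p \<Omega> u \<longleftrightarrow> u \<in> borel_measurable (lebesgue_on \<Omega>) \<and> modular p \<Omega> u < \<infinity>"

definition lux_norm :: "('a::euclidean_space \<Rightarrow> real) \<Rightarrow> 'a set \<Rightarrow> ('a \<Rightarrow> real) \<Rightarrow> real" where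
  "lux_norm p \<Omega> u = Inf {\<mu>. \<mu> > 0 \<and> modular p \<Omega> (\<lambda>x. u x / \<mu>) \<le> 1}"

definition weak_grad :: "'a::euclidean_space set \<Rightarrow> ('a \<Rightarrow> real) \<Rightarrow> ('a \<Rightarrow> 'a) \<Rightarrow> bool" where
  "weak_grad \<Omega> u G \<longleftrightarrow>
     (\<forall>\<phi>. test_fun \<Omega> \<phi> \<longrightarrow> (\<forall>b\<in>Basis.
        integrable (lebesgue_on \<Omega>) (\<lambda>x. u x * frechet_derivative \<phi> (at x) b) \<and>
        integrable (lebesgue_on \<Omega>) (\<lambda>x. (G x \<bullet> b) * \<phi> x) \<and>
        integral\<^sup>L (lebesgue_on \<Omega>) (\<lambda>x. u x * frechet_derivative \<phi> (at x) b)
          = - integral\<^sup>L (lebesgue_on \<Omega>) (\<lambda>x. (G x \<bullet> b) * \<phi> x)))"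

text \<open>u belongs to E with (weak) gradient G: u and |G| lie in L^{p(x)}, G is the weak gradient
  of u, and u is a limit of test functions in the W^{1,p(x)} sense (which, by the Poincare
  inequality, is the closure of C_0^infinity under the norm |grad u|_{p(x)}).\<close>
definition in_E :: "('a::euclidean_space \<Rightarrow> real) \<Rightarrow> 'a set \<Rightarrow> ('a \<Rightarrow> real) \<Rightarrow> ('a \<Rightarrow> 'a) \<Rightarrow> bool" where
  "in_E p \<Omega> u G \<longleftrightarrow> in_Lpx p \<Omega> u \<and> G \<in> borel_measurable (lebesgue_on \<Omega>) \<and>
     in_Lpx p \<Omega> (\<lambda>x. norm (G x)) \<and> weak_grad \<Omega> u G \<and>
     (\<exists>\<phi> :: nat \<Rightarrow> 'a \<Rightarrow> real. (\<forall>k. test_fun \<Omega> (\<phi> k)) \<and>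
        (\<lambda>k. lux_norm p \<Omega> (\<lambda>x. norm (grad (\<phi> k) x - G x))) \<longlonglongrightarrow> 0 \<and>
        (\<lambda>k. lux_norm p \<Omega> (\<lambda>x. \<phi> k x - u x)) \<longlonglongrightarrow> 0)"

definition weak_solution ::
  "('a::euclidean_space \<Rightarrow> real) \<Rightarrow> 'a set \<Rightarrow> ('a \<Rightarrow> 'a \<Rightarrow> 'a) \<Rightarrow> real \<Rightarrow> real \<Rightarrow> real
    \<Rightarrow> ('a \<Rightarrow> real) \<Rightarrow> bool" where
  "weak_solution p \<Omega> a lam \<gamma> \<beta> u \<longleftrightarrow>
     (\<exists>G. in_E p \<Omega> u G \<and> (AE x in lebesgue_on \<Omega>. u x \<ge> 0) \<and>
       (\<forall>\<phi> H. in_E p \<Omega> \<phi> H \<longrightarrow>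
          integrable (lebesgue_on \<Omega>) (\<lambda>x. a x (G x) \<bullet> H x) \<and>
          integrable (lebesgue_on \<Omega>) (\<lambda>x. u x powr (\<gamma> - 1) * \<phi> x) \<and>
          integrable (lebesgue_on \<Omega>) (\<lambda>x. u x powr (\<beta> - 1) * \<phi> x) \<and>
          integral\<^sup>L (lebesgue_on \<Omega>) (\<lambda>x. a x (G x) \<bullet> H x)
           - lam * integral\<^sup>L (lebesgue_on \<Omega>) (\<lambda>x. u x powr (\<gamma> - 1) * \<phi> x)
           + lam * integral\<^sup>L (lebesgue_on \<Omega>) (\<lambda>x. u x powr (\<beta> - 1) * \<phi> x) = 0))"

end

theory Submission
  imports Defs "HOL-Complex_Analysis.Great_Picard" "HOL-Computational_Algebra.Polynomial"
begin

text \<open>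
  Solutions are fixed points of a descent map, which replaces deformation arguments. For
  \<open>u \<ge> 0\<close> the term \<open>- \<lambda> u\<^sup>\<gamma> / \<gamma>\<close> of the energy \<open>J\<close> is replaced by its tangent at \<open>u\<close>.
  The result is a uniformly convex majorant of \<open>J\<close>, by (A4), which touches \<open>J\<close> at \<open>u\<close>; let
  \<open>S u\<close> be its minimiser. Minimising sequences are Cauchy by (A4), \<open>S u\<close> is nonnegative, and
  \<open>S\<close> is continuous from \<open>L\<^sup>p\<^sup>(\<^sup>x\<^sup>)\<close> into the energy space, hence compact by the Rellich theorem. Moreover \<open>J\<close> does not
  exceed \<open>J u\<close> on the segment from \<open>u\<close> to \<open>S u\<close>. Every orbit of \<open>S\<close> therefore accumulates at a
  critical point whose energy is the limit of the energies along the orbit.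

  For large \<open>\<lambda>\<close> some multiple \<open>w\<close> of a bump function has negative energy, and its orbit gives
  one solution. As \<open>p\<^sup>+\<close> is below the critical exponent of \<open>p\<^sup>-\<close>, the energy is at least some
  \<open>c > 0\<close> on a small sphere. An orbit whose energy has dropped below \<open>c\<close> can no longer cross
  this sphere, so the parameters \<open>t \<in> [0, 1]\<close> for which the orbit of \<open>t w\<close> does so inside and
  those for which it does so outside form disjoint nonempty open sets. By connectedness some orbit
  keeps its energy above \<open>c\<close>; it gives the second solution.

  The Sobolev estimate is obtained in weak form by comparing a function with its mean values over
  balls of a radius that depends on the level, using only integration along rays.
\<close>

section \<open>Sobolev and Rellich estimates for compactly supported functions\<close>

text \<open>Distances are measured by modulars, and Luxemburg norms enter only through
  \<open>lux_tendsto_iff\<close>. For exponents between 1 and P the modular satisfies a triangle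
  inequality with factor 2^P, which suffices for completeness, continuity and compactness.
  Constant-exponent inequalities for r = p^- are carried over to p(x) by one recurring device, of
  which \<open>le_add_powr_mult\<close> is the simplest case: split at a threshold, bound small
  values by the measure of the set and large ones by the modular, and choose the threshold
  afterwards. The gap between p^+ and the critical exponent of p^- is used through one exponent q
  strictly inside it, once as an L^q bound that yields compactness and once as growth of higher
  order than the modular. The \<beta>-term is convex and stays in the majorant; the concave
  \<gamma>-term lies below its tangents. As \<gamma> < p^-, the energy is coercive for every
  \<lambda>, so orbits stay bounded.\<close>

lemma le_add_powr_mult:
  fixes a t r :: real
  assumes "a \<ge> 0" "t > 0" "r \<ge> 1"
  shows "a \<le> t + t powr (1 - r) * a powr r"
proof (cases "a \<le> t")
  case True
  then show ?thesis by (smt (verit) mult_nonneg_nonneg powr_ge_zero)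
next
  case False
  then have "a > 0" using assms by auto
  have "a = a powr (1 - r) * a powr r"
    using \<open>a > 0\<close> by (simp flip: powr_add)
  also have "\<dots> \<le> t powr (1 - r) * a powr r"
    using False assms by (intro mult_right_mono powr_mono2') auto
  finally show ?thesis using assms by linarith
qed

lemma nn_integral_lborel_scale:
  fixes F :: "'a::euclidean_space \<Rightarrow> ennreal"
  assumes [measurable]: "F \<in> borel_measurable borel" and c: "c > 0"
  shows "(\<integral>\<^sup>+z. F (x + c *\<^sub>R z) \<partial>lborel) = ennreal (c powr (- real DIM('a))) * (\<integral>\<^sup>+z. F z \<partial>lborel)"
proof -
  have "(\<integral>\<^sup>+z. F z \<partial>lborel) = (\<integral>\<^sup>+z. F z \<partial>(density (distr lborel borel (\<lambda>z. x + c *\<^sub>R z)) (\<lambda>_. \<bar>c\<bar>^DIM('a))))"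
    using lborel_affine[of c x] c by simp
  also have "\<dots> = (\<integral>\<^sup>+z. ennreal (c ^ DIM('a)) * F (x + c *\<^sub>R z) \<partial>lborel)"
    using c by (subst nn_integral_density) (auto simp: nn_integral_distr)
  also have "\<dots> = ennreal (c ^ DIM('a)) * (\<integral>\<^sup>+z. F (x + c *\<^sub>R z) \<partial>lborel)"
    by (rule nn_integral_cmult) simp
  finally have eq: "(\<integral>\<^sup>+z. F z \<partial>lborel) = ennreal (c ^ DIM('a)) * (\<integral>\<^sup>+z. F (x + c *\<^sub>R z) \<partial>lborel)" .
  have "ennreal (c powr (- real DIM('a))) * ennreal (c ^ DIM('a)) = 1"
    using c by (simp add: powr_minus powr_realpow flip: ennreal_mult')
  then show ?thesis unfolding eq by (metis mult.assoc mult_1)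
qed

lemma nn_integral_lborel_translate:
  fixes F :: "'a::euclidean_space \<Rightarrow> ennreal"
  assumes "F \<in> borel_measurable borel"
  shows "(\<integral>\<^sup>+z. F (z + x) \<partial>lborel) = (\<integral>\<^sup>+z. F z \<partial>lborel)"
  using nn_integral_lborel_scale[OF assms, of 1 x] by (simp add: add.commute)

lemma nn_integral_powr_at_top:
  fixes e :: real
  assumes "e > 1"
  shows "(\<integral>\<^sup>+t. ennreal (t powr (- e)) * indicator {1..} t \<partial>lborel) = ennreal (1 / (e - 1))"
proof -
  define F where "F = (\<lambda>t::real. - (t powr (1 - e)) / (e - 1))"
  have "((\<lambda>t::real. t powr (1 - e)) \<longlongrightarrow> 0) at_top"
    using assms by (intro tendsto_neg_powr) (auto intro: filterlim_ident)
  then have lim: "(F \<longlongrightarrow> 0) at_top"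
    unfolding F_def using tendsto_divide[OF tendsto_minus tendsto_const, of _ 0 at_top "e - 1"] assms by fastforce
  have der: "DERIV F t :> t powr (- e)" if "1 \<le> t" for t
  proof -
    have "DERIV F t :> - ((1 - e) * t powr (1 - e - 1)) / (e - 1)"
      unfolding F_def using that assms by (auto intro!: derivative_eq_intros)
    moreover have "- ((1 - e) * t powr (1 - e - 1)) / (e - 1) = t powr (- e)"
      using assms by (simp add: field_simps)
    ultimately show ?thesis by simp
  qed
  show ?thesis
    using nn_integral_FTC_atLeast[of "\<lambda>t. t powr (- e)" 1 F 0] der lim
    by (simp add: F_def)
qed

locale c1_compact =
  fixes \<phi> :: "'a::euclidean_space \<Rightarrow> real" and g :: "'a \<Rightarrow> 'a" and R :: real
  assumes deriv: "\<And>x. (\<phi> has_derivative (\<lambda>h. g x \<bullet> h)) (at x)"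
    and cont_g: "continuous_on UNIV g"
    and supp: "\<And>x. norm x \<ge> R \<Longrightarrow> \<phi> x = 0"
    and R_pos: "R > 0"
begin

lemma cont: "continuous_on UNIV \<phi>"
  by (rule has_derivative_continuous_on) (rule has_derivative_at_withinI[OF deriv])

lemma borel [measurable]: "\<phi> \<in> borel_measurable borel" "g \<in> borel_measurable borel"
  using cont cont_g by (auto intro: borel_measurable_continuous_onI)

lemma segment_bound:
  assumes "a \<le> b"
  shows "ennreal \<bar>\<phi> (x + b *\<^sub>R z) - \<phi> (x + a *\<^sub>R z)\<bar>
    \<le> (\<integral>\<^sup>+t. ennreal (norm z * norm (g (x + t *\<^sub>R z))) * indicator {a..b} t \<partial>lborel)"
proof -
  define F where "F = (\<lambda>t. \<phi> (x + t *\<^sub>R z))"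
  define f where "f = (\<lambda>t. g (x + t *\<^sub>R z) \<bullet> z)"
  have F: "(F has_vector_derivative f t) (at t within {a..b})" for t
  proof -
    have "(F has_derivative (\<lambda>h. g (x + t *\<^sub>R z) \<bullet> (h *\<^sub>R z))) (at t)"
      unfolding F_def
      by (rule has_derivative_compose[where g=\<phi> and f="\<lambda>t. x + t *\<^sub>R z", OF _ deriv])
        (auto intro!: derivative_eq_intros)
    then show ?thesis
      by (auto simp: has_vector_derivative_def f_def mult.commute intro: has_derivative_at_withinI)
  qed
  have cf: "continuous_on {a..b} f"
    unfolding f_def by (intro continuous_intros continuous_on_compose2[OF cont_g]) auto
  have FTC: "has_bochner_integral lborel (\<lambda>t. indicator {a..b} t *\<^sub>R f t) (F b - F a)"
    by (rule has_bochner_integral_FTC_Icc[OF assms F cf])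
  have "ennreal (norm (F b - F a)) \<le> (\<integral>\<^sup>+t. ennreal (norm (indicator {a..b} t *\<^sub>R f t)) \<partial>lborel)"
    using FTC integral_norm_bound_ennreal has_bochner_integral_iff by metis
  also have "\<dots> \<le> (\<integral>\<^sup>+t. ennreal (norm z * norm (g (x + t *\<^sub>R z))) * indicator {a..b} t \<partial>lborel)"
  proof (intro nn_integral_mono)
    fix t
    have "\<bar>g (x + t *\<^sub>R z) \<bullet> z\<bar> \<le> norm z * norm (g (x + t *\<^sub>R z))"
      by (metis Cauchy_Schwarz_ineq2 mult.commute)
    then show "ennreal (norm (indicator {a..b} t *\<^sub>R f t)) \<le> ennreal (norm z * norm (g (x + t *\<^sub>R z))) * indicator {a..b} t"
      by (auto simp: f_def indicator_def intro!: ennreal_leI)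
  qed
  finally show ?thesis by (simp add: F_def)
qed

text \<open>Far out on the ray the function vanishes, so the fundamental theorem of calculus has no
  boundary term there. The parameter starts at 1 and not at 0, away from the end where the Jacobian
  of the later substitution blows up.\<close>

lemma ray_bound:
  assumes "z \<noteq> 0"
  shows "ennreal \<bar>\<phi> (x + z)\<bar>
    \<le> (\<integral>\<^sup>+t. ennreal (norm z * norm (g (x + t *\<^sub>R z))) * indicator {1..} t \<partial>lborel)"
proof -
  define b where "b = max 1 ((R + norm x) / norm z)"
  have "b * norm z \<ge> R + norm x"
    using assms by (auto simp: b_def max_def field_simps)
  moreover have "norm (b *\<^sub>R z) = b * norm z" by (auto simp: b_def)
  moreover have "norm (x + b *\<^sub>R z) \<ge> norm (b *\<^sub>R z) - norm x"
    by (metis add.commute norm_diff_ineq)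
  ultimately have "\<phi> (x + b *\<^sub>R z) = 0" by (intro supp) linarith
  then have "ennreal \<bar>\<phi> (x + z)\<bar> = ennreal \<bar>\<phi> (x + b *\<^sub>R z) - \<phi> (x + 1 *\<^sub>R z)\<bar>" by simp
  also have "\<dots> \<le> (\<integral>\<^sup>+t. ennreal (norm z * norm (g (x + t *\<^sub>R z))) * indicator {1..b} t \<partial>lborel)"
    by (rule segment_bound) (simp add: b_def)
  also have "\<dots> \<le> (\<integral>\<^sup>+t. ennreal (norm z * norm (g (x + t *\<^sub>R z))) * indicator {1..} t \<partial>lborel)"
    by (intro nn_integral_mono) (auto simp: indicator_def)
  finally show ?thesis .
qed

text \<open>The ray estimate is integrated over the ball; the substitution at parameter t then
  contributes the Jacobian t^(-N). The parameter \<open>k\<close> is left free, and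
  \<open>level_set_bound\<close> balances its two occurrences.\<close>

lemma ball_average_bound:
  fixes h r D k :: real
  assumes r: "1 \<le> r" "r < real DIM('a)" and h: "h > 0" and k: "k > 0" and D: "D \<ge> 0"
    and gD: "(\<integral>\<^sup>+x. ennreal (norm (g x) powr r) \<partial>lborel) \<le> ennreal D"
  shows "(\<integral>\<^sup>+z. ennreal \<bar>\<phi> (x + z)\<bar> * indicator (ball 0 h) z \<partial>lborel)
     \<le> ennreal (h * (r / (DIM('a) - r)) * (k * measure lborel (ball (0::'a) h) + k powr (1 - r) * D))"
proof -
  let ?N = "real DIM('a)"
  define B where "B = ball (0::'a) h"
  have [measurable]: "B \<in> sets borel" by (simp add: B_def)
  define V where "V = measure lborel B"
  have V: "emeasure lborel B = ennreal V"
    unfolding V_def B_def using emeasure_lborel_ball_finite[of "0::'a" h]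
    by (intro emeasure_eq_ennreal_measure) auto
  have inner: "(\<integral>\<^sup>+z. ennreal (norm z * norm (g (x + t *\<^sub>R z))) * indicator {1..} t * indicator B z \<partial>lborel)
      \<le> ennreal (h * (k * V + k powr (1 - r) * D)) * (ennreal (t powr (- (?N / r))) * indicator {1..} t)" for t :: real
  proof (cases "t \<ge> 1")
    case True
    \<comment> \<open>The threshold has to decay in t: with this power both the threshold itself and
      \<open>\<tau> powr (1 - r)\<close> times the Jacobian t^(-N) are multiples of t^(-N/r), which
      is integrable at infinity because r < N.\<close>
    define \<tau> where "\<tau> = k * t powr (- (?N / r))"
    have \<tau>: "\<tau> > 0" using k True by (simp add: \<tau>_def)
    have "(\<integral>\<^sup>+z. ennreal (norm z * norm (g (x + t *\<^sub>R z))) * indicator {1..} t * indicator B z \<partial>lborel)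
      \<le> (\<integral>\<^sup>+z. ennreal h * (ennreal \<tau> * indicator B z + ennreal (\<tau> powr (1 - r)) * ennreal (norm (g (x + t *\<^sub>R z)) powr r)) \<partial>lborel)"
    proof (rule nn_integral_mono)
      fix z :: 'a
      define w where "w = norm (g (x + t *\<^sub>R z))"
      show "ennreal (norm z * w) * indicator {1..} t * indicator B z
        \<le> ennreal h * (ennreal \<tau> * indicator B z + ennreal (\<tau> powr (1 - r)) * ennreal (w powr r))"
      proof (cases "z \<in> B")
        case z: True
        have w: "w \<le> \<tau> + \<tau> powr (1 - r) * w powr r"
          by (rule le_add_powr_mult) (use r \<tau> in \<open>auto simp: w_def\<close>)
        have "norm z * w \<le> h * (\<tau> + \<tau> powr (1 - r) * w powr r)"
          using z by (intro mult_mono w) (use h in \<open>auto simp: w_def B_def\<close>)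
        then have "ennreal (norm z * w) \<le> ennreal (h * (\<tau> + \<tau> powr (1 - r) * w powr r))"
          by (rule ennreal_leI)
        also have "\<dots> = ennreal h * (ennreal \<tau> + ennreal (\<tau> powr (1 - r)) * ennreal (w powr r))"
          using h \<tau> by (simp add: ennreal_mult)
        finally show ?thesis using True z by simp
      qed simp
    qed
    also have "\<dots> = ennreal h * (ennreal \<tau> * ennreal V + ennreal (\<tau> powr (1 - r)) * (\<integral>\<^sup>+z. ennreal (norm (g (x + t *\<^sub>R z)) powr r) \<partial>lborel))"
      by (simp add: nn_integral_cmult nn_integral_add nn_integral_cmult_indicator V)
    also have "(\<integral>\<^sup>+z. ennreal (norm (g (x + t *\<^sub>R z)) powr r) \<partial>lborel) 
        = ennreal (t powr (- ?N)) * (\<integral>\<^sup>+z. ennreal (norm (g z) powr r) \<partial>lborel)"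
      by (rule nn_integral_lborel_scale[where F="\<lambda>z. ennreal (norm (g z) powr r)"]) (use True in simp_all)
    also have "ennreal h * (ennreal \<tau> * ennreal V + ennreal (\<tau> powr (1 - r)) * (ennreal (t powr (- ?N)) * (\<integral>\<^sup>+z. ennreal (norm (g z) powr r) \<partial>lborel)))
       \<le> ennreal h * (ennreal \<tau> * ennreal V + ennreal (\<tau> powr (1 - r)) * (ennreal (t powr (- ?N)) * ennreal D))"
      by (intro mult_left_mono add_left_mono gD) auto
    also have "\<dots> = ennreal (h * (\<tau> * V + \<tau> powr (1 - r) * t powr (- ?N) * D))"
      using h \<tau> D by (simp add: V_def ennreal_mult mult.assoc)
    also have "\<tau> powr (1 - r) * t powr (- ?N) = k powr (1 - r) * t powr (- (?N / r))"
    proof -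
      have "\<tau> powr (1 - r) = k powr (1 - r) * t powr (- (?N / r) * (1 - r))"
        using k True by (simp add: \<tau>_def powr_mult powr_powr)
      moreover have "- (?N / r) * (1 - r) + - ?N = - (?N / r)"
        using r by (simp add: field_simps)
      ultimately show ?thesis by (metis (no_types, lifting) mult.assoc powr_add)
    qed
    also have "h * (\<tau> * V + k powr (1 - r) * t powr (- (?N / r)) * D) = h * (k * V + k powr (1 - r) * D) * t powr (- (?N / r))"
      by (simp add: \<tau>_def algebra_simps)
    also have "ennreal \<dots> = ennreal (h * (k * V + k powr (1 - r) * D)) * (ennreal (t powr (- (?N / r))) * indicator {1..} t)"
      using True h k D by (simp add: ennreal_mult' V_def)
    finally show ?thesis .
  qed simp
  have "(\<integral>\<^sup>+z. ennreal \<bar>\<phi> (x + z)\<bar> * indicator B z \<partial>lborel)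
    \<le> (\<integral>\<^sup>+z. (\<integral>\<^sup>+t. ennreal (norm z * norm (g (x + t *\<^sub>R z))) * indicator {1..} t \<partial>lborel) * indicator B z \<partial>lborel)"
  proof (rule nn_integral_mono_AE)
    show "AE z in lborel. ennreal \<bar>\<phi> (x + z)\<bar> * indicator B z
      \<le> (\<integral>\<^sup>+t. ennreal (norm z * norm (g (x + t *\<^sub>R z))) * indicator {1..} t \<partial>lborel) * indicator B z"
      using AE_lborel_singleton[of "0::'a"] by eventually_elim (intro mult_right_mono ray_bound, auto)
  qed
  also have "\<dots> = (\<integral>\<^sup>+z. (\<integral>\<^sup>+t. ennreal (norm z * norm (g (x + t *\<^sub>R z))) * indicator {1..} t * indicator B z \<partial>lborel) \<partial>lborel)"
    by (simp add: nn_integral_multc)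
  also have "\<dots> = (\<integral>\<^sup>+t. (\<integral>\<^sup>+z. ennreal (norm z * norm (g (x + t *\<^sub>R z))) * indicator {1..} t * indicator B z \<partial>lborel) \<partial>lborel)"
    by (rule lborel_pair.Fubini') measurable
  also have "\<dots> \<le> (\<integral>\<^sup>+t. ennreal (h * (k * V + k powr (1 - r) * D)) * (ennreal (t powr (- (?N / r))) * indicator {1..} t) \<partial>lborel)"
    by (intro nn_integral_mono inner)
  also have "\<dots> = ennreal (h * (k * V + k powr (1 - r) * D)) * ennreal (1 / (?N / r - 1))"
    by (subst nn_integral_cmult) (use r in \<open>auto simp: nn_integral_powr_at_top\<close>)
  also have "\<dots> = ennreal (h * (k * V + k powr (1 - r) * D) * (1 / (?N / r - 1)))"
    using h k D by (subst ennreal_mult') (auto simp: V_def)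
  also have "h * (k * V + k powr (1 - r) * D) * (1 / (?N / r - 1)) = h * (r / (?N - r)) * (k * V + k powr (1 - r) * D)"
    using r by (simp add: field_simps)
  finally show ?thesis by (simp add: V_def B_def)
qed

text \<open>Tonelli exchanges the segment integral with the space integral, and every translate of
  \<open>norm (g x)\<close> has the same integral.\<close>

lemma translate_bound:
  shows "(\<integral>\<^sup>+x. ennreal \<bar>\<phi> (x + z) - \<phi> x\<bar> \<partial>lborel) \<le> ennreal (norm z) * (\<integral>\<^sup>+x. ennreal (norm (g x)) \<partial>lborel)"
proof -
  have "(\<integral>\<^sup>+x. ennreal \<bar>\<phi> (x + z) - \<phi> x\<bar> \<partial>lborel)
     \<le> (\<integral>\<^sup>+x. (\<integral>\<^sup>+t. ennreal (norm z * norm (g (x + t *\<^sub>R z))) * indicator {0..1} t \<partial>lborel) \<partial>lborel)"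
    using segment_bound[of 0 1 _ z] by (intro nn_integral_mono) simp
  also have "\<dots> = (\<integral>\<^sup>+t. (\<integral>\<^sup>+x. ennreal (norm z * norm (g (x + t *\<^sub>R z))) * indicator {0..1} t \<partial>lborel) \<partial>lborel)"
    by (rule lborel_pair.Fubini') measurable
  also have "\<dots> = (\<integral>\<^sup>+t. (\<integral>\<^sup>+x. ennreal (norm z) * ennreal (norm (g x)) \<partial>lborel) * indicator {0..1::real} t \<partial>lborel)"
  proof (rule nn_integral_cong)
    fix t :: real
    show "(\<integral>\<^sup>+x. ennreal (norm z * norm (g (x + t *\<^sub>R z))) * indicator {0..1} t \<partial>lborel)
      = (\<integral>\<^sup>+x. ennreal (norm z) * ennreal (norm (g x)) \<partial>lborel) * indicator {0..1::real} t"
      using nn_integral_lborel_translate[of "\<lambda>x. ennreal (norm z) * ennreal (norm (g x))" "t *\<^sub>R z"]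
      by (simp add: nn_integral_multc ennreal_mult')
  qed
  also have "\<dots> = ennreal (norm z) * (\<integral>\<^sup>+x. ennreal (norm (g x)) \<partial>lborel)"
    by (simp add: nn_integral_cmult nn_integral_cmult_indicator)
  finally show ?thesis .
qed

end

text \<open>Read off from \<open>level_set_bound\<close>: the factor 4 powr r comes from the
  threshold s / (4 h), and the inner quotient is the constant \<open>K\<close> in the choice of the
  radius h.\<close>

definition sobolev_const :: "real \<Rightarrow> real \<Rightarrow> real" where
  "sobolev_const N r = 4 powr r * ((8 * (r / (N - r))) powr r / unit_ball_vol N) powr (r / (N - r))"

text \<open>The cancelled term is an embedded real and hence finite, while \<open>X\<close> may be
  infinite.\<close>

lemma ennreal_cancel_half:
  assumes "ennreal (2 * a) \<le> ennreal a + X" "a \<ge> 0"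
  shows "ennreal a \<le> X"
proof (cases X)
  case (real y)
  then have "ennreal (2 * a) \<le> ennreal (a + y)" using assms by simp
  then have "2 * a \<le> a + y" using assms real by (subst (asm) ennreal_le_iff) auto
  then show ?thesis using real by (simp add: ennreal_leI)
qed simp

section \<open>Weak-type bound and subcritical Sobolev inequality\<close>

context c1_compact
begin

text \<open>On the bounded range [0, 1] no decay in t is required, so the threshold is constant. The
  double integral is left unevaluated because it still depends on \<open>x\<close>; after
  integration in \<open>x\<close>, translation invariance turns it into at most D times the volume
  of the ball.\<close>

lemma ball_oscillation_bound:
  fixes r h \<tau> :: real
  assumes r: "1 \<le> r" and h: "h > 0" and \<tau>: "\<tau> > 0"
  shows "(\<integral>\<^sup>+z. ennreal \<bar>\<phi> (x + z) - \<phi> x\<bar> * indicator (ball 0 h) z \<partial>lborel)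
    \<le> ennreal (h * \<tau> * measure lborel (ball (0::'a) h)) + ennreal (h * \<tau> powr (1 - r)) *
      (\<integral>\<^sup>+z. (\<integral>\<^sup>+t. ennreal (norm (g (x + t *\<^sub>R z)) powr r) * indicator {0..1} t * indicator (ball 0 h) z \<partial>lborel) \<partial>lborel)"
proof -
  define B where "B = ball (0::'a) h"
  have [measurable]: "B \<in> sets borel" by (simp add: B_def)
  define V where "V = measure lborel B"
  have V: "emeasure lborel B = ennreal V"
    unfolding V_def B_def using emeasure_lborel_ball_finite[of "0::'a" h]
    by (intro emeasure_eq_ennreal_measure) auto
  have pt: "ennreal \<bar>\<phi> (x + z) - \<phi> x\<bar> * indicator B z \<le> ennreal (h * \<tau>) * indicator B z + ennreal (h * \<tau> powr (1 - r)) *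
      (\<integral>\<^sup>+t. ennreal (norm (g (x + t *\<^sub>R z)) powr r) * indicator {0..1} t * indicator B z \<partial>lborel)" for z
  proof (cases "z \<in> B")
    case True
    have le: "norm z * norm (g y) \<le> h * \<tau> + h * \<tau> powr (1 - r) * norm (g y) powr r" for y
    proof -
      have "norm z * norm (g y) \<le> h * (\<tau> + \<tau> powr (1 - r) * norm (g y) powr r)"
        using True h by (intro mult_mono le_add_powr_mult \<tau> r) (auto simp: B_def)
      then show ?thesis by (simp add: algebra_simps)
    qed
    have "ennreal \<bar>\<phi> (x + z) - \<phi> x\<bar> \<le> (\<integral>\<^sup>+t. ennreal (norm z * norm (g (x + t *\<^sub>R z))) * indicator {0..1} t \<partial>lborel)"
      using segment_bound[of 0 1 x z] by simp
    also have "\<dots> \<le> (\<integral>\<^sup>+t. ennreal (h * \<tau>) * indicator {0..1::real} t + ennreal (h * \<tau> powr (1 - r)) *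
        (ennreal (norm (g (x + t *\<^sub>R z)) powr r) * indicator {0..1} t) \<partial>lborel)"
    proof (rule nn_integral_mono)
      fix t :: real
      have "ennreal (norm z * norm (g (x + t *\<^sub>R z))) \<le> ennreal (h * \<tau> + h * \<tau> powr (1 - r) * norm (g (x + t *\<^sub>R z)) powr r)"
        by (rule ennreal_leI[OF le])
      also have "\<dots> = ennreal (h * \<tau>) + ennreal (h * \<tau> powr (1 - r)) * ennreal (norm (g (x + t *\<^sub>R z)) powr r)"
        using h \<tau> by (simp add: ennreal_mult)
      finally show "ennreal (norm z * norm (g (x + t *\<^sub>R z))) * indicator {0..1} t
        \<le> ennreal (h * \<tau>) * indicator {0..1::real} t + ennreal (h * \<tau> powr (1 - r)) *
        (ennreal (norm (g (x + t *\<^sub>R z)) powr r) * indicator {0..1} t)"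
        by (auto simp: indicator_def)
    qed
    also have "\<dots> = ennreal (h * \<tau>) + ennreal (h * \<tau> powr (1 - r)) *
      (\<integral>\<^sup>+t. ennreal (norm (g (x + t *\<^sub>R z)) powr r) * indicator {0..1} t \<partial>lborel)"
      by (simp add: nn_integral_add nn_integral_cmult nn_integral_cmult_indicator)
    finally show ?thesis using True by simp
  qed simp
  have "(\<integral>\<^sup>+z. ennreal \<bar>\<phi> (x + z) - \<phi> x\<bar> * indicator B z \<partial>lborel) \<le> (\<integral>\<^sup>+z. ennreal (h * \<tau>) * indicator B z + ennreal (h * \<tau> powr (1 - r)) *
      (\<integral>\<^sup>+t. ennreal (norm (g (x + t *\<^sub>R z)) powr r) * indicator {0..1} t * indicator B z \<partial>lborel) \<partial>lborel)"
    by (rule nn_integral_mono[OF pt])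
  also have "\<dots> = ennreal (h * \<tau>) * ennreal V + ennreal (h * \<tau> powr (1 - r)) *
      (\<integral>\<^sup>+z. (\<integral>\<^sup>+t. ennreal (norm (g (x + t *\<^sub>R z)) powr r) * indicator {0..1} t * indicator B z \<partial>lborel) \<partial>lborel)"
    by (simp add: nn_integral_add nn_integral_cmult nn_integral_cmult_indicator V)
  also have "ennreal (h * \<tau>) * ennreal V = ennreal (h * \<tau> * V)"
    using h \<tau> by (simp add: ennreal_mult V_def)
  finally show ?thesis by (simp add: B_def V_def)
qed

text \<open>The radius \<open>h\<close> is chosen so that the mean of \<open>\<bar>\<phi>\<bar>\<close> over every ball of radius \<open>h\<close> is at most \<open>s / 4\<close>;
  where \<open>\<bar>\<phi>\<bar> > s\<close>, the mean oscillation over such a ball is then large.\<close>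

lemma level_set_bound:
  fixes r D s :: real
  assumes r: "1 \<le> r" "r < real DIM('a)" and D: "D > 0" and s: "s > 0"
    and gD: "(\<integral>\<^sup>+x. ennreal (norm (g x) powr r) \<partial>lborel) \<le> ennreal D"
  shows "emeasure lborel {x. s < \<bar>\<phi> x\<bar>}
    \<le> ennreal (sobolev_const (DIM('a)) r * (D / s powr r) powr (DIM('a) / (DIM('a) - r)))"
proof -
  define N where "N = real DIM('a)"
  have rN: "r < N" using r by (simp add: N_def)
  define c where "c = r / (N - r)"
  have c: "c > 0" using r rN by (simp add: c_def)
  define \<omega> where "\<omega> = unit_ball_vol N"
  have \<omega>: "\<omega> > 0" by (simp add: \<omega>_def N_def)
  define X where "X = D / s powr r"
  have X: "X > 0" using D s by (simp add: X_def)
  define K where "K = (8 * c) powr r / \<omega>"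
  have K: "K > 0" using c \<omega> by (simp add: K_def)
  \<comment> \<open>This solves h powr (N - r) = K * X, which is the condition k powr r * V = D for
    the \<open>k\<close> below; it makes the two terms of \<open>ball_average_bound\<close>
    equal.\<close>
  define h where "h = (K * X) powr (1 / (N - r))"
  have h: "h > 0" using K X by (simp add: h_def)
  define k where "k = s / (8 * h * c)"
  have k: "k > 0" using s h c by (simp add: k_def)
  \<comment> \<open>The gradient-free term of the oscillation estimate becomes s V / 4. Together
    with the mean it uses up half of s V, and the other half must be paid for by the
    gradient.\<close>
  define \<tau> where "\<tau> = s / (4 * h)"
  have \<tau>: "\<tau> > 0" using s h by (simp add: \<tau>_def)
  define B where "B = ball (0::'a) h"
  have [measurable]: "B \<in> sets borel" by (simp add: B_def)
  define V where "V = measure lborel B"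
  have V: "emeasure lborel B = ennreal V"
    unfolding V_def B_def using emeasure_lborel_ball_finite[of "0::'a" h]
    by (intro emeasure_eq_ennreal_measure) auto
  have Vh: "V = \<omega> * h powr N"
    using h by (simp add: V_def B_def content_ball \<omega>_def N_def powr_realpow)
  have V0: "V > 0" using Vh \<omega> h by simp
  have kr: "k powr r * V = D"
  proof -
    have "h powr N = h powr r * h powr (N - r)" by (simp flip: powr_add)
    also have "h powr (N - r) = K * X" using rN K X by (simp add: h_def powr_powr)
    finally have "k powr r * V = (s powr r / ((8 * c) powr r * h powr r)) * (\<omega> * (h powr r * (K * X)))"
      using s h c by (simp add: Vh k_def powr_divide powr_mult mult.commute mult.left_commute)
    also have "\<dots> = s powr r * X"
      using \<omega> h c by (simp add: K_def)
    also have "\<dots> = D" using s by (simp add: X_def)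
    finally show ?thesis .
  qed
  have k1: "k powr (1 - r) * D = k * V"
    using k by (simp add: powr_diff flip: kr)
  define \<Xi> where "\<Xi> = (\<lambda>x. \<integral>\<^sup>+z. (\<integral>\<^sup>+t. ennreal (norm (g (x + t *\<^sub>R z)) powr r) * indicator {0..1} t * indicator B z \<partial>lborel) \<partial>lborel)"
  have [measurable]: "\<Xi> \<in> borel_measurable borel" unfolding \<Xi>_def by measurable
  have pt: "ennreal (s * V / 2) * indicator {x. s < \<bar>\<phi> x\<bar>} x \<le> ennreal (h * \<tau> powr (1 - r)) * \<Xi> x" for x
  proof (cases "s < \<bar>\<phi> x\<bar>")
    case True
    have "ennreal (2 * (s * V / 2)) = (\<integral>\<^sup>+z. ennreal s * indicator B z \<partial>lborel)"
      using s by (simp add: nn_integral_cmult_indicator V ennreal_mult V0 less_imp_le)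
    also have "\<dots> \<le> (\<integral>\<^sup>+z. ennreal \<bar>\<phi> (x + z)\<bar> * indicator B z + ennreal \<bar>\<phi> (x + z) - \<phi> x\<bar> * indicator B z \<partial>lborel)"
    proof (rule nn_integral_mono)
      fix z
      have "s \<le> \<bar>\<phi> (x + z)\<bar> + \<bar>\<phi> (x + z) - \<phi> x\<bar>" using True by linarith
      then have "ennreal s \<le> ennreal \<bar>\<phi> (x + z)\<bar> + ennreal \<bar>\<phi> (x + z) - \<phi> x\<bar>"
        by (simp add: ennreal_leI flip: ennreal_plus)
      then show "ennreal s * indicator B z \<le> ennreal \<bar>\<phi> (x + z)\<bar> * indicator B z + ennreal \<bar>\<phi> (x + z) - \<phi> x\<bar> * indicator B z"
        by (auto simp: indicator_def)
    qed
    also have "\<dots> = (\<integral>\<^sup>+z. ennreal \<bar>\<phi> (x + z)\<bar> * indicator B z \<partial>lborel) + (\<integral>\<^sup>+z. ennreal \<bar>\<phi> (x + z) - \<phi> x\<bar> * indicator B z \<partial>lborel)"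
      by (rule nn_integral_add) measurable
    also have "\<dots> \<le> ennreal (h * c * (k * V + k powr (1 - r) * D)) + (ennreal (h * \<tau> * V) + ennreal (h * \<tau> powr (1 - r)) * \<Xi> x)"
      using ball_average_bound[OF r h k _ gD, of x] ball_oscillation_bound[OF r(1) h \<tau>, of x] D
      by (intro add_mono) (auto simp: B_def V_def \<Xi>_def c_def N_def)
    also have "h * c * (k * V + k powr (1 - r) * D) = s * V / 4"
      unfolding k1 using h c by (simp add: k_def)
    also have "h * \<tau> * V = s * V / 4"
      using h by (simp add: \<tau>_def)
    also have "ennreal (s * V / 4) + (ennreal (s * V / 4) + ennreal (h * \<tau> powr (1 - r)) * \<Xi> x)
      = ennreal (s * V / 2) + ennreal (h * \<tau> powr (1 - r)) * \<Xi> x"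
    proof -
      have "ennreal (s * V / 4) + ennreal (s * V / 4) = ennreal (s * V / 4 + s * V / 4)"
        using s V0 by (intro ennreal_plus[symmetric]) auto
      also have "s * V / 4 + s * V / 4 = s * V / 2" by simp
      finally show ?thesis by (simp only: add.assoc[symmetric])
    qed
    finally have "ennreal (2 * (s * V / 2)) \<le> ennreal (s * V / 2) + ennreal (h * \<tau> powr (1 - r)) * \<Xi> x" .
    then have "ennreal (s * V / 2) \<le> ennreal (h * \<tau> powr (1 - r)) * \<Xi> x"
      by (rule ennreal_cancel_half) (use s V0 in simp)
    then show ?thesis using True by simp
  qed simp
  have "(\<integral>\<^sup>+x. \<Xi> x \<partial>lborel) = (\<integral>\<^sup>+z. (\<integral>\<^sup>+x. (\<integral>\<^sup>+t. ennreal (norm (g (x + t *\<^sub>R z)) powr r) * indicator {0..1} t * indicator B z \<partial>lborel) \<partial>lborel) \<partial>lborel)"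
    unfolding \<Xi>_def by (rule lborel_pair.Fubini') measurable
  also have "\<dots> = (\<integral>\<^sup>+z. (\<integral>\<^sup>+t. (\<integral>\<^sup>+x. ennreal (norm (g (x + t *\<^sub>R z)) powr r) * indicator {0..1} t * indicator B z \<partial>lborel) \<partial>lborel) \<partial>lborel)"
    by (intro nn_integral_cong lborel_pair.Fubini') measurable
  also have "\<dots> = (\<integral>\<^sup>+z. (\<integral>\<^sup>+t. (\<integral>\<^sup>+x. ennreal (norm (g x) powr r) \<partial>lborel) * indicator {0..1::real} t * indicator B z \<partial>lborel) \<partial>lborel)"
  proof (intro nn_integral_cong)
    fix t :: real and z :: 'a
    show "(\<integral>\<^sup>+x. ennreal (norm (g (x + t *\<^sub>R z)) powr r) * indicator {0..1} t * indicator B z \<partial>lborel)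
      = (\<integral>\<^sup>+x. ennreal (norm (g x) powr r) \<partial>lborel) * indicator {0..1::real} t * indicator B z"
      using nn_integral_lborel_translate[of "\<lambda>x. ennreal (norm (g x) powr r)" "t *\<^sub>R z"]
      by (simp add: nn_integral_multc)
  qed
  also have "\<dots> = (\<integral>\<^sup>+x. ennreal (norm (g x) powr r) \<partial>lborel) * ennreal V"
    by (simp add: nn_integral_multc nn_integral_cmult_indicator V)
  also have "\<dots> \<le> ennreal D * ennreal V" by (intro mult_right_mono gD) simp
  finally have \<Xi>_int: "(\<integral>\<^sup>+x. \<Xi> x \<partial>lborel) \<le> ennreal D * ennreal V" .
  have meas[measurable]: "{x. s < \<bar>\<phi> x\<bar>} \<in> sets borel" by measurable
  have "ennreal (s * V / 2) * emeasure lborel {x. s < \<bar>\<phi> x\<bar>} = (\<integral>\<^sup>+x. ennreal (s * V / 2) * indicator {x. s < \<bar>\<phi> x\<bar>} x \<partial>lborel)"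
    by (subst nn_integral_cmult_indicator) auto
  also have "\<dots> \<le> (\<integral>\<^sup>+x. ennreal (h * \<tau> powr (1 - r)) * \<Xi> x \<partial>lborel)"
    by (rule nn_integral_mono[OF pt])
  also have "\<dots> = ennreal (h * \<tau> powr (1 - r)) * (\<integral>\<^sup>+x. \<Xi> x \<partial>lborel)"
    by (rule nn_integral_cmult) measurable
  also have "\<dots> \<le> ennreal (h * \<tau> powr (1 - r)) * (ennreal D * ennreal V)"
    by (intro mult_left_mono \<Xi>_int) simp
  also have "\<dots> = ennreal (s * V / 2) * ennreal (2 * h / s * \<tau> powr (1 - r) * D)"
    using s h V0 D by (simp flip: ennreal_mult)
  finally have "emeasure lborel {x. s < \<bar>\<phi> x\<bar>} \<le> ennreal (2 * h / s * \<tau> powr (1 - r) * D)"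
    using s V0 by (subst (asm) ennreal_mult_le_mult_iff) auto
  also have "\<dots> \<le> ennreal (sobolev_const N r * X powr (N / (N - r)))"
  proof (rule ennreal_leI)
    \<comment> \<open>The left side equals D / (2 \<tau>^r). Inserting h produces the power N / (N -
      r) of X, and the remaining factor 1/2 is discarded.\<close>
    have "2 * h / s * \<tau> powr (1 - r) * D = 2 * h / s * \<tau> * (D / \<tau> powr r)"
      using \<tau> by (simp add: powr_diff)
    also have "2 * h / s * \<tau> = 1 / 2" using h s by (simp add: \<tau>_def)
    also have "D / \<tau> powr r = 4 powr r * h powr r * X"
      using h s by (simp add: \<tau>_def X_def powr_divide powr_mult)
    also have "h powr r = K powr (r / (N - r)) * X powr (r / (N - r))"
      using K X by (simp add: h_def powr_powr powr_mult)
    also have "1 / 2 * (4 powr r * (K powr (r / (N - r)) * X powr (r / (N - r))) * X)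
        = 1 / 2 * (sobolev_const N r * (X powr (r / (N - r)) * X powr 1))"
      using X by (simp add: sobolev_const_def K_def c_def \<omega>_def)
    also have "X powr (r / (N - r)) * X powr 1 = X powr (N / (N - r))"
      unfolding powr_add[symmetric] using rN by (intro arg_cong[where f="(powr) X"]) (simp add: field_simps)
    finally have eq: "2 * h / s * \<tau> powr (1 - r) * D = 1 / 2 * (sobolev_const N r * X powr (N / (N - r)))" .
    have half: "1 / 2 * Y \<le> Y" if "0 \<le> Y" for Y :: real using that by simp
    show "2 * h / s * \<tau> powr (1 - r) * D \<le> sobolev_const N r * X powr (N / (N - r))"
      unfolding eq by (rule half) (simp add: sobolev_const_def)
  qed
  finally show ?thesis by (simp add: N_def X_def)
qed

text \<open>Summation of the weak-type bound over dyadic levels: below the critical exponent the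
  series is geometric with ratio 2 powr (q - N r / (N - r)) < 1, which is the denominator in the
  constant.\<close>

lemma sobolev:
  fixes r D q \<mu> :: real
  assumes r: "1 \<le> r" "r < real DIM('a)" and D: "D > 0"
    and gD: "(\<integral>\<^sup>+x. ennreal (norm (g x) powr r) \<partial>lborel) \<le> ennreal D"
    and q: "0 < q" "q < DIM('a) * r / (DIM('a) - r)"
    and S: "S \<in> sets lborel" "emeasure lborel S = ennreal \<mu>" "\<mu> \<ge> 0" "\<And>x. x \<notin> S \<Longrightarrow> \<phi> x = 0"
  shows "(\<integral>\<^sup>+x. ennreal (\<bar>\<phi> x\<bar> powr q) \<partial>lborel)
    \<le> ennreal ((\<mu> + 2 powr q * sobolev_const (DIM('a)) r / (1 - 2 powr (q - DIM('a) * r / (DIM('a) - r)))) * D powr (q / r))"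
proof -
  define N where "N = real DIM('a)"
  have rN: "r < N" using r by (simp add: N_def)
  define C where "C = sobolev_const N r"
  have C: "C \<ge> 0" by (simp add: C_def sobolev_const_def)
  define \<rho> where "\<rho> = 2 powr (q - N * r / (N - r))"
  have \<rho>: "0 < \<rho>" "\<rho> < 1" using q using powr_less_mono[of "q - N * r / (N - r)" 0 2] by (auto simp: \<rho>_def N_def)
  \<comment> \<open>Scaling the levels by D powr (1 / r) makes the result homogeneous of degree q /
    r in D; values below \<open>s 0\<close> contribute only through the measure of
    \<open>S\<close>.\<close>
  define s where "s = (\<lambda>j::nat. D powr (1 / r) * 2 ^ j)"
  have s: "s j > 0" for j using D by (simp add: s_def)
  define E where "E = (\<lambda>j. {x. s j < \<bar>\<phi> x\<bar>})"
  have [measurable]: "E j \<in> sets borel" for j unfolding E_def by measurable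
  have [measurable]: "S \<in> sets borel" using S by simp
  \<comment> \<open>A point of \<open>E j\<close> outside \<open>E (Suc j)\<close> has absolute
    value at most \<open>s (Suc j)\<close>, hence the weight is taken from the next level.\<close>
  define w where "w = (\<lambda>j. s (Suc j) powr q)"
  have pt: "ennreal (\<bar>\<phi> x\<bar> powr q) \<le> ennreal (D powr (q / r)) * indicator S x + (\<Sum>j. ennreal (w j) * indicator (E j) x)" for x
  proof (cases "\<bar>\<phi> x\<bar> \<le> s 0")
    case True
    show ?thesis
    proof (cases "x \<in> S")
      case x: True
      have "\<bar>\<phi> x\<bar> powr q \<le> s 0 powr q" using True q by (intro powr_mono2) auto
      also have "\<dots> = D powr (q / r)" using D by (simp add: s_def powr_powr)
      finally have "ennreal (\<bar>\<phi> x\<bar> powr q) \<le> ennreal (D powr (q / r)) * indicator S x"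
        using x by (simp add: ennreal_leI)
      then show ?thesis by (rule add_increasing2[rotated]) simp
    next
      case False
      then show ?thesis using S q by simp
    qed
  next
    case False
    have "\<exists>n. \<bar>\<phi> x\<bar> \<le> s n"
    proof -
      obtain n where "\<bar>\<phi> x\<bar> / D powr (1 / r) < 2 ^ n" using real_arch_pow[of 2] by auto
      then have "\<bar>\<phi> x\<bar> \<le> s n" using D by (simp add: s_def field_simps)
      then show ?thesis ..
    qed
    define n where "n = (LEAST n. \<bar>\<phi> x\<bar> \<le> s n)"
    have n: "\<bar>\<phi> x\<bar> \<le> s n" unfolding n_def by (rule LeastI_ex) fact
    then have "n \<noteq> 0" using False by (intro notI) simp
    then obtain j where j: "n = Suc j" by (cases n) auto
    have "\<not> \<bar>\<phi> x\<bar> \<le> s j" using not_less_Least[of j "\<lambda>n. \<bar>\<phi> x\<bar> \<le> s n"] j n_def by auto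
    then have "x \<in> E j" by (simp add: E_def)
    have "ennreal (\<bar>\<phi> x\<bar> powr q) \<le> ennreal (w j) * indicator (E j) x"
      using \<open>x \<in> E j\<close> n j q by (auto simp: w_def intro!: ennreal_leI powr_mono2)
    also have "\<dots> \<le> (\<Sum>j. ennreal (w j) * indicator (E j) x)"
    proof -
      define F where "F = (\<lambda>j. ennreal (w j) * indicator (E j) x)"
      have "sum F {j} \<le> suminf F" by (rule sum_le_suminf) auto
      then have "F j \<le> suminf F" by simp
      then show ?thesis unfolding F_def .
    qed
    finally show ?thesis by (rule add_increasing[rotated]) simp
  qed
  have level: "ennreal (w j) * emeasure lborel (E j) \<le> ennreal (D powr (q / r) * 2 powr q * C * \<rho> ^ j)" for j
  proof -
    have "emeasure lborel (E j) \<le> ennreal (C * (D / s j powr r) powr (N / (N - r)))"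
      using level_set_bound[OF r D s gD] by (simp add: E_def C_def N_def)
    then have "ennreal (w j) * emeasure lborel (E j) \<le> ennreal (w j) * ennreal (C * (D / s j powr r) powr (N / (N - r)))"
      by (rule mult_left_mono) simp
    also have "\<dots> = ennreal (w j * (C * (D / s j powr r) powr (N / (N - r))))"
      by (simp add: ennreal_mult w_def C)
    also have "D / s j powr r = 2 powr (- (real j * r))"
    proof -
      have "s j powr r = D * 2 powr (real j * r)"
        using D r by (simp add: s_def powr_mult powr_powr flip: powr_realpow)
      then show ?thesis using D by (simp add: powr_minus field_simps)
    qed
    also have "((2::real) powr (- (real j * r))) powr (N / (N - r)) = 2 powr (- (real j) * (N * r / (N - r)))"
      unfolding powr_powr by (rule arg_cong[where f="(powr) 2"]) simp
    also have wj: "w j = D powr (q / r) * 2 powr q * 2 powr (real j * q)"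
    proof -
      have "w j = D powr (q / r) * (2 ^ Suc j) powr q"
        using D by (simp only: w_def s_def powr_mult powr_powr) simp
      also have "(2 ^ Suc j :: real) = 2 powr (1 + real j)"
        using powr_realpow[of 2 "Suc j"] by simp
      also have "(2 powr (1 + real j)) powr q = 2 powr q * 2 powr (real j * q)"
        by (simp add: powr_powr algebra_simps flip: powr_add)
      finally show ?thesis by simp
    qed
    also have "D powr (q / r) * 2 powr q * 2 powr (real j * q) * (C * 2 powr (- (real j) * (N * r / (N - r))))
       = D powr (q / r) * 2 powr q * C * (2 powr (real j * q) * 2 powr (- (real j) * (N * r / (N - r))))"
      by simp
    also have "2 powr (real j * q) * 2 powr (- (real j) * (N * r / (N - r))) = \<rho> powr real j"
      unfolding \<rho>_def powr_powr powr_add[symmetric] by (simp add: algebra_simps)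
    also have "\<dots> = \<rho> ^ j" using \<rho> by (simp add: powr_realpow)
    finally show ?thesis unfolding wj .
  qed
  have "(\<integral>\<^sup>+x. ennreal (\<bar>\<phi> x\<bar> powr q) \<partial>lborel)
    \<le> (\<integral>\<^sup>+x. ennreal (D powr (q / r)) * indicator S x + (\<Sum>j. ennreal (w j) * indicator (E j) x) \<partial>lborel)"
    by (rule nn_integral_mono[OF pt])
  also have "\<dots> = ennreal (D powr (q / r)) * emeasure lborel S + (\<Sum>j. ennreal (w j) * emeasure lborel (E j))"
    by (simp add: nn_integral_add nn_integral_suminf nn_integral_cmult_indicator)
  also have "\<dots> \<le> ennreal (D powr (q / r)) * emeasure lborel S + (\<Sum>j. ennreal (D powr (q / r) * 2 powr q * C * \<rho> ^ j))"
    by (intro add_left_mono suminf_le level) auto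
  also have "(\<Sum>j. ennreal (D powr (q / r) * 2 powr q * C * \<rho> ^ j)) = ennreal (D powr (q / r) * 2 powr q * C * (1 / (1 - \<rho>)))"
  proof (rule suminf_ennreal_eq)
    show "0 \<le> D powr (q / r) * 2 powr q * C * \<rho> ^ j" for j using C \<rho> by simp
    show "(\<lambda>j. D powr (q / r) * 2 powr q * C * \<rho> ^ j) sums (D powr (q / r) * 2 powr q * C * (1 / (1 - \<rho>)))"
      using \<rho> by (intro sums_mult geometric_sums) auto
  qed
  also have "ennreal (D powr (q / r)) * emeasure lborel S + ennreal (D powr (q / r) * 2 powr q * C * (1 / (1 - \<rho>)))
    = ennreal ((\<mu> + 2 powr q * C / (1 - \<rho>)) * D powr (q / r))"
    using S C \<rho> by (simp add: algebra_simps flip: ennreal_mult ennreal_plus)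
  finally show ?thesis by (simp add: C_def \<rho>_def N_def)
qed

end

section \<open>Compactness in L^1 through ball means\<close>

context c1_compact
begin

lemma integrable_translate: "integrable lborel (\<lambda>z. indicator (ball 0 h) z *\<^sub>R \<phi> (x + z))"
proof -
  have "bounded (\<phi> ` cball 0 R)"
    by (intro compact_imp_bounded compact_continuous_image continuous_on_subset[OF cont]) auto
  then obtain K where K: "\<And>x. x \<in> cball 0 R \<Longrightarrow> norm (\<phi> x) \<le> K"
    unfolding bounded_iff by blast
  have "norm (\<phi> x) \<le> max 0 K" for x
    using K[of x] supp[of x] by (cases "norm x \<le> R") auto
  then show ?thesis
    by (intro integrableI_bounded_set[where A="ball (0::'a) h" and B="max 0 K"])
      (use emeasure_lborel_ball_finite in \<open>auto simp: indicator_def\<close>)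
qed

text \<open>Not divided by the volume of the ball, so that the sup bound and the Lipschitz bound
  below are the same for all radii.\<close>

definition ball_integral :: "real \<Rightarrow> 'a \<Rightarrow> real" where
  "ball_integral h x = (\<integral>z. indicator (ball 0 h) z *\<^sub>R \<phi> (x + z) \<partial>lborel)"

lemma ball_integral_measurable [measurable]: "ball_integral h \<in> borel_measurable borel"
proof -
  define B where "B = ball (0::'a) h"
  have [measurable]: "B \<in> sets borel" by (simp add: B_def)
  show ?thesis unfolding ball_integral_def B_def[symmetric] by measurable
qed

lemma ball_integral_lipschitz:
  assumes "(\<integral>\<^sup>+x. ennreal (norm (g x)) \<partial>lborel) \<le> ennreal D" "D \<ge> 0"
  shows "\<bar>ball_integral h x - ball_integral h y\<bar> \<le> norm (x - y) * D"
proof -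
  have "ennreal \<bar>ball_integral h x - ball_integral h y\<bar> = 
      ennreal (norm (\<integral>z. indicator (ball 0 h) z *\<^sub>R \<phi> (x + z) - indicator (ball 0 h) z *\<^sub>R \<phi> (y + z) \<partial>lborel))"
    unfolding ball_integral_def by (subst Bochner_Integration.integral_diff[OF integrable_translate integrable_translate]) simp
  also have "\<dots> \<le> (\<integral>\<^sup>+z. norm (indicator (ball 0 h) z *\<^sub>R \<phi> (x + z) - indicator (ball 0 h) z *\<^sub>R \<phi> (y + z)) \<partial>lborel)"
    by (intro integral_norm_bound_ennreal Bochner_Integration.integrable_diff integrable_translate)
  also have "\<dots> \<le> (\<integral>\<^sup>+z. ennreal \<bar>\<phi> ((z + y) + (x - y)) - \<phi> (z + y)\<bar> \<partial>lborel)"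
    by (intro nn_integral_mono ennreal_leI) (auto simp: indicator_def add.commute)
  also have "\<dots> = (\<integral>\<^sup>+z. ennreal \<bar>\<phi> (z + (x - y)) - \<phi> z\<bar> \<partial>lborel)"
    by (rule nn_integral_lborel_translate[where F="\<lambda>z. ennreal \<bar>\<phi> (z + (x - y)) - \<phi> z\<bar>"]) measurable
  also have "\<dots> \<le> ennreal (norm (x - y)) * (\<integral>\<^sup>+x. ennreal (norm (g x)) \<partial>lborel)"
    by (rule translate_bound)
  also have "\<dots> \<le> ennreal (norm (x - y)) * ennreal D" by (intro mult_left_mono assms) simp
  also have "\<dots> = ennreal (norm (x - y) * D)" by (simp add: ennreal_mult')
  finally show ?thesis using assms(2) by (subst (asm) ennreal_le_iff) auto
qed

text \<open>A translation by 2 R moves the support off itself, so the translation estimate already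
  controls the function: a Poincare inequality in L^1.\<close>

lemma L1_bound:
  assumes "(\<integral>\<^sup>+x. ennreal (norm (g x)) \<partial>lborel) \<le> ennreal D" "D \<ge> 0"
  shows "(\<integral>\<^sup>+x. ennreal \<bar>\<phi> x\<bar> \<partial>lborel) \<le> ennreal (2 * R * D)"
proof -
  define z :: 'a where "z = (2 * R) *\<^sub>R (SOME b. b \<in> Basis)"
  have nz: "norm z = 2 * R" using R_pos by (simp add: z_def some_in_eq)
  have "\<bar>\<phi> x\<bar> \<le> \<bar>\<phi> (x + z) - \<phi> x\<bar>" for x
  proof (cases "norm x \<ge> R")
    case True
    then show ?thesis using supp by simp
  next
    case False
    have "norm (x + z) \<ge> norm z - norm x" by (metis add.commute norm_diff_ineq)
    then have "\<phi> (x + z) = 0" using False nz by (intro supp) linarith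
    then show ?thesis by simp
  qed
  then have "(\<integral>\<^sup>+x. ennreal \<bar>\<phi> x\<bar> \<partial>lborel) \<le> (\<integral>\<^sup>+x. ennreal \<bar>\<phi> (x + z) - \<phi> x\<bar> \<partial>lborel)"
    by (intro nn_integral_mono ennreal_leI)
  also have "\<dots> \<le> ennreal (norm z) * (\<integral>\<^sup>+x. ennreal (norm (g x)) \<partial>lborel)"
    by (rule translate_bound)
  also have "\<dots> \<le> ennreal (norm z) * ennreal D" by (intro mult_left_mono assms) simp
  also have "\<dots> = ennreal (2 * R * D)" unfolding nz using R_pos by (simp add: ennreal_mult')
  finally show ?thesis .
qed

lemma ball_integral_bound:
  assumes "(\<integral>\<^sup>+x. ennreal (norm (g x)) \<partial>lborel) \<le> ennreal D" "D \<ge> 0"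
  shows "\<bar>ball_integral h x\<bar> \<le> 2 * R * D"
proof -
  have "ennreal \<bar>ball_integral h x\<bar> \<le> (\<integral>\<^sup>+z. norm (indicator (ball 0 h) z *\<^sub>R \<phi> (x + z)) \<partial>lborel)"
    unfolding ball_integral_def using integral_norm_bound_ennreal[OF integrable_translate] by simp
  also have "\<dots> \<le> (\<integral>\<^sup>+z. ennreal \<bar>\<phi> (z + x)\<bar> \<partial>lborel)"
    by (intro nn_integral_mono ennreal_leI) (auto simp: indicator_def add.commute)
  also have "\<dots> = (\<integral>\<^sup>+z. ennreal \<bar>\<phi> z\<bar> \<partial>lborel)"
    by (rule nn_integral_lborel_translate[where F="\<lambda>z. ennreal \<bar>\<phi> z\<bar>"]) measurable
  also have "\<dots> \<le> ennreal (2 * R * D)" by (rule L1_bound[OF assms])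
  finally show ?thesis using assms(2) R_pos by (subst (asm) ennreal_le_iff) auto
qed

text \<open>The mean over a ball of radius h is an average of translates by less than h, each at L^1
  distance at most h D.\<close>

lemma ball_integral_approx:
  assumes "(\<integral>\<^sup>+x. ennreal (norm (g x)) \<partial>lborel) \<le> ennreal D" "D \<ge> 0" and h: "h > 0"
  shows "(\<integral>\<^sup>+x. ennreal \<bar>\<phi> x - ball_integral h x / measure lborel (ball (0::'a) h)\<bar> \<partial>lborel) \<le> ennreal (h * D)"
proof -
  define B where "B = ball (0::'a) h"
  have [measurable]: "B \<in> sets borel" by (simp add: B_def)
  define V where "V = measure lborel B"
  have V: "emeasure lborel B = ennreal V"
    unfolding V_def B_def using emeasure_lborel_ball_finite[of "0::'a" h]
    by (intro emeasure_eq_ennreal_measure) auto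
  have V0: "V > 0" unfolding V_def B_def by (rule content_ball_pos[OF h])
  have intB: "integrable lborel (\<lambda>z. indicator B z *\<^sub>R c)" for c :: real
    using V by (intro integrable_scaleR_left integrable_real_indicator) auto
  have pt: "ennreal V * ennreal \<bar>\<phi> x - ball_integral h x / V\<bar> \<le> (\<integral>\<^sup>+z. ennreal \<bar>\<phi> (x + z) - \<phi> x\<bar> * indicator B z \<partial>lborel)" for x
  proof -
    have "V * \<bar>\<phi> x - ball_integral h x / V\<bar> = \<bar>V * \<phi> x - ball_integral h x\<bar>"
      using V0 by (simp add: abs_if field_simps)
    also have "V * \<phi> x = (\<integral>z. indicator B z *\<^sub>R \<phi> x \<partial>lborel)"
      by (simp add: V_def)
    also have "\<dots> - ball_integral h x = (\<integral>z. indicator B z *\<^sub>R \<phi> x - indicator B z *\<^sub>R \<phi> (x + z) \<partial>lborel)"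
      using integrable_translate[of h x] intB[of "\<phi> x"] unfolding ball_integral_def B_def
      by (intro Bochner_Integration.integral_diff[symmetric])
    finally have "ennreal (V * \<bar>\<phi> x - ball_integral h x / V\<bar>) = ennreal (norm (\<integral>z. indicator B z *\<^sub>R \<phi> x - indicator B z *\<^sub>R \<phi> (x + z) \<partial>lborel))"
      by simp
    also have "\<dots> \<le> (\<integral>\<^sup>+z. norm (indicator B z *\<^sub>R \<phi> x - indicator B z *\<^sub>R \<phi> (x + z)) \<partial>lborel)"
      using integrable_translate[of h x] intB[of "\<phi> x"] unfolding B_def
      by (intro integral_norm_bound_ennreal Bochner_Integration.integrable_diff)
    also have "\<dots> \<le> (\<integral>\<^sup>+z. ennreal \<bar>\<phi> (x + z) - \<phi> x\<bar> * indicator B z \<partial>lborel)"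
      by (intro nn_integral_mono) (auto simp: indicator_def)
    finally show ?thesis using V0 by (simp add: ennreal_mult)
  qed
  have "ennreal V * (\<integral>\<^sup>+x. ennreal \<bar>\<phi> x - ball_integral h x / V\<bar> \<partial>lborel)
      = (\<integral>\<^sup>+x. ennreal V * ennreal \<bar>\<phi> x - ball_integral h x / V\<bar> \<partial>lborel)"
    by (rule nn_integral_cmult[symmetric]) measurable
  also have "\<dots> \<le> (\<integral>\<^sup>+x. (\<integral>\<^sup>+z. ennreal \<bar>\<phi> (x + z) - \<phi> x\<bar> * indicator B z \<partial>lborel) \<partial>lborel)"
    by (rule nn_integral_mono[OF pt])
  also have "\<dots> = (\<integral>\<^sup>+z. (\<integral>\<^sup>+x. ennreal \<bar>\<phi> (x + z) - \<phi> x\<bar> * indicator B z \<partial>lborel) \<partial>lborel)"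
    by (rule lborel_pair.Fubini') measurable
  also have "\<dots> \<le> (\<integral>\<^sup>+z. ennreal (h * D) * indicator B z \<partial>lborel)"
  proof (rule nn_integral_mono)
    fix z
    show "(\<integral>\<^sup>+x. ennreal \<bar>\<phi> (x + z) - \<phi> x\<bar> * indicator B z \<partial>lborel) \<le> ennreal (h * D) * indicator B z"
    proof (cases "z \<in> B")
      case True
      have "(\<integral>\<^sup>+x. ennreal \<bar>\<phi> (x + z) - \<phi> x\<bar> \<partial>lborel) \<le> ennreal (norm z) * (\<integral>\<^sup>+x. ennreal (norm (g x)) \<partial>lborel)"
        by (rule translate_bound)
      also have "\<dots> \<le> ennreal h * ennreal D"
        using True by (intro mult_mono assms ennreal_leI) (auto simp: B_def)
      finally show ?thesis using True h by (simp add: ennreal_mult')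
    qed simp
  qed
  also have "\<dots> = ennreal (h * D) * ennreal V" by (simp add: nn_integral_cmult_indicator V)
  also have "\<dots> = ennreal V * ennreal (h * D)" by (rule mult.commute)
  finally show ?thesis using V0
    by (subst (asm) ennreal_mult_le_mult_iff) (auto simp: V_def B_def)
qed

end

lemma frac_cancel: "Y > 0 \<Longrightarrow> e / (4 * Y) * Y = e / (4::real)" by simp

text \<open>Ball integrals act as mollifications: for a fixed radius they are bounded and
  equi-Lipschitz, so one diagonal subsequence converges pointwise for all radii 1 / (m + 1), and
  replacing a function by its mean costs an error uniform along the sequence. Only the Cauchy
  property is asserted; the limit is produced later in the modular space.\<close>

lemma rellich_L1:
  fixes \<phi> :: "nat \<Rightarrow> 'a::euclidean_space \<Rightarrow> real"
  assumes c1: "\<And>n. c1_compact (\<phi> n) (g n) R"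
    and gD: "\<And>n. (\<integral>\<^sup>+x. ennreal (norm (g n x)) \<partial>lborel) \<le> ennreal D" and D: "D \<ge> 0"
  obtains k where "strict_mono (k::nat \<Rightarrow> nat)"
    "\<And>e. e > 0 \<Longrightarrow> \<exists>N. \<forall>i\<ge>N. \<forall>j\<ge>N. (\<integral>\<^sup>+x. ennreal \<bar>\<phi> (k i) x - \<phi> (k j) x\<bar> \<partial>lborel) \<le> ennreal e"
proof -
  define I where "I = (\<lambda>n h x. c1_compact.ball_integral (\<phi> n) h x)"
  have Ib: "\<bar>I n h x\<bar> \<le> 2 * R * D" for n h x
    unfolding I_def by (rule c1_compact.ball_integral_bound[OF c1 gD D])
  have Il: "\<bar>I n h x - I n h y\<bar> \<le> norm (x - y) * D" for n h x y
    unfolding I_def by (rule c1_compact.ball_integral_lipschitz[OF c1 gD D])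
  have Im[measurable]: "I n h \<in> borel_measurable borel" for n h
    unfolding I_def by (rule c1_compact.ball_integral_measurable[OF c1])
  have [measurable]: "\<phi> n \<in> borel_measurable borel" for n by (rule c1_compact.borel[OF c1])
  have R: "R > 0" using c1_compact.R_pos[OF c1] .
  define h where "h = (\<lambda>m::nat. 1 / real (Suc m))"
  have h: "h m > 0" for m by (simp add: h_def)
  obtain Q :: "'a set" where Q: "countable Q" "\<And>X. open X \<Longrightarrow> X \<noteq> {} \<Longrightarrow> \<exists>d\<in>Q. d \<in> X"
    using countable_dense_setE by blast
  obtain k where k: "strict_mono (k::nat\<Rightarrow>nat)" and
    conv: "\<And>x. x \<in> (UNIV::nat set) \<times> Q \<Longrightarrow> \<exists>l. (\<lambda>n. I (k n) (h (fst x)) (snd x)) \<longlonglongrightarrow> l"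
    using function_convergent_subsequence[of "(UNIV::nat set) \<times> Q" "\<lambda>n x. I n (h (fst x)) (snd x)" "2 * R * D"] Ib Q(1)
    by (metis countable_SIGMA countableI_type real_norm_def)
  \<comment> \<open>Convergence on the countable dense set spreads to every point by the common
    Lipschitz constant.\<close>
  have conv': "convergent (\<lambda>n. I (k n) (h m) x)" for m x
  proof (rule Cauchy_convergent, rule metric_CauchyI)
    fix e :: real assume e: "e > 0"
    define d where "d = e / (3 * (D + 1))"
    have d: "d > 0" using e D by (simp add: d_def)
    obtain q where q: "q \<in> Q" "q \<in> ball x d" using Q(2)[of "ball x d"] d by auto
    have xq: "norm (x - q) * D < e / 3"
    proof -
      have "norm (x - q) * D \<le> d * D" using q D by (intro mult_right_mono) (auto simp: dist_norm)
      also have "\<dots> < d * (D + 1)" using d by simp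
      also have "\<dots> = e / 3" using D by (simp add: d_def field_simps)
      finally show ?thesis .
    qed
    have "Cauchy (\<lambda>n. I (k n) (h m) q)"
      using conv[of "(m, q)"] q(1) by (auto intro: LIMSEQ_imp_Cauchy)
    then obtain N where N: "\<And>i j. i \<ge> N \<Longrightarrow> j \<ge> N \<Longrightarrow> dist (I (k i) (h m) q) (I (k j) (h m) q) < e / 3"
      using e by (meson metric_CauchyD divide_pos_pos zero_less_numeral)
    have "dist (I (k i) (h m) x) (I (k j) (h m) x) < e" if "i \<ge> N" "j \<ge> N" for i j
      using N[OF that] Il[of "k i" "h m" x q] Il[of "k j" "h m" x q] xq unfolding dist_real_def by linarith
    then show "\<exists>N. \<forall>i\<ge>N. \<forall>j\<ge>N. dist (I (k i) (h m) x) (I (k j) (h m) x) < e" by blast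
  qed
  define l where "l = (\<lambda>m x. lim (\<lambda>n. I (k n) (h m) x))"
  have l: "(\<lambda>n. I (k n) (h m) x) \<longlonglongrightarrow> l m x" for m x
    unfolding l_def using conv' convergent_LIMSEQ_iff by blast
  have [measurable]: "l m \<in> borel_measurable borel" for m
    unfolding l_def by measurable
  have lb: "\<bar>l m x\<bar> \<le> 2 * R * D" for m x
    using l by (rule Lim_bounded[OF tendsto_rabs]) (use Ib in auto)
  \<comment> \<open>Ball integrals spread beyond the support, but the functions themselves vanish
    outside this ball, so comparing on it is enough and provides the finite measure for dominated
    convergence.\<close>
  define S where "S = ball (0::'a) R"
  have [measurable]: "S \<in> sets borel" by (simp add: S_def)
  have S: "emeasure lborel S < \<infinity>" unfolding S_def using emeasure_lborel_ball_finite[of 0 R] by simp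
  have L1: "(\<lambda>n. \<integral>\<^sup>+x. ennreal \<bar>I (k n) (h m) x - l m x\<bar> * indicator S x \<partial>lborel) \<longlonglongrightarrow> (\<integral>\<^sup>+x. 0 \<partial>(lborel::'a measure))" for m
  proof (rule nn_integral_dominated_convergence[where w="\<lambda>x. ennreal (4 * R * D) * indicator S x"])
    show "(\<integral>\<^sup>+x. ennreal (4 * R * D) * indicator S x \<partial>lborel) < \<infinity>"
      using S by (simp add: nn_integral_cmult_indicator ennreal_mult_less_top)
    show "AE x in lborel. ennreal \<bar>I (k n) (h m) x - l m x\<bar> * indicator S x \<le> ennreal (4 * R * D) * indicator S x" for n
    proof (rule AE_I2)
      fix x
      have "\<bar>I (k n) (h m) x - l m x\<bar> \<le> 4 * R * D" using Ib[of "k n" "h m" x] lb[of m x] by linarith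
      then show "ennreal \<bar>I (k n) (h m) x - l m x\<bar> * indicator S x \<le> ennreal (4 * R * D) * indicator S x"
        by (intro mult_right_mono ennreal_leI) auto
    qed
    show "AE x in lborel. (\<lambda>n. ennreal \<bar>I (k n) (h m) x - l m x\<bar> * indicator S x) \<longlonglongrightarrow> 0"
    proof (rule AE_I2)
      fix x
      have "(\<lambda>n. \<bar>I (k n) (h m) x - l m x\<bar>) \<longlonglongrightarrow> 0"
        using l[of m x] by (simp add: LIM_zero_iff tendsto_rabs_zero_iff)
      then have "(\<lambda>n. ennreal \<bar>I (k n) (h m) x - l m x\<bar>) \<longlonglongrightarrow> ennreal 0" by (rule tendsto_ennrealI)
      then show "(\<lambda>n. ennreal \<bar>I (k n) (h m) x - l m x\<bar> * indicator S x) \<longlonglongrightarrow> 0"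
        by (auto simp: indicator_def)
    qed
  qed measurable
  have main: "\<exists>N. \<forall>i\<ge>N. \<forall>j\<ge>N. (\<integral>\<^sup>+x. ennreal \<bar>\<phi> (k i) x - \<phi> (k j) x\<bar> \<partial>lborel) \<le> ennreal e" if e: "e > 0" for e
  proof -
    \<comment> \<open>Each of the two mean approximations may cost e / 4; the other half is left for
      the two ball integrals, which are compared through their pointwise limit.\<close>
    obtain m where m: "h m * (D + 1) < e / 4"
    proof -
      obtain m where "inverse (real (Suc m)) < e / (4 * (D + 1))"
        using reals_Archimedean[of "e / (4 * (D + 1))"] e D by auto
      then have "h m * (D + 1) < e / (4 * (D + 1)) * (D + 1)"
        using D by (intro mult_strict_right_mono) (auto simp: h_def inverse_eq_divide)
      also have "e / (4 * (D + 1)) * (D + 1) = e / 4"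
        using D by (intro frac_cancel) simp
      finally show thesis by (rule that)
    qed
    have hm: "h m * D \<le> e / 4" using m h[of m] by (simp add: algebra_simps)
    define V where "V = measure lborel (ball (0::'a) (h m))"
    have V0: "V > 0" unfolding V_def by (rule content_ball_pos[OF h])
    define Z where "Z = (\<lambda>n. \<integral>\<^sup>+x. ennreal \<bar>I (k n) (h m) x - l m x\<bar> * indicator S x \<partial>lborel)"
    have "eventually (\<lambda>n. Z n < ennreal (V * e / 4)) sequentially"
      using L1[of m] V0 e unfolding Z_def by (intro order_tendstoD) auto
    then obtain N where N: "\<And>n. n \<ge> N \<Longrightarrow> Z n < ennreal (V * e / 4)"
      by (auto simp: eventually_sequentially)
    have app: "(\<integral>\<^sup>+x. ennreal \<bar>\<phi> n x - I n (h m) x / V\<bar> \<partial>lborel) \<le> ennreal (e / 4)" for n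
      using c1_compact.ball_integral_approx[OF c1 gD D h, of n m] hm unfolding I_def V_def
      by (meson ennreal_leI order_trans)
    have "(\<integral>\<^sup>+x. ennreal \<bar>\<phi> (k i) x - \<phi> (k j) x\<bar> \<partial>lborel) \<le> ennreal e" if i: "i \<ge> N" and j: "j \<ge> N" for i j
    proof -
      have pt: "ennreal \<bar>\<phi> (k i) x - \<phi> (k j) x\<bar> \<le> ennreal \<bar>\<phi> (k i) x - I (k i) (h m) x / V\<bar> + ennreal \<bar>\<phi> (k j) x - I (k j) (h m) x / V\<bar>
         + ennreal (1 / V) * (ennreal \<bar>I (k i) (h m) x - l m x\<bar> * indicator S x) + ennreal (1 / V) * (ennreal \<bar>I (k j) (h m) x - l m x\<bar> * indicator S x)" for x
      proof (cases "x \<in> S")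
        case False
        then have "\<phi> n x = 0" for n using c1_compact.supp[OF c1] by (auto simp: S_def)
        then show ?thesis by simp
      next
        case True
        have "\<bar>I (k i) (h m) x / V - I (k j) (h m) x / V\<bar> \<le> 1 / V * \<bar>I (k i) (h m) x - l m x\<bar> + 1 / V * \<bar>I (k j) (h m) x - l m x\<bar>"
          using V0 by (simp add: field_simps abs_if)
        then have "\<bar>\<phi> (k i) x - \<phi> (k j) x\<bar> \<le> \<bar>\<phi> (k i) x - I (k i) (h m) x / V\<bar> + \<bar>\<phi> (k j) x - I (k j) (h m) x / V\<bar>
          + 1 / V * \<bar>I (k i) (h m) x - l m x\<bar> + 1 / V * \<bar>I (k j) (h m) x - l m x\<bar>"
          by linarith
        then have "ennreal \<bar>\<phi> (k i) x - \<phi> (k j) x\<bar> \<le> ennreal (\<bar>\<phi> (k i) x - I (k i) (h m) x / V\<bar> + \<bar>\<phi> (k j) x - I (k j) (h m) x / V\<bar>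
          + 1 / V * \<bar>I (k i) (h m) x - l m x\<bar> + 1 / V * \<bar>I (k j) (h m) x - l m x\<bar>)" by (rule ennreal_leI)
        also have "\<dots> = ennreal \<bar>\<phi> (k i) x - I (k i) (h m) x / V\<bar> + ennreal \<bar>\<phi> (k j) x - I (k j) (h m) x / V\<bar>
         + ennreal (1 / V) * (ennreal \<bar>I (k i) (h m) x - l m x\<bar> * indicator S x) + ennreal (1 / V) * (ennreal \<bar>I (k j) (h m) x - l m x\<bar> * indicator S x)"
          using True V0 by (simp add: ennreal_plus ennreal_mult'[symmetric] del: ennreal_plus_if)
        finally show ?thesis .
      qed
      have "(\<integral>\<^sup>+x. ennreal \<bar>\<phi> (k i) x - \<phi> (k j) x\<bar> \<partial>lborel) \<le> 
        (\<integral>\<^sup>+x. ennreal \<bar>\<phi> (k i) x - I (k i) (h m) x / V\<bar> + ennreal \<bar>\<phi> (k j) x - I (k j) (h m) x / V\<bar>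
         + ennreal (1 / V) * (ennreal \<bar>I (k i) (h m) x - l m x\<bar> * indicator S x) + ennreal (1 / V) * (ennreal \<bar>I (k j) (h m) x - l m x\<bar> * indicator S x) \<partial>lborel)"
        by (rule nn_integral_mono[OF pt])
      also have "\<dots> = (\<integral>\<^sup>+x. ennreal \<bar>\<phi> (k i) x - I (k i) (h m) x / V\<bar> \<partial>lborel) + (\<integral>\<^sup>+x. ennreal \<bar>\<phi> (k j) x - I (k j) (h m) x / V\<bar> \<partial>lborel)
         + ennreal (1 / V) * Z i + ennreal (1 / V) * Z j"
        by (simp add: nn_integral_add nn_integral_cmult Z_def)
      also have "\<dots> \<le> ennreal (e / 4) + ennreal (e / 4) + ennreal (1 / V) * ennreal (V * e / 4) + ennreal (1 / V) * ennreal (V * e / 4)"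
        using N[OF i] N[OF j] by (intro add_mono app mult_left_mono) auto
      also have "ennreal (1 / V) * ennreal (V * e / 4) = ennreal (e / 4)"
        using V0 e by (simp flip: ennreal_mult)
      also have "ennreal (e / 4) + ennreal (e / 4) + ennreal (e / 4) + ennreal (e / 4) = ennreal (e / 4 + e / 4 + e / 4 + e / 4)"
        using e by (simp only: ennreal_plus)
      finally show ?thesis by simp
    qed
    then show ?thesis by blast
  qed
  show thesis by (rule that[OF k main])
qed

section \<open>Modular convergence with a variable exponent\<close>

lemma powr_add_le:
  fixes a b q P :: real
  assumes "0 \<le> a" "0 \<le> b" "0 \<le> q" "q \<le> P"
  shows "(a + b) powr q \<le> 2 powr P * (a powr q + b powr q)"
proof -
  have "(a + b) powr q \<le> (2 * max a b) powr q"
    using assms by (intro powr_mono2) auto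
  also have "\<dots> = 2 powr q * max a b powr q" using assms by (intro powr_mult)
  also have "\<dots> \<le> 2 powr P * (a powr q + b powr q)"
    using assms by (intro mult_mono powr_mono) (auto simp: max_def)
  finally show ?thesis .
qed

lemma powr_le_one_plus:
  fixes s e q :: real
  assumes "0 \<le> s" "0 \<le> e" "e \<le> q"
  shows "s powr e \<le> 1 + s powr q"
proof (cases "s \<le> 1")
  case True
  have "s powr e \<le> 1 powr e" using True assms by (intro powr_mono2) auto
  then show ?thesis by (smt (verit) powr_ge_zero powr_one_eq_one)
next
  case False
  then have "s powr e \<le> s powr q" using assms by (intro powr_mono) auto
  then show ?thesis by linarith
qed

text \<open>The uniform upper bound \<open>P\<close> turns pointwise inequalities with exponent p(x)
  into integral inequalities with constants such as 2 powr P.\<close>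

locale variable_exponent =
  fixes \<Omega> :: "'a::euclidean_space set" and p :: "'a \<Rightarrow> real" and P :: real
  assumes openO: "open \<Omega>" and boundedO: "bounded \<Omega>"
    and p_cont: "continuous_on \<Omega> p"
    and p_ge1: "\<And>x. x \<in> \<Omega> \<Longrightarrow> 1 \<le> p x" and p_le: "\<And>x. x \<in> \<Omega> \<Longrightarrow> p x \<le> P"
    and P_ge1: "1 \<le> P"
begin

abbreviation "M \<equiv> lebesgue_on \<Omega>"

lemma space_M [simp]: "space M = \<Omega>" by (simp add: space_restrict_space)

lemma O_sets [measurable]: "\<Omega> \<in> sets lebesgue" 
  by (metis openO borel_open sets_completionI_sets sets_lborel)

lemma finite_M: "finite_measure M"
proof (rule finite_measureI)
  have "emeasure lebesgue \<Omega> < \<infinity>"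
    using bounded_set_imp_lmeasurable[OF boundedO O_sets] by (simp add: fmeasurable_def)
  then show "emeasure M (space M) \<noteq> \<infinity>" by (simp add: emeasure_restrict_space)
qed

sublocale finite_measure M by (rule finite_M)

lemma borel_imp_M: "f \<in> borel_measurable borel \<Longrightarrow> f \<in> borel_measurable M"
  by (intro measurable_restrict_space1 measurable_completion) simp

lemma cont_imp_M:
  fixes f :: "'a \<Rightarrow> 'c::euclidean_space"
  shows "continuous_on \<Omega> f \<Longrightarrow> f \<in> borel_measurable M"
  using continuous_imp_measurable_on_sets_lebesgue O_sets by blast

lemma p_meas [measurable]: "p \<in> borel_measurable M" by (rule cont_imp_M[OF p_cont])

definition Lp :: "('a \<Rightarrow> 'b::euclidean_space) set" where
  "Lp = {U. U \<in> borel_measurable M \<and> integrable M (\<lambda>x. norm (U x) powr p x)}"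

text \<open>As a Bochner integral this is 0 when the integrand is not integrable, so the value
  carries information only together with membership in \<open>Lp\<close>.\<close>

definition pmod :: "('a \<Rightarrow> 'b::euclidean_space) \<Rightarrow> real" where
  "pmod U = (\<integral>x. norm (U x) powr p x \<partial>M)"

lemma LpD [measurable_dest]: "U \<in> Lp \<Longrightarrow> U \<in> borel_measurable M" by (simp add: Lp_def)
lemma Lp_integrable: "U \<in> Lp \<Longrightarrow> integrable M (\<lambda>x. norm (U x) powr p x)" by (simp add: Lp_def)

lemma pmod_nonneg: "pmod U \<ge> 0" unfolding pmod_def by (rule integral_nonneg_AE) simp

lemma caratheodory_measurable:
  fixes f :: "'a \<Rightarrow> 'b::euclidean_space \<Rightarrow> 'c::euclidean_space"
  assumes f: "continuous_on (\<Omega> \<times> UNIV) (\<lambda>(x, y). f x y)" and [measurable]: "U \<in> borel_measurable M"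
  shows "(\<lambda>x. f x (U x)) \<in> borel_measurable M"
proof -
  have 1: "(\<lambda>(x, y). f x y) \<in> borel_measurable (restrict_space borel (\<Omega> \<times> UNIV))"
    by (rule borel_measurable_continuous_on_restrict[OF f])
  have [measurable]: "(\<lambda>x. x) \<in> borel_measurable M" by (rule borel_imp_M) simp
  have "(\<lambda>x. (x, U x)) \<in> M \<rightarrow>\<^sub>M restrict_space borel (\<Omega> \<times> UNIV)"
    by (rule measurable_restrict_space2) (auto intro: borel_measurable_Pair)
  from measurable_compose[OF this 1] show ?thesis by simp
qed

text \<open>The class of integrands that act on \<open>Lp\<close>. All densities below are brought
  into this form, so that integrability and continuity of the integral are proved once. The value
  type is arbitrary in order to admit tuples of functions and gradients.\<close>

definition growth :: "('a \<Rightarrow> 'b::euclidean_space \<Rightarrow> real) \<Rightarrow> bool" where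
  "growth f \<longleftrightarrow> continuous_on (\<Omega> \<times> UNIV) (\<lambda>(x, y). f x y) \<and>
    (\<exists>C. \<forall>x\<in>\<Omega>. \<forall>y. \<bar>f x y\<bar> \<le> C * (1 + norm y powr p x))"

lemma growth_measurable: "growth f \<Longrightarrow> U \<in> borel_measurable M \<Longrightarrow> (\<lambda>x. f x (U x)) \<in> borel_measurable M"
  unfolding growth_def by (rule caratheodory_measurable) auto

lemma growth_integrable:
  fixes f :: "'a \<Rightarrow> 'b::euclidean_space \<Rightarrow> real"
  assumes f: "growth f" and U: "U \<in> Lp"
  shows "integrable M (\<lambda>x. f x (U x))"
proof -
  obtain C where C: "\<And>x y. x \<in> \<Omega> \<Longrightarrow> \<bar>f x y\<bar> \<le> C * (1 + norm y powr p x)"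
    using f unfolding growth_def by blast
  show ?thesis
  proof (rule Bochner_Integration.integrable_bound)
    show "integrable M (\<lambda>x. C * (1 + norm (U x) powr p x))"
      by (intro integrable_mult_right Bochner_Integration.integrable_add integrable_const Lp_integrable U)
    show "(\<lambda>x. f x (U x)) \<in> borel_measurable M" by (rule growth_measurable[OF f LpD[OF U]])
    show "AE x in M. norm (f x (U x)) \<le> norm (C * (1 + norm (U x) powr p x))"
    proof (rule AE_I2)
      fix x assume "x \<in> space M"
      then show "norm (f x (U x)) \<le> norm (C * (1 + norm (U x) powr p x))"
        using C[of x "U x"] by simp
    qed
  qed
qed

lemma norm_powr_cont:
  "continuous_on (\<Omega> \<times> (UNIV :: 'b::euclidean_space set)) (\<lambda>(x, y). norm y powr p x)"
proof -
  have "continuous_on (\<Omega> \<times> (UNIV :: 'b set)) (\<lambda>z. norm (snd z) powr p (fst z))"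
    using p_ge1 by (intro continuous_on_powr' continuous_intros continuous_on_compose2[OF p_cont]) force+
  then show ?thesis by (simp add: case_prod_beta')
qed

lemma growth_norm_powr: "growth (\<lambda>x (y::'b::euclidean_space). norm y powr p x)"
  unfolding growth_def
proof (intro conjI exI[of _ 1] ballI allI)
  show "continuous_on (\<Omega> \<times> (UNIV :: 'b set)) (\<lambda>(x, y). norm y powr p x)" by (rule norm_powr_cont)
qed simp

lemma norm_powr_add_le:
  assumes "x \<in> \<Omega>" 
  shows "norm (a + b) powr p x \<le> 2 powr P * (norm a powr p x + norm b powr p x)"
proof -
  have "norm (a + b) powr p x \<le> (norm a + norm b) powr p x"
    using p_ge1[OF assms] by (intro powr_mono2 norm_triangle_ineq) auto
  also have "\<dots> \<le> 2 powr P * (norm a powr p x + norm b powr p x)"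
    using p_ge1[OF assms] p_le[OF assms] by (intro powr_add_le) auto
  finally show ?thesis .
qed

lemma Lp_bounded:
  assumes W: "W \<in> Lp" and [measurable]: "V \<in> borel_measurable M" and le: "\<And>x. x \<in> \<Omega> \<Longrightarrow> norm (V x) \<le> norm (W x)"
  shows "V \<in> Lp" "pmod V \<le> pmod W"
proof -
  have pt: "norm (V x) powr p x \<le> norm (W x) powr p x" if "x \<in> \<Omega>" for x
    using le[OF that] p_ge1[OF that] by (intro powr_mono2) auto
  show 1: "V \<in> Lp"
    unfolding Lp_def mem_Collect_eq
  proof
    show "integrable M (\<lambda>x. norm (V x) powr p x)"
      by (rule Bochner_Integration.integrable_bound[OF Lp_integrable[OF W]]) (use pt in \<open>auto intro!: AE_I2\<close>)
  qed fact
  show "pmod V \<le> pmod W" unfolding pmod_def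
    by (rule integral_mono[OF Lp_integrable[OF 1] Lp_integrable[OF W]]) (use pt in auto)
qed

lemma Lp_add:
  assumes U: "U \<in> Lp" and V: "V \<in> Lp"
  shows "(\<lambda>x. U x + V x) \<in> Lp" "pmod (\<lambda>x. U x + V x) \<le> 2 powr P * (pmod U + pmod V)"
proof -
  note [measurable] = LpD[OF U] LpD[OF V]
  have int: "integrable M (\<lambda>x. 2 powr P * (norm (U x) powr p x + norm (V x) powr p x))"
    by (intro integrable_mult_right Bochner_Integration.integrable_add Lp_integrable U V)
  show 1: "(\<lambda>x. U x + V x) \<in> Lp"
    unfolding Lp_def mem_Collect_eq
  proof
    show "integrable M (\<lambda>x. norm (U x + V x) powr p x)"
      by (rule Bochner_Integration.integrable_bound[OF int]) (use norm_powr_add_le in \<open>auto intro!: AE_I2\<close>)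
  qed measurable
  have "pmod (\<lambda>x. U x + V x) \<le> (\<integral>x. 2 powr P * (norm (U x) powr p x + norm (V x) powr p x) \<partial>M)"
    unfolding pmod_def by (rule integral_mono[OF Lp_integrable[OF 1] int]) (use norm_powr_add_le in auto)
  also have "\<dots> = 2 powr P * (pmod U + pmod V)"
    unfolding pmod_def by (simp add: Bochner_Integration.integral_add Lp_integrable U V)
  finally show "pmod (\<lambda>x. U x + V x) \<le> 2 powr P * (pmod U + pmod V)" .
qed

text \<open>The bound for small \<open>c\<close> is linear because p \<ge> 1; it makes V + t H
  converge in modular as t varies. The last bound covers all \<open>c\<close> by taking the worst
  exponent.\<close>

lemma Lp_scale:
  assumes U: "U \<in> Lp"
  shows "(\<lambda>x. c *\<^sub>R U x) \<in> Lp" "\<bar>c\<bar> \<le> 1 \<Longrightarrow> pmod (\<lambda>x. c *\<^sub>R U x) \<le> \<bar>c\<bar> * pmod U"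
    "pmod (\<lambda>x. c *\<^sub>R U x) \<le> (1 + \<bar>c\<bar> powr P) * pmod U"
proof -
  note [measurable] = LpD[OF U]
  have eq: "norm (c *\<^sub>R U x) powr p x = \<bar>c\<bar> powr p x * norm (U x) powr p x" for x
    by (simp add: powr_mult)
  have cP: "\<bar>c\<bar> powr p x \<le> 1 + \<bar>c\<bar> powr P" if "x \<in> \<Omega>" for x
    using p_ge1[OF that] p_le[OF that] by (intro powr_le_one_plus) auto
  have int: "integrable M (\<lambda>x. (1 + \<bar>c\<bar> powr P) * norm (U x) powr p x)"
    by (intro integrable_mult_right Lp_integrable U)
  have pt: "norm (c *\<^sub>R U x) powr p x \<le> (1 + \<bar>c\<bar> powr P) * norm (U x) powr p x" if "x \<in> \<Omega>" for x
    unfolding eq by (intro mult_right_mono cP that) simp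
  show 1: "(\<lambda>x. c *\<^sub>R U x) \<in> Lp"
    unfolding Lp_def mem_Collect_eq
  proof
    show "integrable M (\<lambda>x. norm (c *\<^sub>R U x) powr p x)"
      by (rule Bochner_Integration.integrable_bound[OF int]) (use pt in \<open>auto intro!: AE_I2\<close>)
  qed measurable
  show "pmod (\<lambda>x. c *\<^sub>R U x) \<le> (1 + \<bar>c\<bar> powr P) * pmod U"
  proof -
    have "pmod (\<lambda>x. c *\<^sub>R U x) \<le> (\<integral>x. (1 + \<bar>c\<bar> powr P) * norm (U x) powr p x \<partial>M)"
      unfolding pmod_def by (rule integral_mono[OF Lp_integrable[OF 1] int]) (use pt in auto)
    then show ?thesis by (simp add: pmod_def)
  qed
  show "pmod (\<lambda>x. c *\<^sub>R U x) \<le> \<bar>c\<bar> * pmod U" if c: "\<bar>c\<bar> \<le> 1"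
  proof -
    have "pmod (\<lambda>x. c *\<^sub>R U x) \<le> (\<integral>x. \<bar>c\<bar> * norm (U x) powr p x \<partial>M)"
      unfolding pmod_def
    proof (rule integral_mono[OF Lp_integrable[OF 1]])
      show "integrable M (\<lambda>x. \<bar>c\<bar> * norm (U x) powr p x)" by (intro integrable_mult_right Lp_integrable U)
      fix x assume "x \<in> space M"
      then have "1 \<le> p x" using p_ge1 by simp
      then have "\<bar>c\<bar> powr p x \<le> \<bar>c\<bar> powr 1" using c by (intro powr_mono') auto
      then show "norm (c *\<^sub>R U x) powr p x \<le> \<bar>c\<bar> * norm (U x) powr p x"
        unfolding eq by (intro mult_right_mono) auto
    qed
    then show ?thesis by (simp add: pmod_def)
  qed
qed

lemma Lp_diff: "U \<in> Lp \<Longrightarrow> V \<in> Lp \<Longrightarrow> (\<lambda>x. U x - V x) \<in> Lp"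
  using Lp_add(1)[of U "\<lambda>x. (-1) *\<^sub>R V x"] Lp_scale(1)[of V "-1"] by simp

lemma pmod_diff_commute: "pmod (\<lambda>x. U x - V x) = pmod (\<lambda>x. V x - U x)"
  by (simp add: pmod_def norm_minus_commute)

lemma pmod_triangle:
  assumes "U \<in> Lp" "V \<in> Lp" "W \<in> Lp"
  shows "pmod (\<lambda>x. U x - W x) \<le> 2 powr P * (pmod (\<lambda>x. U x - V x) + pmod (\<lambda>x. V x - W x))"
  using Lp_add(2)[OF Lp_diff[OF assms(1,2)] Lp_diff[OF assms(2,3)]] by simp

lemma Lp_Pair:
  fixes U :: "'a \<Rightarrow> 'b::euclidean_space" and V :: "'a \<Rightarrow> 'c::euclidean_space"
  assumes U: "U \<in> Lp" and V: "V \<in> Lp"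
  shows "(\<lambda>x. (U x, V x)) \<in> Lp" "pmod (\<lambda>x. (U x, V x)) \<le> 2 powr P * (pmod U + pmod V)"
proof -
  have a: "(\<lambda>x. (U x, 0::'c)) \<in> Lp" "pmod (\<lambda>x. (U x, 0::'c)) = pmod U"
    using U by (auto simp: Lp_def pmod_def norm_Pair intro!: borel_measurable_Pair)
  have b: "(\<lambda>x. (0::'b, V x)) \<in> Lp" "pmod (\<lambda>x. (0::'b, V x)) = pmod V"
    using V by (auto simp: Lp_def pmod_def norm_Pair intro!: borel_measurable_Pair)
  show "(\<lambda>x. (U x, V x)) \<in> Lp" "pmod (\<lambda>x. (U x, V x)) \<le> 2 powr P * (pmod U + pmod V)"
    using Lp_add[OF a(1) b(1)] a(2) b(2) by auto
qed

lemma Lp_fst: "U \<in> Lp \<Longrightarrow> (\<lambda>x. fst (U x)) \<in> Lp" "U \<in> Lp \<Longrightarrow> pmod (\<lambda>x. fst (U x)) \<le> pmod U"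
proof -
  assume U: "U \<in> Lp"
  have m: "(\<lambda>x. fst (U x)) \<in> borel_measurable M" 
    by (rule measurable_compose[OF LpD[OF U] borel_measurable_continuous_onI]) (intro continuous_intros)
  show "(\<lambda>x. fst (U x)) \<in> Lp" "pmod (\<lambda>x. fst (U x)) \<le> pmod U"
    using Lp_bounded[OF U m] norm_fst_le by (metis prod.collapse)+
qed

lemma Lp_snd: "U \<in> Lp \<Longrightarrow> (\<lambda>x. snd (U x)) \<in> Lp" "U \<in> Lp \<Longrightarrow> pmod (\<lambda>x. snd (U x)) \<le> pmod U"
proof -
  assume U: "U \<in> Lp"
  have m: "(\<lambda>x. snd (U x)) \<in> borel_measurable M" 
    by (rule measurable_compose[OF LpD[OF U] borel_measurable_continuous_onI]) (intro continuous_intros)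
  show "(\<lambda>x. snd (U x)) \<in> Lp" "pmod (\<lambda>x. snd (U x)) \<le> pmod U"
    using Lp_bounded[OF U m] norm_snd_le by (metis prod.collapse)+
qed

lemma Lp_PairD:
  "(\<lambda>x. (U x, V x)) \<in> Lp \<Longrightarrow> U \<in> Lp" "(\<lambda>x. (U x, V x)) \<in> Lp \<Longrightarrow> V \<in> Lp"
  using Lp_fst(1)[of "\<lambda>x. (U x, V x)"] Lp_snd(1)[of "\<lambda>x. (U x, V x)"] by auto

lemma bounded_in_Lp:
  assumes [measurable]: "U \<in> borel_measurable M" and b: "\<And>x. x \<in> \<Omega> \<Longrightarrow> norm (U x) \<le> B"
  shows "U \<in> Lp"
  unfolding Lp_def mem_Collect_eq
proof
  show "integrable M (\<lambda>x. norm (U x) powr p x)"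
  proof (rule integrable_const_bound[where B="1 + B powr P"])
    show "AE x in M. norm (norm (U x) powr p x) \<le> 1 + B powr P"
    proof (rule AE_I2)
      fix x assume "x \<in> space M"
      then have x: "x \<in> \<Omega>" by simp
      have "norm (U x) powr p x \<le> 1 + norm (U x) powr P"
        using p_ge1[OF x] p_le[OF x] by (intro powr_le_one_plus) auto
      also have "norm (U x) powr P \<le> B powr P" using b[OF x] P_ge1 by (intro powr_mono2) auto
      finally show "norm (norm (U x) powr p x) \<le> 1 + B powr P" by simp
    qed
  qed measurable
qed fact

section \<open>Modular convergence, superposition operators and completeness\<close>

definition mconv :: "(nat \<Rightarrow> 'a \<Rightarrow> 'b::euclidean_space) \<Rightarrow> ('a \<Rightarrow> 'b) \<Rightarrow> bool" where
  "mconv U V \<longleftrightarrow> (\<forall>n. U n \<in> Lp) \<and> V \<in> Lp \<and> (\<lambda>n. pmod (\<lambda>x. U n x - V x)) \<longlonglongrightarrow> 0"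

lemma mconv_subseq: "mconv U V \<Longrightarrow> strict_mono k \<Longrightarrow> mconv (\<lambda>n. U (k n)) V"
  unfolding mconv_def using LIMSEQ_subseq_LIMSEQ[of "\<lambda>n. pmod (\<lambda>x. U n x - V x)" 0 k] by (auto simp: o_def)

lemma mconv_imp_AE_subseq:
  assumes "mconv U V"
  obtains r where "strict_mono (r::nat\<Rightarrow>nat)" "AE x in M. (\<lambda>n. U (r n) x) \<longlonglongrightarrow> V x"
proof -
  let ?h = "\<lambda>n x. norm (U n x - V x) powr p x"
  have "\<exists>r::nat\<Rightarrow>nat. strict_mono r \<and> (AE x in M. (\<lambda>n. ?h (r n) x) \<longlonglongrightarrow> 0)"
  proof (rule tendsto_L1_AE_subseq)
    show "integrable M (?h n)" for n using assms unfolding mconv_def by (intro Lp_integrable Lp_diff) auto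
    show "(\<lambda>n. \<integral>x. norm (?h n x) \<partial>M) \<longlonglongrightarrow> 0" using assms by (simp add: mconv_def pmod_def)
  qed
  then obtain r where r: "strict_mono r" "AE x in M. (\<lambda>n. ?h (r n) x) \<longlonglongrightarrow> 0" by blast
  have "AE x in M. (\<lambda>n. U (r n) x) \<longlonglongrightarrow> V x"
    using r(2) AE_space[of M]
  proof eventually_elim
    case (elim x)
    then have x: "p x \<ge> 1" using p_ge1 by simp
    have "(\<lambda>n. ?h (r n) x powr (1 / p x)) \<longlonglongrightarrow> 0 powr (1 / p x)"
      by (rule tendsto_powr') (use elim x in auto)
    then have "(\<lambda>n. norm (U (r n) x - V x)) \<longlonglongrightarrow> 0" using x by (simp add: powr_powr)
    then show ?case by (simp add: LIM_zero_iff tendsto_norm_zero_iff)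
  qed
  with r(1) show thesis by (rule that)
qed

text \<open>Almost everywhere convergence is available only along subsequences. For limits of
  numbers it suffices that every subsequence has a further one with the same limit.\<close>

lemma tendsto_via_subseq:
  fixes X :: "nat \<Rightarrow> real"
  assumes "\<And>k. strict_mono (k::nat\<Rightarrow>nat) \<Longrightarrow> \<exists>r::nat\<Rightarrow>nat. strict_mono r \<and> (\<lambda>n. X (k (r n))) \<longlonglongrightarrow> L"
  shows "X \<longlonglongrightarrow> L"
proof (rule ccontr)
  assume "\<not> X \<longlonglongrightarrow> L"
  then obtain e where e: "e > 0" "\<forall>N. \<exists>n\<ge>N. \<not> dist (X n) L < e"
    by (auto simp: lim_sequentially)
  then have "infinite {n. \<not> dist (X n) L < e}" unfolding infinite_nat_iff_unbounded_le by blast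
  then obtain k where k: "strict_mono (k::nat\<Rightarrow>nat)" "\<And>n. \<not> dist (X (k n)) L < e"
    using infinite_enumerate[of "{n. \<not> dist (X n) L < e}"] by auto
  from assms[OF k(1)] obtain r where r: "(\<lambda>n. X (k (r n))) \<longlonglongrightarrow> L" by blast
  then obtain N where "dist (X (k (r N))) L < e" using e(1) unfolding lim_sequentially by blast
  with k(2) show False by blast
qed

text \<open>Continuity of superposition operators: the excess of the error over a multiple of the
  modular of the difference is dominated, so ordinary dominated convergence applies.\<close>

lemma growth_tendsto_L1:
  fixes f :: "'a \<Rightarrow> 'b::euclidean_space \<Rightarrow> real"
  assumes f: "growth f" and conv: "mconv U V"
  shows "(\<lambda>n. \<integral>x. \<bar>f x (U n x) - f x (V x)\<bar> \<partial>M) \<longlonglongrightarrow> 0"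
proof (rule tendsto_via_subseq)
  fix k :: "nat \<Rightarrow> nat" assume k: "strict_mono k"
  obtain r where r: "strict_mono r" and AEc: "AE x in M. (\<lambda>n. U (k (r n)) x) \<longlonglongrightarrow> V x"
    using mconv_imp_AE_subseq[OF mconv_subseq[OF conv k]] by blast
  define W where "W = (\<lambda>n. U (k (r n)))"
  have conv': "mconv W V" unfolding W_def using mconv_subseq[OF mconv_subseq[OF conv k] r] .
  then have WL: "W n \<in> Lp" and VL: "V \<in> Lp" for n by (auto simp: mconv_def)
  note [measurable] = LpD[OF WL] LpD[OF VL] growth_measurable[OF f LpD[OF WL]] growth_measurable[OF f LpD[OF VL]]
  obtain C0 where C0: "\<And>x y. x \<in> \<Omega> \<Longrightarrow> \<bar>f x y\<bar> \<le> C0 * (1 + norm y powr p x)"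
    using f unfolding growth_def by blast
  define C where "C = \<bar>C0\<bar>"
  have C: "\<bar>f x y\<bar> \<le> C * (1 + norm y powr p x)" if "x \<in> \<Omega>" for x y
  proof -
    have "C0 * (1 + norm y powr p x) \<le> C * (1 + norm y powr p x)"
      by (intro mult_right_mono) (auto simp: C_def)
    then show ?thesis using C0[OF that, of y] by linarith
  qed
  have C_nonneg: "C \<ge> 0" by (simp add: C_def)
  define h where "h = (\<lambda>n x. norm (W n x - V x) powr p x)"
  define d where "d = (\<lambda>n x. \<bar>f x (W n x) - f x (V x)\<bar>)"
  define K where "K = C * 2 powr P"
  have K: "K \<ge> 0" by (simp add: K_def C_nonneg)
  define b where "b = (\<lambda>x. C * 2 + (C + K) * norm (V x) powr p x)"
  define e where "e = (\<lambda>n x. max 0 (d n x - K * h n x))"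
  have hint: "integrable M (h n)" for n unfolding h_def by (intro Lp_integrable Lp_diff WL VL)
  have dint: "integrable M (d n)" for n unfolding d_def
    by (intro Bochner_Integration.integrable_abs Bochner_Integration.integrable_diff growth_integrable f WL VL)
  have dle: "d n x \<le> b x + K * h n x" if x: "x \<in> \<Omega>" for n x
  proof -
    have "norm (W n x) powr p x \<le> 2 powr P * (h n x + norm (V x) powr p x)"
      unfolding h_def using norm_powr_add_le[OF x, of "W n x - V x" "V x"] by simp
    then have "C * norm (W n x) powr p x \<le> C * (2 powr P * (h n x + norm (V x) powr p x))"
      using C_nonneg by (rule mult_left_mono)
    moreover have "d n x \<le> C * (1 + norm (W n x) powr p x) + C * (1 + norm (V x) powr p x)"
      unfolding d_def using C[OF x, of "W n x"] C[OF x, of "V x"] by linarith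
    ultimately show ?thesis unfolding b_def K_def by (simp add: algebra_simps)
  qed
  have bint: "integrable M b"
    unfolding b_def by (intro Bochner_Integration.integrable_add integrable_const integrable_mult_right Lp_integrable VL)
  have b0: "b x \<ge> 0" for x using C_nonneg K by (auto simp: b_def)
  have [measurable]: "h n \<in> borel_measurable M" "d n \<in> borel_measurable M" for n
    using hint dint by auto
  have em[measurable]: "e n \<in> borel_measurable M" for n unfolding e_def by measurable
  have e_lim: "(\<lambda>n. \<integral>x. e n x \<partial>M) \<longlonglongrightarrow> (\<integral>x. 0 \<partial>M)"
  proof (rule integral_dominated_convergence[where w=b])
    show "AE x in M. (\<lambda>n. e n x) \<longlonglongrightarrow> 0"
      using AEc AE_space[of M]
    proof eventually_elim
      case (elim x)
      have x: "x \<in> \<Omega>" using elim by simp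
      have c: "continuous_on UNIV (f x)"
      proof -
        have "continuous_on UNIV ((\<lambda>(x, y). f x y) \<circ> Pair x)"
          by (intro continuous_on_compose continuous_intros continuous_on_subset[OF f[unfolded growth_def, THEN conjunct1]])
            (use x in auto)
        then show ?thesis by (simp add: o_def)
      qed
      have "(\<lambda>n. f x (W n x)) \<longlonglongrightarrow> f x (V x)"
        using elim(1) c unfolding W_def by (intro continuous_on_tendsto_compose[OF c]) auto
      then have "(\<lambda>n. d n x) \<longlonglongrightarrow> 0" unfolding d_def by (simp add: LIM_zero_iff tendsto_rabs_zero_iff)
      then show ?case
      proof (rule Lim_null_comparison[rotated])
        show "\<forall>\<^sub>F n in sequentially. norm (e n x) \<le> d n x"
          using K by (intro always_eventually) (auto simp: e_def d_def h_def max_def)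
      qed
    qed
    show "AE x in M. norm (e n x) \<le> b x" for n
      using dle b0 by (intro AE_I2) (auto simp: e_def max_def algebra_simps)
  qed (use bint in auto)
  have eint: "integrable M (e n)" for n
    by (rule Bochner_Integration.integrable_bound[OF bint])
       (use dle b0 in \<open>auto intro!: AE_I2 simp: e_def max_def algebra_simps\<close>)
  have upper: "(\<integral>x. d n x \<partial>M) \<le> (\<integral>x. e n x \<partial>M) + K * pmod (\<lambda>x. W n x - V x)" for n
  proof -
    have "(\<integral>x. d n x \<partial>M) \<le> (\<integral>x. e n x + K * h n x \<partial>M)"
      using hint dint eint by (intro integral_mono) (auto simp: e_def)
    also have "\<dots> = (\<integral>x. e n x \<partial>M) + K * pmod (\<lambda>x. W n x - V x)"
      using hint eint by (simp add: pmod_def h_def)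
    finally show ?thesis .
  qed
  have lim: "(\<lambda>n. (\<integral>x. e n x \<partial>M) + K * pmod (\<lambda>x. W n x - V x)) \<longlonglongrightarrow> 0 + K * 0"
    using e_lim conv' unfolding mconv_def by (intro tendsto_add tendsto_mult tendsto_const) auto
  have "(\<lambda>n. \<integral>x. d n x \<partial>M) \<longlonglongrightarrow> 0"
  proof (rule real_tendsto_sandwich[OF _ _ tendsto_const])
    show "(\<lambda>n. (\<integral>x. e n x \<partial>M) + K * pmod (\<lambda>x. W n x - V x)) \<longlonglongrightarrow> 0" using lim by simp
    show "\<forall>\<^sub>F n in sequentially. 0 \<le> (\<integral>x. d n x \<partial>M)"
      by (intro always_eventually allI integral_nonneg_AE) (auto simp: d_def)
  qed (use upper in auto)
  then show "\<exists>r. strict_mono r \<and> (\<lambda>n. \<integral>x. \<bar>f x (U (k (r n)) x) - f x (V x)\<bar> \<partial>M) \<longlonglongrightarrow> 0"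
    using r unfolding d_def W_def by blast
qed

lemma growth_tendsto:
  fixes f :: "'a \<Rightarrow> 'b::euclidean_space \<Rightarrow> real"
  assumes f: "growth f" and conv: "mconv U V"
  shows "(\<lambda>n. \<integral>x. f x (U n x) \<partial>M) \<longlonglongrightarrow> (\<integral>x. f x (V x) \<partial>M)"
proof -
  have UL: "U n \<in> Lp" and VL: "V \<in> Lp" for n using conv by (auto simp: mconv_def)
  have "\<bar>(\<integral>x. f x (U n x) \<partial>M) - (\<integral>x. f x (V x) \<partial>M)\<bar> \<le> (\<integral>x. \<bar>f x (U n x) - f x (V x)\<bar> \<partial>M)" for n
  proof -
    have "(\<integral>x. f x (U n x) \<partial>M) - (\<integral>x. f x (V x) \<partial>M) = (\<integral>x. f x (U n x) - f x (V x) \<partial>M)"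
      by (intro Bochner_Integration.integral_diff[symmetric] growth_integrable f UL VL)
    then show ?thesis by (metis integral_abs_bound)
  qed
  then have "(\<lambda>n. (\<integral>x. f x (U n x) \<partial>M) - (\<integral>x. f x (V x) \<partial>M)) \<longlonglongrightarrow> 0"
    by (intro Lim_null_comparison[OF _ growth_tendsto_L1[OF f conv]]) auto
  then show ?thesis by (simp add: LIM_zero_iff)
qed


text \<open>Threshold splitting with exponent p(x): above t the power 1 - p(x) is at most t powr (1
  - P), uniformly in x because t \<le> 1.\<close>

lemma L1_le_pmod:
  fixes W :: "'a \<Rightarrow> 'b::euclidean_space"
  assumes W: "W \<in> Lp" and t: "0 < t" "t \<le> 1"
  shows "(\<integral>\<^sup>+x. ennreal (norm (W x)) \<partial>M) \<le> ennreal (t * measure M \<Omega> + t powr (1 - P) * pmod W)"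
proof -
  note [measurable] = LpD[OF W]
  have int: "integrable M (\<lambda>x. t + t powr (1 - P) * norm (W x) powr p x)"
    by (intro Bochner_Integration.integrable_add integrable_const integrable_mult_right Lp_integrable W)
  have "(\<integral>\<^sup>+x. ennreal (norm (W x)) \<partial>M) \<le> (\<integral>\<^sup>+x. ennreal (t + t powr (1 - P) * norm (W x) powr p x) \<partial>M)"
  proof (rule nn_integral_mono, rule ennreal_leI)
    fix x assume "x \<in> space M"
    then have x: "x \<in> \<Omega>" by simp
    show "norm (W x) \<le> t + t powr (1 - P) * norm (W x) powr p x"
    proof (cases "norm (W x) \<le> t")
      case True
      then show ?thesis by (smt (verit) mult_nonneg_nonneg powr_ge_zero)
    next
      case False
      then have n0: "norm (W x) > 0" using t by linarith
      have "norm (W x) = norm (W x) powr (1 - p x) * norm (W x) powr p x"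
        using n0 by (simp flip: powr_add)
      also have "\<dots> \<le> t powr (1 - P) * norm (W x) powr p x"
      proof (rule mult_right_mono)
        have "norm (W x) powr (1 - p x) \<le> t powr (1 - p x)"
          using False t p_ge1[OF x] by (intro powr_mono2') auto
        also have "\<dots> \<le> t powr (1 - P)"
          using t p_le[OF x] by (intro powr_mono') auto
        finally show "norm (W x) powr (1 - p x) \<le> t powr (1 - P)" .
      qed simp
      finally show ?thesis using t by linarith
    qed
  qed
  also have "\<dots> = ennreal (\<integral>x. t + t powr (1 - P) * norm (W x) powr p x \<partial>M)"
    using t by (intro nn_integral_eq_integral int AE_I2) auto
  also have "(\<integral>x. t + t powr (1 - P) * norm (W x) powr p x \<partial>M) = t * measure M \<Omega> + t powr (1 - P) * pmod W"
    unfolding pmod_def by (subst Bochner_Integration.integral_add) (auto intro!: Lp_integrable W)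
  finally show ?thesis .
qed

text \<open>Riesz-Fischer for the modular: a fast subsequence converges almost everywhere since its
  L^1 increments are summable, and Fatou's lemma bounds the modular distance of the whole sequence
  to the limit.\<close>

lemma Lp_complete:
  fixes U :: "nat \<Rightarrow> 'a \<Rightarrow> 'b::euclidean_space"
  assumes U: "\<And>n. U n \<in> Lp"
    and C: "\<And>e. e > 0 \<Longrightarrow> \<exists>N. \<forall>i\<ge>N. \<forall>j\<ge>N. pmod (\<lambda>x. U i x - U j x) \<le> e"
  obtains V where "mconv U V"
proof -
  note [measurable] = LpD[OF U]
  \<comment> \<open>With threshold t = 2^(-n) and modular at most t powr P, the product t powr (1 -
    P) * t powr P is t again, so \<open>L1_le_pmod\<close> makes the increments at most 2^(-n) times
    a constant.\<close>
  define c where "c = (\<lambda>n::nat. (1 / 2 ^ n) powr P :: real)"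
  have c0: "c n > 0" for n by (simp add: c_def)
  obtain N where N: "\<And>n i j. i \<ge> N n \<Longrightarrow> j \<ge> N n \<Longrightarrow> pmod (\<lambda>x. U i x - U j x) \<le> c n"
    using C[OF c0] by metis
  define s where "s = rec_nat (N 0) (\<lambda>n m. max (N (Suc n)) (Suc m))"
  have s_simps: "s 0 = N 0" "s (Suc n) = max (N (Suc n)) (Suc (s n))" for n by (simp_all add: s_def)
  have sN: "s n \<ge> N n" for n by (cases n) (simp_all add: s_simps)
  have s_mono: "strict_mono s" by (rule strict_monoI_Suc) (simp add: s_simps)
  define d where "d = (\<lambda>n x. norm (U (s (Suc n)) x - U (s n) x))"
  have [measurable]: "d n \<in> borel_measurable M" for n unfolding d_def by measurable
  have dn: "(\<integral>\<^sup>+x. ennreal (d n x) \<partial>M) \<le> ennreal ((1 / 2) ^ n * (measure M \<Omega> + 1))" for n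
  proof -
    let ?t = "1 / 2 ^ n :: real"
    have "pmod (\<lambda>x. U (s (Suc n)) x - U (s n) x) \<le> c n"
      using sN[of n] strict_monoD[OF s_mono, of n "Suc n"] by (intro N) auto
    then have "?t powr (1 - P) * pmod (\<lambda>x. U (s (Suc n)) x - U (s n) x) \<le> ?t powr (1 - P) * c n"
      by (rule mult_left_mono) simp
    also have "\<dots> = ?t" by (simp add: c_def flip: powr_add)
    finally have "?t * measure M \<Omega> + ?t powr (1 - P) * pmod (\<lambda>x. U (s (Suc n)) x - U (s n) x) \<le> (1 / 2) ^ n * (measure M \<Omega> + 1)"
      by (simp add: power_divide algebra_simps)
    with L1_le_pmod[OF Lp_diff[OF U U], of ?t "s (Suc n)" "s n"] show ?thesis
      unfolding d_def by (meson ennreal_leI order_trans divide_le_eq_1_pos one_le_power one_le_numeral zero_less_divide_1_iff zero_less_numeral zero_less_power)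
  qed
  have "(\<integral>\<^sup>+x. (\<Sum>n. ennreal (d n x)) \<partial>M) = (\<Sum>n. \<integral>\<^sup>+x. ennreal (d n x) \<partial>M)"
    by (rule nn_integral_suminf) measurable
  also have "\<dots> \<le> (\<Sum>n. ennreal ((1 / 2) ^ n * (measure M \<Omega> + 1)))"
    by (intro suminf_le dn) auto
  also have "\<dots> = ennreal (1 / (1 - 1 / 2) * (measure M \<Omega> + 1))"
    by (intro suminf_ennreal_eq sums_mult2 geometric_sums) auto
  finally have "(\<integral>\<^sup>+x. (\<Sum>n. ennreal (d n x)) \<partial>M) \<noteq> \<infinity>" by (auto simp: top_unique)
  then have "AE x in M. (\<Sum>n. ennreal (d n x)) \<noteq> \<infinity>"
    by (intro nn_integral_noteq_infinite) auto
  then have AEc: "AE x in M. convergent (\<lambda>n. U (s n) x)"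
  proof eventually_elim
    case (elim x)
    have "summable (\<lambda>n. d n x)"
      by (rule summable_suminf_not_top) (use elim in \<open>auto simp: d_def\<close>)
    then have "summable (\<lambda>n. U (s (Suc n)) x - U (s n) x)"
      unfolding d_def by (rule summable_norm_cancel)
    then have "convergent (\<lambda>n. \<Sum>i<n. U (s (Suc i)) x - U (s i) x)"
      by (simp add: summable_iff_convergent)
    then have "convergent (\<lambda>n. U (s n) x - U (s 0) x)"
      unfolding sum_lessThan_telescope[of "\<lambda>n. U (s n) x"] .
    then show ?case using convergent_diff_const_right_iff by blast
  qed
  define V where "V = (\<lambda>x. lim (\<lambda>n. U (s n) x))"
  have [measurable]: "V \<in> borel_measurable M" unfolding V_def by measurable
  have AEl: "AE x in M. (\<lambda>n. U (s n) x) \<longlonglongrightarrow> V x"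
    using AEc unfolding V_def by eventually_elim (simp add: convergent_LIMSEQ_iff)
  have key: "(\<lambda>x. U i x - V x) \<in> Lp \<and> pmod (\<lambda>x. U i x - V x) \<le> e"
    if e: "e \<ge> 0" and K: "\<And>j. j \<ge> K \<Longrightarrow> pmod (\<lambda>x. U i x - U j x) \<le> e" for i e K
  proof -
    have "(\<integral>\<^sup>+x. ennreal (norm (U i x - V x) powr p x) \<partial>M)
       = (\<integral>\<^sup>+x. liminf (\<lambda>n. ennreal (norm (U i x - U (s n) x) powr p x)) \<partial>M)"
    proof (rule nn_integral_cong_AE)
      show "AE x in M. ennreal (norm (U i x - V x) powr p x) = liminf (\<lambda>n. ennreal (norm (U i x - U (s n) x) powr p x))"
        using AEl AE_space
      proof eventually_elim
        case (elim x)
        then have "p x > 0" using p_ge1[of x] by simp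
        then have "(\<lambda>n. ennreal (norm (U i x - U (s n) x) powr p x)) \<longlonglongrightarrow> ennreal (norm (U i x - V x) powr p x)"
          using elim by (intro tendsto_ennrealI tendsto_powr' tendsto_norm tendsto_diff tendsto_const) auto
        then show ?case by (metis lim_imp_Liminf trivial_limit_sequentially)
      qed
    qed
    also have "\<dots> \<le> liminf (\<lambda>n. \<integral>\<^sup>+x. ennreal (norm (U i x - U (s n) x) powr p x) \<partial>M)"
      by (rule nn_integral_liminf) measurable
    also have "\<dots> = liminf (\<lambda>n. ennreal (pmod (\<lambda>x. U i x - U (s n) x)))"
      unfolding pmod_def by (subst nn_integral_eq_integral) (auto intro!: Lp_integrable Lp_diff U)
    also have "\<dots> \<le> ennreal e"
    proof -
      have "\<forall>\<^sub>F n in sequentially. ennreal (pmod (\<lambda>x. U i x - U (s n) x)) \<le> ennreal e"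
        using eventually_ge_at_top[of K]
      proof eventually_elim
        case (elim n)
        then have "s n \<ge> K" using strict_mono_imp_increasing[OF s_mono, of n] by linarith
        then show ?case by (intro ennreal_leI K)
      qed
      then have "liminf (\<lambda>n. ennreal (pmod (\<lambda>x. U i x - U (s n) x))) \<le> liminf (\<lambda>n::nat. ennreal e)"
        by (rule Liminf_mono)
      then show ?thesis by (simp add: Liminf_const)
    qed
    finally have le: "(\<integral>\<^sup>+x. ennreal (norm (U i x - V x) powr p x) \<partial>M) \<le> ennreal e" .
    have int: "integrable M (\<lambda>x. norm (U i x - V x) powr p x)"
      by (rule integrableI_bounded) (use le in \<open>auto simp: order_le_less_trans\<close>)
    then have "(\<lambda>x. U i x - V x) \<in> Lp" unfolding Lp_def by simp
    moreover have "ennreal (pmod (\<lambda>x. U i x - V x)) \<le> ennreal e"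
      using le int unfolding pmod_def by (subst (asm) nn_integral_eq_integral) auto
    ultimately show ?thesis using e by simp
  qed
  have "(\<lambda>x. U (N 0) x - V x) \<in> Lp"
    using key[of "c 0" "N 0" "N 0"] N[of 0] c0[of 0] by auto
  \<comment> \<open>The limit belongs to \<open>Lp\<close> because it is a difference of two
    elements of it.\<close>
  then have "(\<lambda>x. U (N 0) x - (U (N 0) x - V x)) \<in> Lp" by (rule Lp_diff[OF U])
  moreover have "(\<lambda>x. U (N 0) x - (U (N 0) x - V x)) = V" by auto
  ultimately have VL: "V \<in> Lp" by (simp only:)
  have "(\<lambda>n. pmod (\<lambda>x. U n x - V x)) \<longlonglongrightarrow> 0"
  proof (rule LIMSEQ_I)
    fix e :: real assume e: "e > 0"
    obtain K where K: "\<And>i j. i \<ge> K \<Longrightarrow> j \<ge> K \<Longrightarrow> pmod (\<lambda>x. U i x - U j x) \<le> e / 2"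
      using C[of "e / 2"] e by auto
    have "norm (pmod (\<lambda>x. U n x - V x) - 0) < e" if "n \<ge> K" for n
      using key[of "e / 2" K n] K[OF that] e pmod_nonneg[of "\<lambda>x. U n x - V x"] by auto
    then show "\<exists>no. \<forall>n\<ge>no. norm (pmod (\<lambda>x. U n x - V x) - 0) < e" by blast
  qed
  then have "mconv U V" using U VL by (simp add: mconv_def)
  then show thesis by (rule that)
qed

end

section \<open>Smooth test functions\<close>

lemma frechet_eqI: "(f has_derivative f') (at x) \<Longrightarrow> frechet_derivative f (at x) = f'"
  by (rule frechet_derivative_at[symmetric])

lemma C_k_SucD: "C_k (Suc k) f \<Longrightarrow> C_k k f"
proof (induction k arbitrary: f)
  case 0
  then show ?case by (simp add: differentiable_imp_continuous_on)
next
  case (Suc k)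
  then show ?case by auto
qed

lemma C_k_has_derivative: "C_k (Suc k) f \<Longrightarrow> (f has_derivative frechet_derivative f (at x)) (at x)"
  by (simp add: differentiable_on_def frechet_derivative_works)

lemma C_k_SucI:
  assumes "\<And>x. (f has_derivative f' x) (at x)" "\<And>b. b \<in> Basis \<Longrightarrow> C_k k (\<lambda>x. f' x b)"
  shows "C_k (Suc k) f"
proof -
  have "frechet_derivative f (at x) = f' x" for x by (rule frechet_eqI[OF assms(1)])
  moreover have "f differentiable_on UNIV"
    using assms(1) unfolding differentiable_on_def differentiable_def by auto
  ultimately show ?thesis using assms(2) by simp
qed

lemma C_k_const: "C_k k (\<lambda>x. c)"
proof (induction k arbitrary: c)
  case (Suc k)
  show ?case by (rule C_k_SucI[where f'="\<lambda>x h. 0"]) (auto intro: Suc)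
qed simp

lemma C_k_add: "C_k k f \<Longrightarrow> C_k k g \<Longrightarrow> C_k k (\<lambda>x. f x + g x)"
proof (induction k arbitrary: f g)
  case (Suc k)
  show ?case
  proof (rule C_k_SucI[where f'="\<lambda>x h. frechet_derivative f (at x) h + frechet_derivative g (at x) h"])
    show "((\<lambda>x. f x + g x) has_derivative (\<lambda>h. frechet_derivative f (at x) h + frechet_derivative g (at x) h)) (at x)" for x
      by (intro has_derivative_add C_k_has_derivative[OF Suc.prems(1)] C_k_has_derivative[OF Suc.prems(2)])
    show "C_k k (\<lambda>x. frechet_derivative f (at x) b + frechet_derivative g (at x) b)" if "b \<in> Basis" for b
      using Suc.prems that by (intro Suc.IH) auto
  qed
qed (auto intro: continuous_intros)

lemma C_k_mult: "C_k k f \<Longrightarrow> C_k k g \<Longrightarrow> C_k k (\<lambda>x. f x * g x)"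
proof (induction k arbitrary: f g)
  case (Suc k)
  show ?case
  proof (rule C_k_SucI[where f'="\<lambda>x h. f x * frechet_derivative g (at x) h + frechet_derivative f (at x) h * g x"])
    show "((\<lambda>x. f x * g x) has_derivative (\<lambda>h. f x * frechet_derivative g (at x) h + frechet_derivative f (at x) h * g x)) (at x)" for x
      by (intro has_derivative_mult C_k_has_derivative[OF Suc.prems(1)] C_k_has_derivative[OF Suc.prems(2)])
    show "C_k k (\<lambda>x. f x * frechet_derivative g (at x) b + frechet_derivative f (at x) b * g x)" if "b \<in> Basis" for b
      using Suc.prems that C_k_SucD[OF Suc.prems(1)] C_k_SucD[OF Suc.prems(2)] by (intro C_k_add Suc.IH) auto
  qed
qed (auto intro: continuous_intros)

lemma C_k_inner: "C_k k (\<lambda>x. x \<bullet> c)"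
proof (cases k)
  case (Suc j)
  show ?thesis unfolding Suc
    by (rule C_k_SucI[where f'="\<lambda>x h. h \<bullet> c"]) (auto intro!: derivative_eq_intros C_k_const)
qed (auto intro: continuous_intros)

text \<open>Smoothness of the outer function is encoded as a sequence in which each member is the
  derivative of its predecessor. The claim must be proved for all members at once, because the chain
  rule moves from index n to n + 1.\<close>

lemma C_k_compose:
  fixes \<eta> :: "nat \<Rightarrow> real \<Rightarrow> real"
  assumes d: "\<And>n t. (\<eta> n has_real_derivative \<eta> (Suc n) t) (at t)"
  shows "C_k k \<phi> \<Longrightarrow> C_k k (\<lambda>x. \<eta> n (\<phi> x))"
proof (induction k arbitrary: n \<phi>)
  case 0
  have "continuous_on UNIV (\<eta> n)" using d by (intro DERIV_continuous_on) (auto intro: has_field_derivative_at_within)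
  then show ?case using 0 by (auto intro: continuous_on_compose2)
next
  case (Suc k)
  show ?case
  proof (rule C_k_SucI[where f'="\<lambda>x h. frechet_derivative \<phi> (at x) h * \<eta> (Suc n) (\<phi> x)"])
    show "((\<lambda>x. \<eta> n (\<phi> x)) has_derivative (\<lambda>h. frechet_derivative \<phi> (at x) h * \<eta> (Suc n) (\<phi> x))) (at x)" for x
      using has_derivative_compose[OF C_k_has_derivative[OF Suc.prems] d[of n "\<phi> x", unfolded has_field_derivative_def]]
      by (simp add: mult.commute)
    show "C_k k (\<lambda>x. frechet_derivative \<phi> (at x) b * \<eta> (Suc n) (\<phi> x))" if "b \<in> Basis" for b
      using Suc.prems that C_k_SucD[OF Suc.prems] by (intro C_k_mult Suc.IH) auto
  qed
qed

lemma smooth_has_derivative: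
  assumes "smooth_fun f"
  shows "(f has_derivative (\<lambda>h. grad f x \<bullet> h)) (at x)"
proof -
  have d: "(f has_derivative frechet_derivative f (at x)) (at x)"
    using assms C_k_has_derivative unfolding smooth_fun_def by blast
  then have l: "linear (frechet_derivative f (at x))" by (rule has_derivative_linear)
  have "frechet_derivative f (at x) h = grad f x \<bullet> h" for h
  proof -
    have "frechet_derivative f (at x) h = frechet_derivative f (at x) (\<Sum>b\<in>Basis. (h \<bullet> b) *\<^sub>R b)"
      by (simp add: euclidean_representation)
    also have "\<dots> = (\<Sum>b\<in>Basis. (h \<bullet> b) * frechet_derivative f (at x) b)"
      by (simp add: linear_sum[OF l] linear_scale[OF l])
    also have "\<dots> = grad f x \<bullet> h"
      by (simp add: grad_def inner_sum_left inner_commute[of h] mult.commute)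
    finally show ?thesis .
  qed
  then show ?thesis using d by (metis (no_types, lifting) ext)
qed

lemma grad_eqI:
  assumes "(f has_derivative (\<lambda>h. g \<bullet> h)) (at x)" shows "grad f x = g"
  by (simp add: grad_def frechet_eqI[OF assms] euclidean_representation)

lemma frechet_derivative_eq_grad: "smooth_fun f \<Longrightarrow> frechet_derivative f (at x) h = grad f x \<bullet> h"
  by (simp add: frechet_eqI[OF smooth_has_derivative])

lemma smooth_continuous_grad:
  assumes "smooth_fun f" shows "continuous_on UNIV (grad f)"
proof -
  have "C_k (Suc 0) f" using assms unfolding smooth_fun_def by blast
  then have "b \<in> Basis \<Longrightarrow> continuous_on UNIV (\<lambda>x. frechet_derivative f (at x) b)" for b by simp
  then show ?thesis unfolding grad_def by (intro continuous_on_sum continuous_on_scaleR continuous_on_const)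
qed

lemma smooth_continuous: "smooth_fun f \<Longrightarrow> continuous_on UNIV f"
  unfolding smooth_fun_def by (drule spec[of _ 0]) simp

lemma smooth_add: "smooth_fun f \<Longrightarrow> smooth_fun g \<Longrightarrow> smooth_fun (\<lambda>x. f x + g x)"
  unfolding smooth_fun_def by (intro allI C_k_add) blast+

lemma smooth_mult: "smooth_fun f \<Longrightarrow> smooth_fun g \<Longrightarrow> smooth_fun (\<lambda>x. f x * g x)"
  unfolding smooth_fun_def by (intro allI C_k_mult) blast+

lemma smooth_const: "smooth_fun (\<lambda>x. c)"
  unfolding smooth_fun_def by (intro allI C_k_const)

lemma smooth_inner: "smooth_fun (\<lambda>x. x \<bullet> v)"
  unfolding smooth_fun_def by (intro allI C_k_inner)

lemma smooth_compose:
  assumes "\<And>n t. (\<eta> n has_real_derivative \<eta> (Suc n) t) (at t)" "smooth_fun \<phi>"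
  shows "smooth_fun (\<lambda>x. \<eta> n (\<phi> x))"
  unfolding smooth_fun_def
proof
  fix k
  show "C_k k (\<lambda>x. \<eta> n (\<phi> x))"
    by (rule C_k_compose[where \<eta>=\<eta> and n=n and \<phi>=\<phi>]) (use assms in \<open>auto simp: smooth_fun_def\<close>)
qed

lemma smooth_sum: "finite A \<Longrightarrow> (\<And>i. i \<in> A \<Longrightarrow> smooth_fun (f i)) \<Longrightarrow> smooth_fun (\<lambda>x. \<Sum>i\<in>A. f i x)"
proof (induction A rule: finite_induct)
  case (insert a A)
  have "smooth_fun (\<lambda>x. f a x + (\<Sum>i\<in>A. f i x))"
    by (intro smooth_add insert.IH insert.prems) auto
  then show ?case using insert.hyps by simp
qed (simp add: smooth_const)

lemma grad_add: "smooth_fun f \<Longrightarrow> smooth_fun g \<Longrightarrow> grad (\<lambda>x. f x + g x) x = grad f x + grad g x"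
  by (rule grad_eqI, unfold inner_add_left) (intro has_derivative_add smooth_has_derivative)

lemma grad_cmult: "smooth_fun f \<Longrightarrow> grad (\<lambda>x. c * f x) x = c *\<^sub>R grad f x"
  by (rule grad_eqI, unfold inner_scaleR_left) (intro has_derivative_mult_right smooth_has_derivative)

lemma grad_mult:
  assumes "smooth_fun f" "smooth_fun g"
  shows "grad (\<lambda>x. f x * g x) x = f x *\<^sub>R grad g x + g x *\<^sub>R grad f x"
proof (rule grad_eqI)
  have "((\<lambda>x. f x * g x) has_derivative (\<lambda>h. f x * (grad g x \<bullet> h) + (grad f x \<bullet> h) * g x)) (at x)"
    by (intro has_derivative_mult smooth_has_derivative assms)
  then show "((\<lambda>x. f x * g x) has_derivative (\<lambda>h. (f x *\<^sub>R grad g x + g x *\<^sub>R grad f x) \<bullet> h)) (at x)"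
    by (simp add: inner_add_left mult.commute)
qed

lemma grad_compose:
  assumes "(h has_real_derivative h') (at (f x))" "smooth_fun f"
  shows "grad (\<lambda>x. h (f x)) x = h' *\<^sub>R grad f x"
  by (rule grad_eqI)
    (use has_derivative_compose[OF smooth_has_derivative[OF assms(2)] assms(1)[unfolded has_field_derivative_def]] in simp)

lemma test_fun_smooth: "test_fun S f \<Longrightarrow> smooth_fun f" by (simp add: test_fun_def)

lemma compact_closure_subset: "compact K \<Longrightarrow> closure T \<subseteq> K \<Longrightarrow> compact (closure T)"
  using compact_Int_closed[of K "closure T"] by (simp add: inf.absorb2)

lemma test_fun_subset:
  assumes "test_fun S f" "smooth_fun g" "{x. g x \<noteq> 0} \<subseteq> {x. f x \<noteq> 0}"
  shows "test_fun S g"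
proof -
  have f: "compact (closure {x. f x \<noteq> 0})" "closure {x. f x \<noteq> 0} \<subseteq> S"
    using assms(1) unfolding test_fun_def by blast+
  have sub: "closure {x. g x \<noteq> 0} \<subseteq> closure {x. f x \<noteq> 0}" by (rule closure_mono[OF assms(3)])
  show ?thesis unfolding test_fun_def
    using assms(2) compact_closure_subset[OF f(1) sub] order_trans[OF sub f(2)] by blast
qed

lemma test_fun_add:
  assumes "test_fun S f" "test_fun S g" shows "test_fun S (\<lambda>x. f x + g x)"
proof -
  let ?K = "closure {x. f x \<noteq> 0} \<union> closure {x. g x \<noteq> 0}"
  have K: "compact ?K" "?K \<subseteq> S"
    using assms unfolding test_fun_def by (blast intro: compact_Un)+
  have sub: "closure {x. f x + g x \<noteq> 0} \<subseteq> ?K"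
    unfolding closure_Un[symmetric] by (rule closure_mono) auto
  have "smooth_fun (\<lambda>x. f x + g x)" using assms by (intro smooth_add test_fun_smooth)
  then show ?thesis unfolding test_fun_def
    using compact_closure_subset[OF K(1) sub] order_trans[OF sub K(2)] by blast
qed

lemma test_fun_cmult:
  assumes "test_fun S f" shows "test_fun S (\<lambda>x. c * f x)"
proof (rule test_fun_subset[OF assms])
  show "smooth_fun (\<lambda>x. c * f x)" by (intro smooth_mult smooth_const test_fun_smooth[OF assms])
  show "{x. c * f x \<noteq> 0} \<subseteq> {x. f x \<noteq> 0}" by auto
qed

lemma test_fun_mult:
  assumes "test_fun S f" "test_fun S g" shows "test_fun S (\<lambda>x. f x * g x)"
proof (rule test_fun_subset[OF assms(1)])
  show "smooth_fun (\<lambda>x. f x * g x)" by (rule smooth_mult[OF assms[THEN test_fun_smooth]])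
  show "{x. f x * g x \<noteq> 0} \<subseteq> {x. f x \<noteq> 0}" by auto
qed

lemma test_fun_compose:
  assumes d: "\<And>n t. (\<eta> n has_real_derivative \<eta> (Suc n) t) (at t)" and \<phi>: "test_fun S \<phi>" and z: "\<eta> 0 0 = 0"
  shows "test_fun S (\<lambda>x. \<eta> 0 (\<phi> x))"
proof (rule test_fun_subset[OF \<phi>])
  show "smooth_fun (\<lambda>x. \<eta> 0 (\<phi> x))" 
    by (rule smooth_compose[where \<eta>=\<eta> and n=0 and \<phi>=\<phi>]) (use d test_fun_smooth[OF \<phi>] in auto)
  show "{x. \<eta> 0 (\<phi> x) \<noteq> 0} \<subseteq> {x. \<phi> x \<noteq> 0}"
  proof
    fix x assume "x \<in> {x. \<eta> 0 (\<phi> x) \<noteq> 0}"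
    then have "\<phi> x \<noteq> 0" using z by (intro notI) simp
    then show "x \<in> {x. \<phi> x \<noteq> 0}" by simp
  qed
qed

lemma test_fun_zero_outside: "test_fun S f \<Longrightarrow> x \<notin> S \<Longrightarrow> f x = 0"
  unfolding test_fun_def using closure_subset[of "{x. f x \<noteq> 0}"] by blast

lemma test_fun_grad_zero_outside:
  assumes "test_fun S f" "x \<notin> S" shows "grad f x = 0"
proof (rule grad_eqI)
  show "(f has_derivative (\<lambda>h. 0 \<bullet> h)) (at x)"
  proof (rule has_derivative_transform_within_open)
    show "((\<lambda>x. 0::real) has_derivative (\<lambda>h. 0 \<bullet> h)) (at x)" by simp
    show "open (- closure {x. f x \<noteq> 0})" by (intro open_Compl closed_closure)
    show "x \<in> - closure {x. f x \<noteq> 0}"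
      using assms(2) assms(1)[unfolded test_fun_def, THEN conjunct2, THEN conjunct2] by blast
    show "0 = f y" if "y \<in> - closure {x. f x \<noteq> 0}" for y
      by (metis (mono_tags, lifting) that ComplD mem_Collect_eq subsetD closure_subset)
  qed
qed

lemma test_fun_c1_compact:
  assumes "test_fun S f" "S \<subseteq> ball 0 R" "R > 0"
  shows "c1_compact f (grad f) R"
proof
  show "(f has_derivative (\<lambda>h. grad f x \<bullet> h)) (at x)" for x
    by (rule smooth_has_derivative[OF test_fun_smooth[OF assms(1)]])
  show "continuous_on UNIV (grad f)" by (rule smooth_continuous_grad[OF test_fun_smooth[OF assms(1)]])
  show "f x = 0" if "R \<le> norm x" for x
    using that assms by (intro test_fun_zero_outside[OF assms(1)]) auto
qed fact

lemma test_fun_bounded: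
  assumes "test_fun S f"
  obtains K where "\<And>x. norm (f x) \<le> K" "\<And>x. norm (grad f x) \<le> K"
proof -
  let ?C = "closure {x. f x \<noteq> 0}"
  have C: "compact ?C" using assms by (simp add: test_fun_def)
  have sm: "smooth_fun f" by (rule test_fun_smooth[OF assms])
  have t: "test_fun ?C f" using assms by (simp add: test_fun_def)
  have "bounded (f ` ?C)" "bounded (grad f ` ?C)"
    by (intro compact_imp_bounded compact_continuous_image C continuous_on_subset[OF smooth_continuous[OF sm]]
      continuous_on_subset[OF smooth_continuous_grad[OF sm]]; simp)+
  then obtain a b where ab: "\<forall>x\<in>?C. norm (f x) \<le> a" "\<forall>x\<in>?C. norm (grad f x) \<le> b"
    unfolding bounded_iff by blast
  have "norm (f x) \<le> max 0 (max a b)" "norm (grad f x) \<le> max 0 (max a b)" for x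
  proof -
    consider "x \<in> ?C" | "f x = 0" "grad f x = 0"
      using test_fun_zero_outside[OF t, of x] test_fun_grad_zero_outside[OF t, of x] by blast
    then show "norm (f x) \<le> max 0 (max a b)" "norm (grad f x) \<le> max 0 (max a b)"
      using ab(1)[rule_format, of x] ab(2)[rule_format, of x] by (cases; force)+
  qed
  then show thesis by (rule that)
qed

text \<open>Derivatives of \<open>exp (-1/t)\<close> are polynomials in \<open>1/t\<close> times \<open>exp (-1/t)\<close>.\<close>

fun flat_poly :: "nat \<Rightarrow> real poly" where
  "flat_poly 0 = 1"
| "flat_poly (Suc n) = monom 1 2 * (flat_poly n - pderiv (flat_poly n))"

definition flat :: "nat \<Rightarrow> real \<Rightarrow> real" where
  "flat n t = (if t > 0 then poly (flat_poly n) (1 / t) * exp (- (1 / t)) else 0)"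

lemma poly_exp_tendsto: "((\<lambda>s. poly q s * exp (- s)) \<longlongrightarrow> (0::real)) at_top"
proof -
  have "((\<lambda>s. \<Sum>i\<le>degree q. coeff q i * (s ^ i / exp s)) \<longlongrightarrow> (\<Sum>i\<le>degree q. coeff q i * 0)) at_top"
    by (intro tendsto_sum tendsto_mult tendsto_const tendsto_power_div_exp_0)
  then show ?thesis by (simp add: poly_altdef sum_distrib_right exp_minus divide_inverse mult.assoc)
qed

lemma flat_has_derivative: "(flat n has_real_derivative flat (Suc n) t) (at t)"
proof -
  consider "t > 0" | "t < 0" | "t = 0" by linarith
  then show ?thesis
  proof cases
    case 1
    have "((\<lambda>t. poly (flat_poly n) (1 / t) * exp (- (1 / t))) has_real_derivative flat (Suc n) t) (at t)"
      using 1 by (auto intro!: derivative_eq_intros simp: flat_def poly_monom field_simps power2_eq_square)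
    then show ?thesis
      by (rule has_field_derivative_transform_within_open[of _ _ _ "{0<..}"]) (use 1 in \<open>auto simp: flat_def\<close>)
  next
    case 2
    have "((\<lambda>t::real. 0) has_real_derivative flat (Suc n) t) (at t)" using 2 by (simp add: flat_def)
    then show ?thesis
      by (rule has_field_derivative_transform_within_open[of _ _ _ "{..<0}"]) (use 2 in \<open>auto simp: flat_def\<close>)
  next
    case 3
    have l: "((\<lambda>y. (flat n y - flat n 0) / (y - 0)) \<longlongrightarrow> 0) (at_left 0)"
      by (rule tendsto_eventually) (auto simp: flat_def eventually_at_filter)
    \<comment> \<open>The difference quotient at 0 carries an extra factor 1 / t, which becomes the
      monomial after the substitution s = 1 / t.\<close>
    have "((\<lambda>s. poly (flat_poly n * monom 1 1) s * exp (- s)) \<longlongrightarrow> 0) at_top" by (rule poly_exp_tendsto)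
    then have "((\<lambda>y. poly (flat_poly n * monom 1 1) (inverse y) * exp (- inverse y)) \<longlongrightarrow> 0) (at_right 0)"
      by (rule filterlim_compose) (rule filterlim_inverse_at_top_right)
    then have r: "((\<lambda>y. (flat n y - flat n 0) / (y - 0)) \<longlongrightarrow> 0) (at_right 0)"
      by (rule Lim_transform_eventually)
        (auto simp: eventually_at_filter flat_def poly_monom inverse_eq_divide)
    show ?thesis unfolding has_field_derivative_iff 3
      using filterlim_split_at[OF l r] by (simp add: flat_def)
  qed
qed

lemma flat_0: "flat 0 t = (if t > 0 then exp (- (1 / t)) else 0)" by (simp add: flat_def)

lemma flat_nonneg: "flat 0 t \<ge> 0" and flat_pos: "t > 0 \<Longrightarrow> flat 0 t > 0" by (simp_all add: flat_0)

text \<open>This bound and the next one, on the derivative, give the smooth truncation built from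
  \<open>flat 0\<close> linear growth on pairs of function and gradient.\<close>

lemma flat_le: "flat 0 t \<le> \<bar>t\<bar>"
proof (cases "t > 0")
  case True
  have "1 / t \<le> exp (1 / t)" using exp_ge_add_one_self[of "1 / t"] by linarith
  then show ?thesis using True by (simp add: flat_0 exp_minus field_simps)
qed (simp add: flat_0)

lemma flat_1_bounds: "0 \<le> flat 1 t" "flat 1 t \<le> 2"
proof -
  have "flat 1 t = (if t > 0 then (1 / t)\<^sup>2 * exp (- (1 / t)) else 0)"
    by (simp add: flat_def poly_monom)
  moreover have "(1 / t)\<^sup>2 * exp (- (1 / t)) \<le> 2" if "t > 0"
  proof -
    have "1 + 1 / t + (1 / t)\<^sup>2 / 2 \<le> exp (1 / t)" using that by (intro exp_lower_Taylor_quadratic) simp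
    then have "(1 / t)\<^sup>2 \<le> 2 * exp (1 / t)" using that by (smt (verit) divide_nonneg_pos field_sum_of_halves)
    moreover have "X * inverse E \<le> 2" if "X \<le> 2 * E" "E > 0" for X E :: real
      using that by (simp add: field_simps)
    ultimately show ?thesis by (simp only: exp_minus exp_gt_zero)
  qed
  ultimately show "0 \<le> flat 1 t" "flat 1 t \<le> 2" by auto
qed

text \<open>\<open>flat 0\<close> applied to e^2 - |x - x0|^2. The ball of positivity is returned as
  well, since it later makes integrals of powers strictly positive.\<close>

lemma exists_bump:
  fixes S :: "'a::euclidean_space set"
  assumes "open S" "S \<noteq> {}"
  obtains b x0 e where "test_fun S b" "\<And>x. b x \<ge> 0" "e > 0" "ball x0 e \<subseteq> S" "\<And>x. x \<in> ball x0 e \<Longrightarrow> b x > 0"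
proof -
  obtain x0 where "x0 \<in> S" using assms by auto
  then obtain e where e: "e > 0" "cball x0 e \<subseteq> S" using assms(1) open_contains_cball by blast
  define q where "q = (\<lambda>x::'a. e\<^sup>2 - (x - x0) \<bullet> (x - x0))"
  have qs: "smooth_fun q"
  proof -
    \<comment> \<open>The quadratic is rewritten as a polynomial in functions of the form x
      \<bullet> v, for which smoothness is known.\<close>
    have "smooth_fun (\<lambda>x. (e\<^sup>2 + (-1) * (\<Sum>b\<in>Basis. (x \<bullet> b) * (x \<bullet> b))) + ((x \<bullet> (2 *\<^sub>R x0)) + - (x0 \<bullet> x0)))"
      by (intro smooth_add smooth_mult smooth_sum smooth_inner smooth_const) auto
    moreover have "(e\<^sup>2 + (-1) * (\<Sum>b\<in>Basis. (x \<bullet> b) * (x \<bullet> b))) + ((x \<bullet> (2 *\<^sub>R x0)) + - (x0 \<bullet> x0)) = q x" for x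
      unfolding euclidean_inner[of x x, symmetric] q_def by (simp add: inner_diff inner_commute[of x0 x] algebra_simps)
    ultimately show ?thesis by simp
  qed
  have qpos: "q x > 0 \<longleftrightarrow> x \<in> ball x0 e" for x
  proof -
    have "q x = e\<^sup>2 - (dist x0 x)\<^sup>2" by (simp add: q_def dist_norm norm_minus_commute[of x0 x] power2_norm_eq_inner)
    moreover have "(dist x0 x)\<^sup>2 < e\<^sup>2 \<longleftrightarrow> dist x0 x < e"
      using e(1) power2_less_imp_less[of "dist x0 x" e] power_strict_mono[of "dist x0 x" e 2] by auto
    ultimately show ?thesis by simp
  qed
  have flat_q: "flat 0 (q x) \<noteq> 0 \<longleftrightarrow> x \<in> ball x0 e" for x
    unfolding qpos[symmetric] by (simp add: flat_0)
  have "closure {x. flat 0 (q x) \<noteq> 0} = cball x0 e"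
    unfolding flat_q Collect_mem_eq using e(1) by simp
  moreover have "smooth_fun (\<lambda>x. flat 0 (q x))"
    by (rule smooth_compose[where \<eta>=flat and n=0 and \<phi>=q, OF flat_has_derivative qs])
  ultimately have "test_fun S (\<lambda>x. flat 0 (q x))"
    unfolding test_fun_def using e(2) by simp
  then show thesis
  proof (rule that)
    show "ball x0 e \<subseteq> S" using e(2) ball_subset_cball by blast
    show "flat 0 (q x) > 0" if "x \<in> ball x0 e" for x
      by (rule flat_pos) (use that qpos in blast)
  qed (fact e flat_nonneg)+
qed

section \<open>The energy space\<close>

definition jet :: "('a::euclidean_space \<Rightarrow> real) \<Rightarrow> 'a \<Rightarrow> real \<times> 'a" where
  "jet \<phi> x = (\<phi> x, grad \<phi> x)"

text \<open>\<open>r\<close> and \<open>P\<close> enclose the exponent, and \<open>q\<close> lies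
  strictly between \<open>P\<close> and the critical exponent of \<open>r\<close>. Constant-exponent
  estimates are applied with gradient exponent \<open>r\<close> and target exponent up to
  \<open>q\<close>.\<close>

locale sobolev_setting = variable_exponent \<Omega> p P
  for \<Omega> :: "'a::euclidean_space set" and p and P +
  fixes r q R :: real
  assumes r_ge1: "1 \<le> r" and r_le: "\<And>x. x \<in> \<Omega> \<Longrightarrow> r \<le> p x" and r_less: "r < DIM('a)"
    and q_gt: "P < q" and q_less: "q < DIM('a) * r / (DIM('a) - r)"
    and ballO: "\<Omega> \<subseteq> ball 0 R" and R_pos: "R > 0" and O_ne: "\<Omega> \<noteq> {}"
begin

abbreviation "\<mu> \<equiv> measure M \<Omega>"

lemma mu_pos: "\<mu> > 0"
proof -
  obtain x e where "e > 0" "ball x e \<subseteq> \<Omega>" using openO O_ne open_contains_ball by blast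
  have "\<Omega> \<in> lmeasurable" by (rule bounded_set_imp_lmeasurable[OF boundedO O_sets])
  have "0 < measure lebesgue (ball x e)" using content_ball_pos[OF \<open>e > 0\<close>, of x] by simp
  also have "\<dots> \<le> measure lebesgue \<Omega>"
    by (rule measure_mono_fmeasurable) (use \<open>\<Omega> \<in> lmeasurable\<close> \<open>ball x e \<subseteq> \<Omega>\<close> in auto)
  finally show ?thesis by (simp add: measure_restrict_space)
qed

lemma emeasure_O: "emeasure lborel \<Omega> = ennreal \<mu>"
proof -
  have "emeasure M \<Omega> = emeasure lebesgue \<Omega>" by (simp add: emeasure_restrict_space)
  also have "\<dots> = emeasure lborel \<Omega>" using openO by simp
  finally show ?thesis by (metis emeasure_eq_measure)
qed

lemma nn_integral_M_eq_lborel: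
  assumes f: "f \<in> borel_measurable borel" and z: "\<And>x. x \<notin> \<Omega> \<Longrightarrow> f x = 0"
  shows "(\<integral>\<^sup>+x. f x \<partial>M) = (\<integral>\<^sup>+x. f x \<partial>lborel)"
proof -
  have "(\<integral>\<^sup>+x. f x \<partial>M) = (\<integral>\<^sup>+x. f x * indicator \<Omega> x \<partial>lebesgue)"
    by (rule nn_integral_restrict_space) simp
  also have "\<dots> = (\<integral>\<^sup>+x. f x \<partial>lebesgue)"
    by (rule nn_integral_cong) (use z in \<open>auto simp: indicator_def\<close>)
  also have "\<dots> = (\<integral>\<^sup>+x. f x \<partial>lborel)"
    by (rule nn_integral_completion)
  finally show ?thesis .
qed

lemma pmod_nn_integral: "U \<in> Lp \<Longrightarrow> ennreal (pmod U) = (\<integral>\<^sup>+x. ennreal (norm (U x) powr p x) \<partial>M)"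
  unfolding pmod_def by (rule nn_integral_eq_integral[symmetric]) (auto intro: Lp_integrable)

lemma test_c1: "test_fun \<Omega> \<phi> \<Longrightarrow> c1_compact \<phi> (grad \<phi>) R"
  by (rule test_fun_c1_compact[OF _ ballO R_pos])

lemma test_Lp:
  assumes "test_fun \<Omega> \<phi>"
  shows "\<phi> \<in> Lp" "grad \<phi> \<in> Lp" "jet \<phi> \<in> Lp"
proof -
  obtain K where K: "\<And>x. norm (\<phi> x) \<le> K" "\<And>x. norm (grad \<phi> x) \<le> K"
    using test_fun_bounded[OF assms] by blast
  show 1: "\<phi> \<in> Lp" and 2: "grad \<phi> \<in> Lp"
    by (rule bounded_in_Lp[OF borel_imp_M[OF c1_compact.borel(1)[OF test_c1[OF assms]]] K(1)])
      (rule bounded_in_Lp[OF borel_imp_M[OF c1_compact.borel(2)[OF test_c1[OF assms]]] K(2)])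
  show "jet \<phi> \<in> Lp" using Lp_Pair(1)[OF 1 2] by (simp add: jet_def[abs_def])
qed

text \<open>It takes the place of the norm of the energy space; \<open>modular_small\<close> shows
  that on \<open>E\<close> it controls the modular of the whole pair.\<close>

definition gmod :: "('a \<Rightarrow> real \<times> 'a) \<Rightarrow> real" where
  "gmod U = pmod (\<lambda>x. snd (U x))"

lemma gmod_nonneg: "gmod U \<ge> 0" by (simp add: gmod_def pmod_nonneg)

lemma gmod_jet: "gmod (jet \<phi>) = pmod (grad \<phi>)" by (simp add: gmod_def jet_def)

lemma growth_gmod: "growth (\<lambda>x (y :: real \<times> 'a). norm (snd y) powr p x)"
  unfolding growth_def
proof (intro conjI exI[of _ 1] ballI allI)
  show "continuous_on (\<Omega> \<times> UNIV) (\<lambda>(x, y). norm (snd y :: 'a) powr p x)"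
    using p_ge1 unfolding case_prod_beta'
    by (intro continuous_on_powr' continuous_intros continuous_on_compose2[OF p_cont]) force+
  fix x and y :: "real \<times> 'a" assume x: "x \<in> \<Omega>"
  have "norm (snd y) powr p x \<le> norm y powr p x"
    using p_ge1[OF x] norm_snd_le[of "snd y" "fst y"] by (intro powr_mono2) auto
  then show "\<bar>norm (snd y) powr p x\<bar> \<le> 1 * (1 + norm y powr p x)" by simp
qed

lemma gmod_tendsto: "mconv U V \<Longrightarrow> (\<lambda>n. gmod (U n)) \<longlonglongrightarrow> gmod V"
  unfolding gmod_def pmod_def by (rule growth_tendsto[OF growth_gmod])

text \<open>Elements are pairs of a function and its gradient. Only limits of jets occur, so that
  neither uniqueness nor a calculus of weak gradients is needed.\<close>

definition E :: "('a \<Rightarrow> real \<times> 'a) set" where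
  "E = {U. \<exists>\<phi>. (\<forall>n. test_fun \<Omega> (\<phi> n)) \<and> mconv (\<lambda>n. jet (\<phi> n)) U}"

lemma E_Lp: "U \<in> E \<Longrightarrow> U \<in> Lp" by (auto simp: E_def mconv_def)

lemma mconv_const: "U \<in> Lp \<Longrightarrow> mconv (\<lambda>n. U) U"
  using p_ge1 by (auto simp: mconv_def pmod_def)

lemma E_jet:
  assumes "test_fun \<Omega> \<phi>" shows "jet \<phi> \<in> E"
  unfolding E_def mem_Collect_eq
  by (intro exI[of _ "\<lambda>n. \<phi>"] conjI allI assms mconv_const[OF test_Lp(3)[OF assms]])

lemma E_I: "(\<And>n. test_fun \<Omega> (\<phi> n)) \<Longrightarrow> mconv (\<lambda>n. jet (\<phi> n)) U \<Longrightarrow> U \<in> E"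
  unfolding E_def mem_Collect_eq by (intro exI[of _ \<phi>] conjI allI)

lemma E_obtain:
  assumes "U \<in> E"
  obtains \<phi> where "\<And>n. test_fun \<Omega> (\<phi> n)" "mconv (\<lambda>n. jet (\<phi> n)) U"
  using assms unfolding E_def by blast

lemma E_approx:
  assumes "U \<in> E" "e > 0"
  obtains \<phi> where "test_fun \<Omega> \<phi>" "pmod (\<lambda>x. jet \<phi> x - U x) < e"
proof -
  obtain \<phi> where \<phi>: "\<And>n. test_fun \<Omega> (\<phi> n)" "mconv (\<lambda>n. jet (\<phi> n)) U"
    using E_obtain[OF assms(1)] by blast
  then have "\<forall>\<^sub>F n in sequentially. pmod (\<lambda>x. jet (\<phi> n) x - U x) < e"
    unfolding mconv_def using assms(2) by (intro order_tendstoD(2)[where y=0]) auto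
  then obtain n where "pmod (\<lambda>x. jet (\<phi> n) x - U x) < e" by (auto simp: eventually_sequentially)
  with \<phi>(1) show thesis by (rule that)
qed

text \<open>A diagonal choice of test functions, with the triangle inequality of the modular up to
  the factor 2 powr P.\<close>

lemma E_closed:
  assumes U: "\<And>n. U n \<in> E" and c: "mconv U V" shows "V \<in> E"
proof -
  have "\<exists>\<phi>. test_fun \<Omega> \<phi> \<and> pmod (\<lambda>x. jet \<phi> x - U n x) < 1 / real (Suc n)" for n
    using E_approx[OF U, of "1 / real (Suc n)" n] by auto
  then obtain \<phi> where \<phi>: "\<And>n. test_fun \<Omega> (\<phi> n)" "\<And>n. pmod (\<lambda>x. jet (\<phi> n) x - U n x) < 1 / real (Suc n)"
    by metis
  have VL: "V \<in> Lp" using c by (simp add: mconv_def)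
  have "(\<lambda>n. pmod (\<lambda>x. jet (\<phi> n) x - V x)) \<longlonglongrightarrow> 0"
  proof (rule real_tendsto_sandwich[OF _ _ tendsto_const])
    show "\<forall>\<^sub>F n in sequentially. pmod (\<lambda>x. jet (\<phi> n) x - V x) \<le> 2 powr P * (1 / real (Suc n) + pmod (\<lambda>x. U n x - V x))"
    proof (intro always_eventually allI)
      fix n
      have "pmod (\<lambda>x. jet (\<phi> n) x - V x) \<le> 2 powr P * (pmod (\<lambda>x. jet (\<phi> n) x - U n x) + pmod (\<lambda>x. U n x - V x))"
        by (rule pmod_triangle[OF test_Lp(3)[OF \<phi>(1)] E_Lp[OF U] VL])
      also have "\<dots> \<le> 2 powr P * (1 / real (Suc n) + pmod (\<lambda>x. U n x - V x))"
        using \<phi>(2)[of n] by (intro mult_left_mono add_right_mono) auto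
      finally show "pmod (\<lambda>x. jet (\<phi> n) x - V x) \<le> 2 powr P * (1 / real (Suc n) + pmod (\<lambda>x. U n x - V x))" .
    qed
    have "(\<lambda>n. 2 powr P * (1 / real (Suc n) + pmod (\<lambda>x. U n x - V x))) \<longlonglongrightarrow> 2 powr P * (0 + 0)"
      using c unfolding mconv_def by (intro tendsto_intros LIMSEQ_Suc[OF lim_1_over_n]) auto
    then show "(\<lambda>n. 2 powr P * (1 / real (Suc n) + pmod (\<lambda>x. U n x - V x))) \<longlonglongrightarrow> 0" by simp
  qed (auto simp: pmod_nonneg)
  then have "mconv (\<lambda>n. jet (\<phi> n)) V" using VL test_Lp(3)[OF \<phi>(1)] by (simp add: mconv_def)
  then show ?thesis by (rule E_I[rotated]) (rule \<phi>(1))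
qed

lemma mconv_add:
  assumes "mconv U V" "mconv U' V'"
  shows "mconv (\<lambda>n x. U n x + U' n x) (\<lambda>x. V x + V' x)"
proof -
  have L: "U n \<in> Lp" "U' n \<in> Lp" "V \<in> Lp" "V' \<in> Lp" for n using assms by (auto simp: mconv_def)
  have "(\<lambda>n. pmod (\<lambda>x. (U n x + U' n x) - (V x + V' x))) \<longlonglongrightarrow> 0"
  proof (rule real_tendsto_sandwich[OF _ _ tendsto_const])
    show "\<forall>\<^sub>F n in sequentially. pmod (\<lambda>x. (U n x + U' n x) - (V x + V' x))
        \<le> 2 powr P * (pmod (\<lambda>x. U n x - V x) + pmod (\<lambda>x. U' n x - V' x))"
      using Lp_add(2)[OF Lp_diff[OF L(1) L(3)] Lp_diff[OF L(2) L(4)]]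
      by (intro always_eventually allI) (simp add: algebra_simps)
    have "(\<lambda>n. 2 powr P * (pmod (\<lambda>x. U n x - V x) + pmod (\<lambda>x. U' n x - V' x))) \<longlonglongrightarrow> 2 powr P * (0 + 0)"
      using assms unfolding mconv_def by (intro tendsto_intros) auto
    then show "(\<lambda>n. 2 powr P * (pmod (\<lambda>x. U n x - V x) + pmod (\<lambda>x. U' n x - V' x))) \<longlonglongrightarrow> 0" by simp
  qed (auto simp: pmod_nonneg)
  then show ?thesis using L by (simp add: mconv_def Lp_add(1))
qed

lemma mconv_scale:
  assumes "mconv U V" shows "mconv (\<lambda>n x. c *\<^sub>R U n x) (\<lambda>x. c *\<^sub>R V x)"
proof -
  have L: "U n \<in> Lp" "V \<in> Lp" for n using assms by (auto simp: mconv_def)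
  have "(\<lambda>n. pmod (\<lambda>x. c *\<^sub>R U n x - c *\<^sub>R V x)) \<longlonglongrightarrow> 0"
  proof (rule real_tendsto_sandwich[OF _ _ tendsto_const])
    show "\<forall>\<^sub>F n in sequentially. pmod (\<lambda>x. c *\<^sub>R U n x - c *\<^sub>R V x) \<le> (1 + \<bar>c\<bar> powr P) * pmod (\<lambda>x. U n x - V x)"
      using Lp_scale(3)[OF Lp_diff[OF L]] by (intro always_eventually allI) (simp add: scaleR_diff_right)
    have "(\<lambda>n. (1 + \<bar>c\<bar> powr P) * pmod (\<lambda>x. U n x - V x)) \<longlonglongrightarrow> (1 + \<bar>c\<bar> powr P) * 0"
      using assms unfolding mconv_def by (intro tendsto_intros) auto
    then show "(\<lambda>n. (1 + \<bar>c\<bar> powr P) * pmod (\<lambda>x. U n x - V x)) \<longlonglongrightarrow> 0" by simp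
  qed (auto simp: pmod_nonneg)
  then show ?thesis using L by (simp add: mconv_def Lp_scale(1))
qed

lemma E_add: assumes "U \<in> E" "V \<in> E" shows "(\<lambda>x. U x + V x) \<in> E"
proof -
  obtain \<phi> \<psi> where \<phi>: "\<And>n. test_fun \<Omega> (\<phi> n)" "mconv (\<lambda>n. jet (\<phi> n)) U"
    and \<psi>: "\<And>n. test_fun \<Omega> (\<psi> n)" "mconv (\<lambda>n. jet (\<psi> n)) V"
    using E_obtain[OF assms(1)] E_obtain[OF assms(2)] by metis
  have "jet (\<lambda>x. \<phi> n x + \<psi> n x) = (\<lambda>x. jet (\<phi> n) x + jet (\<psi> n) x)" for n
    using grad_add[OF test_fun_smooth[OF \<phi>(1)] test_fun_smooth[OF \<psi>(1)]] by (auto simp: jet_def)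
  then have "mconv (\<lambda>n. jet (\<lambda>x. \<phi> n x + \<psi> n x)) (\<lambda>x. U x + V x)"
    using mconv_add[OF \<phi>(2) \<psi>(2)] by simp
  then show ?thesis by (rule E_I[rotated]) (rule test_fun_add[OF \<phi>(1) \<psi>(1)])
qed

lemma E_scale: assumes "U \<in> E" shows "(\<lambda>x. c *\<^sub>R U x) \<in> E"
proof -
  obtain \<phi> where \<phi>: "\<And>n. test_fun \<Omega> (\<phi> n)" "mconv (\<lambda>n. jet (\<phi> n)) U"
    using assms unfolding E_def by blast
  have "jet (\<lambda>x. c * \<phi> n x) = (\<lambda>x. c *\<^sub>R jet (\<phi> n) x)" for n
    using grad_cmult[OF test_fun_smooth[OF \<phi>(1)]] by (auto simp: jet_def)
  then have "mconv (\<lambda>n. jet (\<lambda>x. c * \<phi> n x)) (\<lambda>x. c *\<^sub>R U x)"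
    using mconv_scale[OF \<phi>(2)] by simp
  then show ?thesis by (rule E_I[rotated]) (rule test_fun_cmult[OF \<phi>(1)])
qed

lemma E_diff: assumes "U \<in> E" "V \<in> E" shows "(\<lambda>x. U x - V x) \<in> E"
  using E_add[OF assms(1) E_scale[OF assms(2), of "-1"]] by simp

lemma E_zero: "(\<lambda>x. 0) \<in> E"
proof -
  obtain b where "test_fun \<Omega> b" by (rule exists_bump[OF openO O_ne])
  then show ?thesis using E_scale[OF E_jet, of b 0] by simp
qed

section \<open>Sobolev and Poincare inequalities in modular form\<close>

lemma powr_r_bound:
  assumes W: "W \<in> Lp" and d: "0 < d" "d \<le> 1"
  shows "(\<integral>\<^sup>+x. ennreal (norm (W x) powr r) \<partial>M) \<le> ennreal (d powr r * \<mu> + d powr (r - P) * pmod W)"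
proof -
  note [measurable] = LpD[OF W]
  have int: "integrable M (\<lambda>x. d powr r + d powr (r - P) * norm (W x) powr p x)"
    by (intro Bochner_Integration.integrable_add integrable_const integrable_mult_right Lp_integrable W)
  have "(\<integral>\<^sup>+x. ennreal (norm (W x) powr r) \<partial>M) \<le> (\<integral>\<^sup>+x. ennreal (d powr r + d powr (r - P) * norm (W x) powr p x) \<partial>M)"
  proof (rule nn_integral_mono, rule ennreal_leI)
    fix x assume "x \<in> space M"
    then have x: "x \<in> \<Omega>" by simp
    show "norm (W x) powr r \<le> d powr r + d powr (r - P) * norm (W x) powr p x"
    proof (cases "norm (W x) \<le> d")
      case True
      have "norm (W x) powr r \<le> d powr r" using True r_ge1 by (intro powr_mono2) auto
      moreover have "0 \<le> d powr (r - P) * norm (W x) powr p x" by simp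
      ultimately show ?thesis by linarith
    next
      case False
      then have n0: "norm (W x) > 0" using d by linarith
      have "norm (W x) powr r = norm (W x) powr (r - p x) * norm (W x) powr p x"
        using n0 by (simp flip: powr_add)
      also have "\<dots> \<le> d powr (r - P) * norm (W x) powr p x"
      proof (rule mult_right_mono)
        \<comment> \<open>The exponent r - p(x) is nonpositive, so values above the threshold may be
          replaced by it; as d \<le> 1, the worst case is p(x) = P.\<close>
        have "norm (W x) powr (r - p x) \<le> d powr (r - p x)"
          using False d r_le[OF x] by (intro powr_mono2') auto
        also have "\<dots> \<le> d powr (r - P)"
          using d p_le[OF x] by (intro powr_mono') auto
        finally show "norm (W x) powr (r - p x) \<le> d powr (r - P)" .
      qed simp
      finally show ?thesis by (smt (verit) powr_ge_zero)
    qed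
  qed
  also have "\<dots> = ennreal (\<integral>x. d powr r + d powr (r - P) * norm (W x) powr p x \<partial>M)"
    by (intro nn_integral_eq_integral int AE_I2) auto
  also have "(\<integral>x. d powr r + d powr (r - P) * norm (W x) powr p x \<partial>M) = d powr r * \<mu> + d powr (r - P) * pmod W"
    unfolding pmod_def by (subst Bochner_Integration.integral_add) (auto intro!: Lp_integrable W)
  finally show ?thesis .
qed

lemma sobolev_test:
  fixes s :: real
  assumes s: "0 < s" "s < DIM('a) * r / (DIM('a) - r)"
  obtains C where "C > 0" "\<And>\<phi> D. test_fun \<Omega> \<phi> \<Longrightarrow> D > 0 \<Longrightarrow> (\<integral>\<^sup>+x. ennreal (norm (grad \<phi> x) powr r) \<partial>M) \<le> ennreal D \<Longrightarrow>
     (\<integral>\<^sup>+x. ennreal (\<bar>\<phi> x\<bar> powr s) \<partial>M) \<le> ennreal (C * D powr (s / r))"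
proof -
  define C where "C = \<mu> + 2 powr s * sobolev_const (DIM('a)) r / (1 - 2 powr (s - DIM('a) * r / (DIM('a) - r)))"
  have "2 powr (s - DIM('a) * r / (DIM('a) - r)) < 1"
    using powr_less_mono[of "s - DIM('a) * r / (DIM('a) - r)" 0 2] s by simp
  then have "C > 0" using mu_pos unfolding C_def
    by (intro add_pos_nonneg divide_nonneg_pos) (auto simp: sobolev_const_def)
  moreover have "(\<integral>\<^sup>+x. ennreal (\<bar>\<phi> x\<bar> powr s) \<partial>M) \<le> ennreal (C * D powr (s / r))"
    if \<phi>: "test_fun \<Omega> \<phi>" and D: "D > 0" and g: "(\<integral>\<^sup>+x. ennreal (norm (grad \<phi> x) powr r) \<partial>M) \<le> ennreal D" for \<phi> D
  proof -
    note c1 = test_c1[OF \<phi>]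
    note [measurable] = c1_compact.borel[OF c1]
    have "(\<integral>\<^sup>+x. ennreal (norm (grad \<phi> x) powr r) \<partial>M) = (\<integral>\<^sup>+x. ennreal (norm (grad \<phi> x) powr r) \<partial>lborel)"
      by (rule nn_integral_M_eq_lborel) (use test_fun_grad_zero_outside[OF \<phi>] r_ge1 in auto)
    then have g': "(\<integral>\<^sup>+x. ennreal (norm (grad \<phi> x) powr r) \<partial>lborel) \<le> ennreal D" using g by simp
    have "(\<integral>\<^sup>+x. ennreal (\<bar>\<phi> x\<bar> powr s) \<partial>M) = (\<integral>\<^sup>+x. ennreal (\<bar>\<phi> x\<bar> powr s) \<partial>lborel)"
      by (rule nn_integral_M_eq_lborel) (use test_fun_zero_outside[OF \<phi>] s in auto)
    also have "\<dots> \<le> ennreal (C * D powr (s / r))"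
      unfolding C_def
      by (rule c1_compact.sobolev[OF c1 r_ge1 r_less D g' s _ emeasure_O])
        (use openO test_fun_zero_outside[OF \<phi>] in auto)
    finally show ?thesis .
  qed
  ultimately show thesis by (rule that)
qed

lemma r_less_critical: "r < DIM('a) * r / (DIM('a) - r)"
proof -
  have "r * (DIM('a) - r) < DIM('a) * r" using r_ge1 by (simp add: algebra_simps)
  then show ?thesis using r_less by (simp add: pos_less_divide_eq)
qed

lemma q_pos: "q > 0" using q_gt P_ge1 by linarith

lemma powr_between:
  fixes s a b c :: real
  assumes "0 \<le> s" "0 \<le> a" "a \<le> b" "b \<le> c"
  shows "s powr b \<le> s powr a + s powr c"
proof (cases "s \<le> 1")
  case True
  then have "s powr b \<le> s powr a" using assms by (cases "s = 0") (auto intro: powr_mono')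
  then show ?thesis by (smt (verit) powr_ge_zero)
next
  case False
  then have "s powr b \<le> s powr c" using assms by (intro powr_mono) auto
  then show ?thesis by (smt (verit) powr_ge_zero)
qed

lemma times_half_cancel: "Y > 0 \<Longrightarrow> Y * (e / (2 * Y)) = e / (2::real)" by simp

text \<open>As p(x) lies between r and q, its power is dominated by the sum of these two constant
  powers, and the Sobolev inequality bounds both by the r-integral of the gradient. The
  epsilon-delta form suffices for passing convergence from the gradient to the pair.\<close>

lemma test_modular_small:
  assumes e: "e > 0"
  obtains d where "d > 0" "\<And>\<phi>. test_fun \<Omega> \<phi> \<Longrightarrow> gmod (jet \<phi>) < d \<Longrightarrow> pmod (jet \<phi>) < e"
proof -
  obtain C1 where C1: "C1 > 0" "\<And>\<phi> D. test_fun \<Omega> \<phi> \<Longrightarrow> D > 0 \<Longrightarrow> (\<integral>\<^sup>+x. ennreal (norm (grad \<phi> x) powr r) \<partial>M) \<le> ennreal D \<Longrightarrow>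
     (\<integral>\<^sup>+x. ennreal (\<bar>\<phi> x\<bar> powr r) \<partial>M) \<le> ennreal (C1 * D powr (r / r))"
    using sobolev_test[of r] r_less_critical r_ge1 by auto
  obtain C2 where C2: "C2 > 0" "\<And>\<phi> D. test_fun \<Omega> \<phi> \<Longrightarrow> D > 0 \<Longrightarrow> (\<integral>\<^sup>+x. ennreal (norm (grad \<phi> x) powr r) \<partial>M) \<le> ennreal D \<Longrightarrow>
     (\<integral>\<^sup>+x. ennreal (\<bar>\<phi> x\<bar> powr q) \<partial>M) \<le> ennreal (C2 * D powr (q / r))"
    using sobolev_test[of q] q_less q_pos by auto
  \<comment> \<open>For D \<le> 1 this allows D powr (q / r) to be replaced by D.\<close>
  have rq: "1 \<le> q / r"
  proof -
    obtain x where "x \<in> \<Omega>" using O_ne by blast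
    then have "r \<le> q" using r_le p_le q_gt by fastforce
    then show ?thesis using r_ge1 by simp
  qed
  define e' where "e' = e / (2 * 2 powr P)"
  have e': "e' > 0" using e by (simp add: e'_def)
  define D where "D = min 1 (e' / (2 * (C1 + C2)))"
  have D: "0 < D" "D \<le> 1" using e' C1(1) C2(1) by (auto simp: D_def)
  have DC: "(C1 + C2) * D \<le> e' / 2"
  proof -
    have "(C1 + C2) * D \<le> (C1 + C2) * (e' / (2 * (C1 + C2)))"
      using C1(1) C2(1) by (intro mult_left_mono) (auto simp: D_def)
    also have "\<dots> = e' / 2" using C1(1) C2(1) by (intro times_half_cancel) auto
    finally show ?thesis .
  qed
  \<comment> \<open>This makes the measure term of \<open>powr_r_bound\<close> at most D / 2; the
    bound \<open>d\<close> on the gradient modular below makes the other term at most D / 2.\<close>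
  define t where "t = min 1 (D / (2 * \<mu>))"
  have t: "0 < t" "t \<le> 1" using D mu_pos by (auto simp: t_def)
  have t\<mu>: "t powr r * \<mu> \<le> D / 2"
  proof -
    have "t powr r \<le> t powr 1" using t r_ge1 by (intro powr_mono') auto
    also have "\<dots> \<le> D / (2 * \<mu>)" using t by (simp add: t_def)
    finally show ?thesis using mu_pos by (simp add: field_simps)
  qed
  define d where "d = min (e' / 2) (D / (2 * t powr (r - P)))"
  have d: "d > 0" using D t e' by (auto simp: d_def)
  have "pmod (jet \<phi>) < e" if \<phi>: "test_fun \<Omega> \<phi>" and m: "gmod (jet \<phi>) < d" for \<phi>
  proof -
    have "t powr (r - P) * pmod (grad \<phi>) \<le> t powr (r - P) * (D / (2 * t powr (r - P)))"
      using m unfolding gmod_jet by (intro mult_left_mono) (auto simp: d_def)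
    then have "t powr r * \<mu> + t powr (r - P) * pmod (grad \<phi>) \<le> D" using t\<mu> t by simp
    then have g: "(\<integral>\<^sup>+x. ennreal (norm (grad \<phi> x) powr r) \<partial>M) \<le> ennreal D"
      using powr_r_bound[OF test_Lp(2)[OF \<phi>] t] by (meson ennreal_leI order_trans)
    have [measurable]: "\<phi> \<in> borel_measurable M" by (rule LpD[OF test_Lp(1)[OF \<phi>]])
    have "ennreal (pmod \<phi>) = (\<integral>\<^sup>+x. ennreal (norm (\<phi> x) powr p x) \<partial>M)"
      by (rule pmod_nn_integral[OF test_Lp(1)[OF \<phi>]])
    also have "\<dots> \<le> (\<integral>\<^sup>+x. ennreal (\<bar>\<phi> x\<bar> powr r) + ennreal (\<bar>\<phi> x\<bar> powr q) \<partial>M)"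
    proof (rule nn_integral_mono)
      fix x assume "x \<in> space M"
      then have x: "x \<in> \<Omega>" by simp
      have "norm (\<phi> x) powr p x \<le> \<bar>\<phi> x\<bar> powr r + \<bar>\<phi> x\<bar> powr q"
        using powr_between[of "\<bar>\<phi> x\<bar>" r "p x" q] r_le[OF x] p_le[OF x] q_gt r_ge1 by simp
      then show "ennreal (norm (\<phi> x) powr p x) \<le> ennreal (\<bar>\<phi> x\<bar> powr r) + ennreal (\<bar>\<phi> x\<bar> powr q)"
        by (simp add: ennreal_leI flip: ennreal_plus)
    qed
    also have "\<dots> = (\<integral>\<^sup>+x. ennreal (\<bar>\<phi> x\<bar> powr r) \<partial>M) + (\<integral>\<^sup>+x. ennreal (\<bar>\<phi> x\<bar> powr q) \<partial>M)"
      by (rule nn_integral_add) measurable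
    also have "\<dots> \<le> ennreal (C1 * D powr (r / r)) + ennreal (C2 * D powr (q / r))"
      by (intro add_mono C1(2) C2(2) \<phi> D(1) g)
    also have "\<dots> = ennreal (C1 * D powr (r / r) + C2 * D powr (q / r))"
      using C1(1) C2(1) by (intro ennreal_plus[symmetric]) auto
    finally have "pmod \<phi> \<le> C1 * D powr (r / r) + C2 * D powr (q / r)"
      using C1(1) C2(1) by (subst (asm) ennreal_le_iff) auto
    also have "\<dots> \<le> C1 * D + C2 * D"
    proof (intro add_mono mult_left_mono)
      have "D powr (q / r) \<le> D powr 1" using D rq by (intro powr_mono') auto
      then show "D powr (q / r) \<le> D" using D by simp
      show "D powr (r / r) \<le> D" using D r_ge1 by simp
    qed (use C1(1) C2(1) in auto)
    also have "\<dots> \<le> e' / 2" using DC by (simp add: algebra_simps)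
    finally have a: "pmod \<phi> \<le> e' / 2" .
    have b: "pmod (grad \<phi>) < e' / 2" using m by (simp add: gmod_jet d_def)
    have "pmod (jet \<phi>) \<le> 2 powr P * (pmod \<phi> + pmod (grad \<phi>))"
      using Lp_Pair(2)[OF test_Lp(1)[OF \<phi>] test_Lp(2)[OF \<phi>]] by (simp add: jet_def[abs_def])
    also have "\<dots> < 2 powr P * e'" using a b by (intro mult_strict_left_mono) auto
    also have "\<dots> = e / 2" by (simp add: e'_def)
    finally show ?thesis using e by linarith
  qed
  with d show thesis by (rule that)
qed

lemma pmod_tendsto: "mconv U V \<Longrightarrow> (\<lambda>n. pmod (U n)) \<longlonglongrightarrow> pmod V"
  unfolding pmod_def by (rule growth_tendsto[OF growth_norm_powr])

lemma modular_small:
  assumes e: "e > 0"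
  obtains d where "d > 0" "\<And>U. U \<in> E \<Longrightarrow> gmod U < d \<Longrightarrow> pmod U < e"
proof -
  obtain d where d: "d > 0" "\<And>\<phi>. test_fun \<Omega> \<phi> \<Longrightarrow> gmod (jet \<phi>) < d \<Longrightarrow> pmod (jet \<phi>) < e / 2"
    using test_modular_small[of "e / 2"] e by auto
  have "pmod U < e" if U: "U \<in> E" "gmod U < d" for U
  proof -
    obtain \<phi> where \<phi>: "\<And>n. test_fun \<Omega> (\<phi> n)" "mconv (\<lambda>n. jet (\<phi> n)) U"
      using E_obtain[OF U(1)] by blast
    have "\<forall>\<^sub>F n in sequentially. gmod (jet (\<phi> n)) < d"
      by (rule order_tendstoD(2)[OF gmod_tendsto[OF \<phi>(2)] U(2)])
    then have "\<forall>\<^sub>F n in sequentially. pmod (jet (\<phi> n)) \<le> e / 2"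
      by eventually_elim (use d(2)[OF \<phi>(1)] in force)
    then have "pmod U \<le> e / 2" using pmod_tendsto[OF \<phi>(2)] by (intro tendsto_upperbound) auto
    then show ?thesis using e by linarith
  qed
  with d(1) show thesis by (rule that)
qed

lemma mconv_if_gmod:
  assumes "\<And>n. U n \<in> E" "V \<in> E" "(\<lambda>n. gmod (\<lambda>x. U n x - V x)) \<longlonglongrightarrow> 0"
  shows "mconv U V"
proof -
  have "(\<lambda>n. pmod (\<lambda>x. U n x - V x)) \<longlonglongrightarrow> 0"
  proof (rule order_tendstoI)
    fix e :: real assume "0 < e"
    then obtain d where d: "d > 0" "\<And>U. U \<in> E \<Longrightarrow> gmod U < d \<Longrightarrow> pmod U < e" using modular_small[OF \<open>0 < e\<close>] by blast
    have "\<forall>\<^sub>F n in sequentially. gmod (\<lambda>x. U n x - V x) < d" by (rule order_tendstoD(2)[OF assms(3) d(1)])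
    then show "\<forall>\<^sub>F n in sequentially. pmod (\<lambda>x. U n x - V x) < e"
      by eventually_elim (use d(2)[OF E_diff[OF assms(1,2)]] in blast)
  next
    fix e :: real assume "e < 0"
    then show "\<forall>\<^sub>F n in sequentially. e < pmod (\<lambda>x. U n x - V x)"
      by (intro always_eventually allI) (use pmod_nonneg less_le_trans in blast)
  qed
  then show ?thesis using assms(1,2) E_Lp by (auto simp: mconv_def)
qed

lemma E_complete:
  assumes U: "\<And>n. U n \<in> E"
    and C: "\<And>e. e > 0 \<Longrightarrow> \<exists>N. \<forall>i\<ge>N. \<forall>j\<ge>N. gmod (\<lambda>x. U i x - U j x) < e"
  obtains V where "V \<in> E" "mconv U V"
proof -
  have "\<exists>N. \<forall>i\<ge>N. \<forall>j\<ge>N. pmod (\<lambda>x. U i x - U j x) \<le> e" if e: "e > 0" for e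
  proof -
    obtain d where d: "d > 0" "\<And>U. U \<in> E \<Longrightarrow> gmod U < d \<Longrightarrow> pmod U < e" using modular_small[OF e] by blast
    obtain N where "\<forall>i\<ge>N. \<forall>j\<ge>N. gmod (\<lambda>x. U i x - U j x) < d" using C[OF d(1)] by blast
    then have "\<forall>i\<ge>N. \<forall>j\<ge>N. pmod (\<lambda>x. U i x - U j x) \<le> e"
      using d(2)[OF E_diff[OF U U]] by (meson less_imp_le)
    then show ?thesis ..
  qed
  then obtain V where V: "mconv U V" using Lp_complete[of U] E_Lp[OF U] by blast
  with E_closed[OF U V] show thesis by (rule that)
qed

lemma growth_fst_powr:
  assumes "0 \<le> s" "\<And>x. x \<in> \<Omega> \<Longrightarrow> s \<le> p x" "s > 0"
  shows "growth (\<lambda>x (y :: real \<times> 'b::euclidean_space). \<bar>fst y\<bar> powr s)"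
  unfolding growth_def
proof (intro conjI exI[of _ 1] ballI allI)
  show "continuous_on (\<Omega> \<times> UNIV) (\<lambda>(x, y::real \<times> 'b). \<bar>fst y\<bar> powr s)"
    using assms unfolding case_prod_beta' by (intro continuous_on_powr' continuous_intros) auto
  fix x and y :: "real \<times> 'b" assume x: "x \<in> \<Omega>"
  have "\<bar>fst y\<bar> powr s \<le> norm y powr s"
    using assms norm_fst_le[of "fst y" "snd y"] by (intro powr_mono2) auto
  also have "\<dots> \<le> 1 + norm y powr p x" using assms x by (intro powr_le_one_plus) auto
  finally show "\<bar>\<bar>fst y\<bar> powr s\<bar> \<le> 1 * (1 + norm y powr p x)" by simp
qed

text \<open>Threshold 1 in \<open>powr_r_bound\<close>. The modular is not homogeneous, and the
  additive 1 covers small and large gradients with a single constant.\<close>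

lemma poincare:
  obtains K where "K > 0" "\<And>U. U \<in> E \<Longrightarrow> (\<integral>x. \<bar>fst (U x)\<bar> powr r \<partial>M) \<le> K * (1 + gmod U)"
proof -
  obtain C where C: "C > 0" "\<And>\<phi> D. test_fun \<Omega> \<phi> \<Longrightarrow> D > 0 \<Longrightarrow> (\<integral>\<^sup>+x. ennreal (norm (grad \<phi> x) powr r) \<partial>M) \<le> ennreal D \<Longrightarrow>
     (\<integral>\<^sup>+x. ennreal (\<bar>\<phi> x\<bar> powr r) \<partial>M) \<le> ennreal (C * D powr (r / r))"
    using sobolev_test[of r] r_less_critical r_ge1 by auto
  have gr: "growth (\<lambda>x (y :: real \<times> 'a). \<bar>fst y\<bar> powr r)"
    using r_ge1 r_le by (intro growth_fst_powr) auto
  define K where "K = C * (\<mu> + 1)"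
  have K: "K > 0" using C(1) mu_pos by (simp add: K_def)
  have t: "(\<integral>x. \<bar>fst (jet \<phi> x)\<bar> powr r \<partial>M) \<le> K * (1 + gmod (jet \<phi>))" if \<phi>: "test_fun \<Omega> \<phi>" for \<phi>
  proof -
    let ?D = "\<mu> + pmod (grad \<phi>)"
    have D: "?D > 0" using mu_pos pmod_nonneg[of "grad \<phi>"] by linarith
    have "(\<integral>\<^sup>+x. ennreal (norm (grad \<phi> x) powr r) \<partial>M) \<le> ennreal ?D"
      using powr_r_bound[OF test_Lp(2)[OF \<phi>], of 1] by simp
    from C(2)[OF \<phi> D this] have "(\<integral>\<^sup>+x. ennreal (\<bar>\<phi> x\<bar> powr r) \<partial>M) \<le> ennreal (C * ?D)"
      using r_ge1 D by simp
    moreover have "(\<integral>\<^sup>+x. ennreal (\<bar>\<phi> x\<bar> powr r) \<partial>M) = ennreal (\<integral>x. \<bar>fst (jet \<phi> x)\<bar> powr r \<partial>M)"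
      using growth_integrable[OF gr test_Lp(3)[OF \<phi>]]
      by (subst nn_integral_eq_integral) (auto simp: jet_def)
    ultimately have "ennreal (\<integral>x. \<bar>fst (jet \<phi> x)\<bar> powr r \<partial>M) \<le> ennreal (C * ?D)" by simp
    then have "(\<integral>x. \<bar>fst (jet \<phi> x)\<bar> powr r \<partial>M) \<le> C * ?D"
      using C(1) D by (subst (asm) ennreal_le_iff) auto
    also have "\<dots> \<le> K * (1 + gmod (jet \<phi>))"
    proof -
      have "\<mu> + pmod (grad \<phi>) \<le> (\<mu> + 1) * (1 + pmod (grad \<phi>))"
        using mu_pos pmod_nonneg[of "grad \<phi>"] by (simp add: algebra_simps)
      then show ?thesis unfolding K_def gmod_jet mult.assoc using C(1) by (intro mult_left_mono) auto
    qed
    finally show ?thesis .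
  qed
  have "(\<integral>x. \<bar>fst (U x)\<bar> powr r \<partial>M) \<le> K * (1 + gmod U)" if U: "U \<in> E" for U
  proof -
    obtain \<phi> where \<phi>: "\<And>n. test_fun \<Omega> (\<phi> n)" "mconv (\<lambda>n. jet (\<phi> n)) U"
      using E_obtain[OF U] by blast
    show ?thesis
    proof (rule tendsto_le[OF sequentially_bot])
      show "(\<lambda>n. \<integral>x. \<bar>fst (jet (\<phi> n) x)\<bar> powr r \<partial>M) \<longlonglongrightarrow> (\<integral>x. \<bar>fst (U x)\<bar> powr r \<partial>M)"
        by (rule growth_tendsto[OF gr \<phi>(2)])
      show "(\<lambda>n. K * (1 + gmod (jet (\<phi> n)))) \<longlonglongrightarrow> K * (1 + gmod U)"
        by (intro tendsto_intros gmod_tendsto \<phi>(2))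
    qed (use t[OF \<phi>(1)] in auto)
  qed
  with K show thesis by (rule that)
qed

text \<open>For small gradients the threshold d = m powr (1 / P) makes both terms of
  \<open>powr_r_bound\<close> multiples of d powr r. The resulting power q / P exceeds 1, and this
  is the source of the energy barrier.\<close>

lemma superlinear_test:
  obtains C where "C > 0" "\<And>\<phi> m. test_fun \<Omega> \<phi> \<Longrightarrow> 0 < m \<Longrightarrow> m \<le> 1 \<Longrightarrow> gmod (jet \<phi>) \<le> m \<Longrightarrow>
    (\<integral>\<^sup>+x. ennreal (\<bar>\<phi> x\<bar> powr q) \<partial>M) \<le> ennreal (C * m powr (q / P))"
proof -
  obtain C where C: "C > 0" "\<And>\<phi> D. test_fun \<Omega> \<phi> \<Longrightarrow> D > 0 \<Longrightarrow> (\<integral>\<^sup>+x. ennreal (norm (grad \<phi> x) powr r) \<partial>M) \<le> ennreal D \<Longrightarrow>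
     (\<integral>\<^sup>+x. ennreal (\<bar>\<phi> x\<bar> powr q) \<partial>M) \<le> ennreal (C * D powr (q / r))"
    using sobolev_test[of q] q_less q_pos by auto
  define C' where "C' = C * (\<mu> + 1) powr (q / r)"
  have "C' > 0" using C(1) mu_pos by (simp add: C'_def)
  moreover have "(\<integral>\<^sup>+x. ennreal (\<bar>\<phi> x\<bar> powr q) \<partial>M) \<le> ennreal (C' * m powr (q / P))"
    if \<phi>: "test_fun \<Omega> \<phi>" and m: "0 < m" "m \<le> 1" "gmod (jet \<phi>) \<le> m" for \<phi> m
  proof -
    define d where "d = m powr (1 / P)"
    have d: "0 < d" "d \<le> 1" using m P_ge1 by (auto simp: d_def powr_le1)
    have "d powr r * \<mu> + d powr (r - P) * pmod (grad \<phi>) \<le> d powr r * \<mu> + d powr (r - P) * m"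
      using m(3) by (intro add_left_mono mult_left_mono) (auto simp: gmod_jet)
    also have "m = d powr P" using m P_ge1 by (simp add: d_def powr_powr)
    also have "d powr r * \<mu> + d powr (r - P) * d powr P = d powr r * (\<mu> + 1)"
      by (simp add: algebra_simps flip: powr_add)
    finally have "(\<integral>\<^sup>+x. ennreal (norm (grad \<phi> x) powr r) \<partial>M) \<le> ennreal (d powr r * (\<mu> + 1))"
      using powr_r_bound[OF test_Lp(2)[OF \<phi>] d] by (meson ennreal_leI order_trans)
    then have "(\<integral>\<^sup>+x. ennreal (\<bar>\<phi> x\<bar> powr q) \<partial>M) \<le> ennreal (C * (d powr r * (\<mu> + 1)) powr (q / r))"
      using d mu_pos by (intro C(2) \<phi>) auto
    also have "C * (d powr r * (\<mu> + 1)) powr (q / r) = C' * m powr (q / P)"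
      using r_ge1 mu_pos m by (simp add: C'_def d_def powr_mult powr_powr)
    finally show ?thesis .
  qed
  ultimately show thesis by (rule that)
qed

end

section \<open>Pairs of functions, and modular against Luxemburg norm\<close>

context variable_exponent
begin

lemma mconv_Pair:
  fixes U :: "nat \<Rightarrow> 'a \<Rightarrow> 'b::euclidean_space" and U' :: "nat \<Rightarrow> 'a \<Rightarrow> 'c::euclidean_space"
  assumes "mconv U V" "mconv U' V'"
  shows "mconv (\<lambda>n x. (U n x, U' n x)) (\<lambda>x. (V x, V' x))"
proof -
  have L: "U n \<in> Lp" "U' n \<in> Lp" "V \<in> Lp" "V' \<in> Lp" for n using assms by (auto simp: mconv_def)
  have "(\<lambda>n. pmod (\<lambda>x. (U n x, U' n x) - (V x, V' x))) \<longlonglongrightarrow> 0"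
  proof (rule real_tendsto_sandwich[OF _ _ tendsto_const])
    show "\<forall>\<^sub>F n in sequentially. pmod (\<lambda>x. (U n x, U' n x) - (V x, V' x))
        \<le> 2 powr P * (pmod (\<lambda>x. U n x - V x) + pmod (\<lambda>x. U' n x - V' x))"
      using Lp_Pair(2)[OF Lp_diff[OF L(1) L(3)] Lp_diff[OF L(2) L(4)]]
      by (intro always_eventually allI) simp
    have "(\<lambda>n. 2 powr P * (pmod (\<lambda>x. U n x - V x) + pmod (\<lambda>x. U' n x - V' x))) \<longlonglongrightarrow> 2 powr P * (0 + 0)"
      using assms unfolding mconv_def by (intro tendsto_intros) auto
    then show "(\<lambda>n. 2 powr P * (pmod (\<lambda>x. U n x - V x) + pmod (\<lambda>x. U' n x - V' x))) \<longlonglongrightarrow> 0" by simp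
  qed (auto simp: pmod_nonneg)
  then show ?thesis using L by (simp add: mconv_def Lp_Pair(1))
qed

lemma mconv_fst:
  assumes "mconv U V" shows "mconv (\<lambda>n x. fst (U n x)) (\<lambda>x. fst (V x))"
proof -
  have L: "U n \<in> Lp" "V \<in> Lp" for n using assms by (auto simp: mconv_def)
  have "(\<lambda>n. pmod (\<lambda>x. fst (U n x) - fst (V x))) \<longlonglongrightarrow> 0"
  proof (rule real_tendsto_sandwich[OF _ _ tendsto_const])
    show "\<forall>\<^sub>F n in sequentially. pmod (\<lambda>x. fst (U n x) - fst (V x)) \<le> pmod (\<lambda>x. U n x - V x)"
      using Lp_fst(2)[OF Lp_diff[OF L]] by (intro always_eventually allI) simp
    show "(\<lambda>n. pmod (\<lambda>x. U n x - V x)) \<longlonglongrightarrow> 0" using assms by (simp add: mconv_def)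
  qed (auto simp: pmod_nonneg)
  then show ?thesis using L by (simp add: mconv_def Lp_fst(1))
qed

lemma scaled_pmod_le:
  assumes U: "U \<in> Lp" and t: "0 < t" "t \<le> 1"
  shows "pmod (\<lambda>x. (1 / t) *\<^sub>R U x) \<le> (1 / t) powr P * pmod U"
proof -
  have "pmod (\<lambda>x. (1 / t) *\<^sub>R U x) \<le> (\<integral>x. (1 / t) powr P * norm (U x) powr p x \<partial>M)"
    unfolding pmod_def
  proof (rule integral_mono[OF Lp_integrable[OF Lp_scale(1)[OF U]]])
    show "integrable M (\<lambda>x. (1 / t) powr P * norm (U x) powr p x)" by (intro integrable_mult_right Lp_integrable U)
    fix x assume "x \<in> space M"
    then have x: "x \<in> \<Omega>" by simp
    have n: "norm ((1 / t) *\<^sub>R U x) = (1 / t) * norm (U x)" using t by simp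
    have "norm ((1 / t) *\<^sub>R U x) powr p x = (1 / t) powr p x * norm (U x) powr p x"
      unfolding n by (rule powr_mult)
    also have "\<dots> \<le> (1 / t) powr P * norm (U x) powr p x"
      using t p_le[OF x] by (intro mult_right_mono powr_mono) auto
    finally show "norm ((1 / t) *\<^sub>R U x) powr p x \<le> (1 / t) powr P * norm (U x) powr p x" .
  qed
  then show ?thesis by (simp add: pmod_def)
qed

lemma modular_eq_pmod:
  fixes w :: "'a \<Rightarrow> real"
  assumes "w \<in> Lp" shows "modular p \<Omega> w = ennreal (pmod w)"
  unfolding modular_def pmod_def
  using nn_integral_eq_integral[OF Lp_integrable[OF assms]] by simp

lemma in_Lpx_iff: "in_Lpx p \<Omega> w \<longleftrightarrow> w \<in> Lp"
proof
  assume w: "in_Lpx p \<Omega> w"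
  then have [measurable]: "w \<in> borel_measurable M" by (simp add: in_Lpx_def)
  have "integrable M (\<lambda>x. norm (w x) powr p x)"
    by (rule integrableI_bounded) (use w in \<open>auto simp: in_Lpx_def modular_def\<close>)
  then show "w \<in> Lp" by (simp add: Lp_def)
next
  assume "w \<in> Lp"
  then show "in_Lpx p \<Omega> w" by (simp add: in_Lpx_def modular_eq_pmod LpD)
qed

lemma modular_scaled_le_iff:
  fixes w :: "'a \<Rightarrow> real"
  assumes "w \<in> Lp" shows "modular p \<Omega> (\<lambda>x. w x / t) \<le> 1 \<longleftrightarrow> pmod (\<lambda>x. (1 / t) *\<^sub>R w x) \<le> 1"
  using modular_eq_pmod[OF Lp_scale(1)[OF assms, of "1 / t"]] by (simp add: divide_inverse mult.commute)

text \<open>\<open>lux_norm\<close> is a real infimum and says nothing on an empty set. Division by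
  max 1 (pmod w) is admissible because p \<ge> 1.\<close>

lemma lux_set_nonempty:
  fixes w :: "'a \<Rightarrow> real"
  assumes "w \<in> Lp" shows "{t. t > 0 \<and> modular p \<Omega> (\<lambda>x. w x / t) \<le> 1} \<noteq> {}"
proof -
  define t where "t = max 1 (pmod w)"
  have t: "t \<ge> 1" "pmod w \<le> t" by (auto simp: t_def)
  have "pmod (\<lambda>x. (1 / t) *\<^sub>R w x) \<le> \<bar>1 / t\<bar> * pmod w" by (rule Lp_scale(2)[OF assms]) (use t in auto)
  also have "\<dots> \<le> 1" using t by simp
  finally show ?thesis using t modular_scaled_le_iff[OF assms, of t] by (auto intro!: exI[of _ t])
qed

lemma lux_nonneg:
  fixes w :: "'a \<Rightarrow> real"
  assumes "w \<in> Lp" shows "lux_norm p \<Omega> w \<ge> 0"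
  unfolding lux_norm_def by (rule cInf_greatest[OF lux_set_nonempty[OF assms]]) auto

text \<open>If some t \<le> 1 is admissible in the infimum, the modular is at most t; conversely a
  modular below t powr P makes t admissible.\<close>

lemma lux_tendsto_iff:
  fixes w :: "nat \<Rightarrow> 'a \<Rightarrow> real"
  assumes w: "\<And>n. w n \<in> Lp"
  shows "(\<lambda>n. lux_norm p \<Omega> (w n)) \<longlonglongrightarrow> 0 \<longleftrightarrow> (\<lambda>n. pmod (w n)) \<longlonglongrightarrow> 0"
proof
  assume L: "(\<lambda>n. lux_norm p \<Omega> (w n)) \<longlonglongrightarrow> 0"
  show "(\<lambda>n. pmod (w n)) \<longlonglongrightarrow> 0"
  proof (rule order_tendstoI)
    fix e :: real assume e: "0 < e"
    have "\<forall>\<^sub>F n in sequentially. lux_norm p \<Omega> (w n) < min 1 e"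
      by (rule order_tendstoD(2)[OF L]) (use e in auto)
    then show "\<forall>\<^sub>F n in sequentially. pmod (w n) < e"
    proof eventually_elim
      case (elim n)
      then obtain t where t: "t > 0" "modular p \<Omega> (\<lambda>x. w n x / t) \<le> 1" "t < min 1 e"
        unfolding lux_norm_def using cInf_lessD[OF lux_set_nonempty[OF w[of n]]] by blast
      have "pmod (\<lambda>x. t *\<^sub>R (1 / t) *\<^sub>R w n x) \<le> \<bar>t\<bar> * pmod (\<lambda>x. (1 / t) *\<^sub>R w n x)"
        by (rule Lp_scale(2)[OF Lp_scale(1)[OF w]]) (use t in auto)
      also have "\<dots> \<le> t * 1"
        using t modular_scaled_le_iff[OF w] by (intro mult_mono) (auto simp: pmod_nonneg)
      finally show ?case using t by simp
    qed
  next
    fix e :: real assume "e < 0"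
    then show "\<forall>\<^sub>F n in sequentially. e < pmod (w n)"
      by (intro always_eventually allI) (use pmod_nonneg less_le_trans in blast)
  qed
next
  assume L: "(\<lambda>n. pmod (w n)) \<longlonglongrightarrow> 0"
  show "(\<lambda>n. lux_norm p \<Omega> (w n)) \<longlonglongrightarrow> 0"
  proof (rule order_tendstoI)
    fix e :: real assume e: "0 < e"
    define t where "t = min 1 (e / 2)"
    have t: "0 < t" "t \<le> 1" "t < e" using e by (auto simp: t_def)
    have "\<forall>\<^sub>F n in sequentially. pmod (w n) < t powr P"
      by (rule order_tendstoD(2)[OF L]) (use t in auto)
    then show "\<forall>\<^sub>F n in sequentially. lux_norm p \<Omega> (w n) < e"
    proof eventually_elim
      case (elim n)
      have "pmod (\<lambda>x. (1 / t) *\<^sub>R w n x) \<le> (1 / t) powr P * pmod (w n)"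
        by (rule scaled_pmod_le[OF w t(1,2)])
      also have "\<dots> \<le> (1 / t) powr P * t powr P" using elim by (intro mult_left_mono) auto
      also have "\<dots> = 1" using t by (simp add: powr_divide)
      finally have "t \<in> {t. t > 0 \<and> modular p \<Omega> (\<lambda>x. w n x / t) \<le> 1}"
        using t modular_scaled_le_iff[OF w] by simp
      then have "lux_norm p \<Omega> (w n) \<le> t"
        unfolding lux_norm_def by (rule cInf_lower) (auto intro!: bdd_belowI[of _ 0])
      then show ?case using t by linarith
    qed
  next
    fix e :: real assume "e < 0"
    then show "\<forall>\<^sub>F n in sequentially. e < lux_norm p \<Omega> (w n)"
      by (intro always_eventually allI) (use lux_nonneg[OF w] less_le_trans in blast)
  qed
qed

lemma Lp_norm_iff:
  assumes "G \<in> borel_measurable M" shows "(\<lambda>x. norm (G x)) \<in> Lp \<longleftrightarrow> G \<in> Lp"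
  using assms by (auto simp: Lp_def)

lemma pmod_norm: "pmod (\<lambda>x. norm (G x)) = pmod G" by (simp add: pmod_def)

end

text \<open>Interpolation between L^1 and L^q, uniform in the exponent a \<le> P: a large L makes
  the coefficient of the q-th power small, and the first term is then left to L^1
  convergence.\<close>

lemma powr_truncation_bound:
  fixes s L a P q :: real
  assumes "0 \<le> s" "1 \<le> L" "1 \<le> a" "a \<le> P" "P < q"
  shows "s powr a \<le> L powr (P - 1) * s + L powr (P - q) * s powr q"
proof (cases "s \<le> L")
  case True
  have "s powr a = s powr (a - 1) * s"
    using assms by (cases "s = 0") (simp_all add: powr_diff)
  also have "\<dots> \<le> L powr (P - 1) * s"
  proof (rule mult_right_mono)
    have "s powr (a - 1) \<le> L powr (a - 1)" using True assms by (intro powr_mono2) auto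
    also have "\<dots> \<le> L powr (P - 1)" using assms by (intro powr_mono) auto
    finally show "s powr (a - 1) \<le> L powr (P - 1)" .
  qed fact
  finally show ?thesis by (smt (verit) mult_nonneg_nonneg powr_ge_zero)
next
  case False
  then have s: "s > 1" using assms by linarith
  have "s powr a \<le> s powr P" using s assms by (intro powr_mono) auto
  also have "\<dots> = s powr (P - q) * s powr q" using s by (simp flip: powr_add)
  also have "\<dots> \<le> L powr (P - q) * s powr q"
    using False assms by (intro mult_right_mono powr_mono2') auto
  finally show ?thesis using assms by (smt (verit) mult_nonneg_nonneg powr_ge_zero)
qed

text \<open>\<open>neg_cut 0\<close> is -flat 0 (-t), a smooth substitute for min t 0 that sends
  test functions to test functions. The sign (-1)^n makes each member the derivative of its
  predecessor, as \<open>test_fun_compose\<close> requires.\<close>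

definition neg_cut :: "nat \<Rightarrow> real \<Rightarrow> real" where
  "neg_cut n t = - ((- 1) ^ n) * flat n (- t)"

lemma neg_cut_deriv: "(neg_cut n has_real_derivative neg_cut (Suc n) t) (at t)"
proof -
  have "((\<lambda>t. flat n (- t)) has_real_derivative flat (Suc n) (- t) * - 1) (at t)"
    by (rule DERIV_chain'[of uminus _ _ _ "flat n", OF _ flat_has_derivative]) (auto intro!: derivative_eq_intros)
  then have "((\<lambda>t. - ((- 1) ^ n) * flat n (- t)) has_real_derivative - ((- 1) ^ n) * (flat (Suc n) (- t) * - 1)) (at t)"
    by (rule DERIV_cmult)
  then show ?thesis by (simp add: neg_cut_def[abs_def])
qed

lemma neg_cut_cont: "continuous_on UNIV (neg_cut n)"
  using neg_cut_deriv by (meson DERIV_continuous_on has_field_derivative_at_within)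

lemma neg_cut_bounds:
  "neg_cut 0 t \<le> 0" "\<bar>neg_cut 0 t\<bar> \<le> \<bar>t\<bar>" "0 \<le> neg_cut 1 t" "\<bar>neg_cut 1 t\<bar> \<le> 2"
  "t \<ge> 0 \<Longrightarrow> neg_cut 0 t = 0" "t < 0 \<Longrightarrow> neg_cut 0 t < 0"
  using flat_nonneg[of "- t"] flat_le[of "- t"] flat_1_bounds[of "- t"] flat_pos[of "- t"]
  by (auto simp: neg_cut_def flat_0)

text \<open>Difference quotients in direction b have integral zero by translation invariance, and
  they converge dominatedly to the directional derivative.\<close>

lemma test_integral_grad_zero:
  fixes f :: "'a::euclidean_space \<Rightarrow> real"
  assumes f: "test_fun S f" and S: "S \<subseteq> ball 0 R" and b: "b \<in> Basis"
  shows "integral\<^sup>L lborel (\<lambda>x. grad f x \<bullet> b) = 0"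
proof -
  define R' where "R' = max R 1"
  have R': "R' > 0" "S \<subseteq> ball 0 R'" using S by (auto simp: R'_def)
  interpret c1_compact f "grad f" R' by (rule test_fun_c1_compact[OF f R'(2,1)])
  obtain K where K: "\<And>x. norm (grad f x) \<le> K" using test_fun_bounded[OF f] by blast
  have nb: "norm b = 1" using b by simp
  have lip: "\<bar>f x - f y\<bar> \<le> K * norm (x - y)" for x y
  proof -
    have "onorm (\<lambda>h. grad f x \<bullet> h) \<le> K" for x
    proof (rule onorm_bound)
      show "K \<ge> 0" using order_trans[OF norm_ge_zero K] .
      fix h
      have "\<bar>grad f x \<bullet> h\<bar> \<le> norm (grad f x) * norm h" by (rule Cauchy_Schwarz_ineq2)
      also have "\<dots> \<le> K * norm h" by (intro mult_right_mono K) simp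
      finally show "norm (grad f x \<bullet> h) \<le> K * norm h" by simp
    qed
    then have "norm (f x - f y) \<le> K * norm (x - y)"
      by (intro differentiable_bound[of UNIV f "\<lambda>x h. grad f x \<bullet> h"])
        (auto intro: has_derivative_at_withinI[OF deriv])
    then show ?thesis by simp
  qed
  have fint: "integrable lborel f"
  proof -
    have "(\<lambda>z. indicator (ball 0 R') z *\<^sub>R f (0 + z)) = f"
    proof
      fix z
      show "indicator (ball 0 R') z *\<^sub>R f (0 + z) = f z"
        using supp[of z] by (cases "norm z < R'") (auto simp: indicator_def)
    qed
    then show ?thesis using integrable_translate[of R' 0] by simp
  qed
  have tr: "integral\<^sup>L lborel (\<lambda>x. f (c + x)) = integral\<^sup>L lborel f" "integrable lborel (\<lambda>x. f (c + x))" for c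
  proof -
    have "integral\<^sup>L lborel f = integral\<^sup>L (distr lborel borel ((+) c)) f" by (simp add: lborel_distr_plus)
    also have "\<dots> = integral\<^sup>L lborel (\<lambda>x. f (c + x))" by (rule integral_distr) auto
    finally show "integral\<^sup>L lborel (\<lambda>x. f (c + x)) = integral\<^sup>L lborel f" ..
    have "integrable (distr lborel borel ((+) c)) f" using fint by (simp add: lborel_distr_plus)
    then show "integrable lborel (\<lambda>x. f (c + x))" by (subst (asm) integrable_distr_eq) auto
  qed
  define h where "h = (\<lambda>n::nat. 1 / real (Suc n))"
  have h: "0 < h n" "h n \<le> 1" for n by (auto simp: h_def)
  have h0: "h \<longlonglongrightarrow> 0" unfolding h_def by (rule LIMSEQ_Suc[OF lim_1_over_n])
  define s where "s = (\<lambda>n x. (f (h n *\<^sub>R b + x) - f x) / h n)"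
  have s0: "integral\<^sup>L lborel (s n) = 0" for n
    unfolding s_def using tr[of "h n *\<^sub>R b"] fint by (simp add: Bochner_Integration.integral_diff)
  \<comment> \<open>The radius is enlarged by 1 because shifts of length at most 1 move the
    support.\<close>
  define B where "B = ball (0::'a) (R' + 1)"
  have "(\<lambda>n. integral\<^sup>L lborel (s n)) \<longlonglongrightarrow> integral\<^sup>L lborel (\<lambda>x. grad f x \<bullet> b)"
  proof (rule integral_dominated_convergence[where w="\<lambda>x. K * indicator B x"])
    show "integrable lborel (\<lambda>x. K * indicator B x)"
      unfolding B_def using emeasure_lborel_ball_finite[of 0 "R' + 1"]
      by (intro integrable_mult_right integrable_real_indicator) auto
    show "AE x in lborel. norm (s n x) \<le> K * indicator B x" for n
    proof (rule AE_I2)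
      fix x
      show "norm (s n x) \<le> K * indicator B x"
      proof (cases "x \<in> B")
        case True
        have "\<bar>f (h n *\<^sub>R b + x) - f x\<bar> \<le> K * h n"
          using lip[of "h n *\<^sub>R b + x" x] nb h[of n] by simp
        then show ?thesis using True h[of n] by (simp add: s_def field_simps)
      next
        case False
        then have x: "norm x \<ge> R' + 1" by (auto simp: B_def)
        have "norm (h n *\<^sub>R b + x) \<ge> norm x - norm (h n *\<^sub>R b)" using norm_diff_ineq[of x "h n *\<^sub>R b"] by (simp add: add.commute)
        then have "norm (h n *\<^sub>R b + x) \<ge> R'" using x nb h[of n] by simp
        then have "f (h n *\<^sub>R b + x) = 0" "f x = 0" using supp x by auto
        then show ?thesis using False by (simp add: s_def)
      qed
    qed
    show "AE x in lborel. (\<lambda>n. s n x) \<longlonglongrightarrow> grad f x \<bullet> b"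
    proof (rule AE_I2)
      fix x
      have "((\<lambda>t. f (t *\<^sub>R b + x)) has_derivative (\<lambda>k. grad f x \<bullet> (k *\<^sub>R b))) (at 0)"
        by (rule has_derivative_compose[where g=f and f="\<lambda>t. t *\<^sub>R b + x" and s=UNIV and x=0, simplified, OF _ deriv])
          (auto intro!: derivative_eq_intros)
      then have "((\<lambda>t. f (t *\<^sub>R b + x)) has_real_derivative (grad f x \<bullet> b)) (at 0)"
        by (simp add: has_field_derivative_def mult_commute_abs)
      then have "((\<lambda>t. (f (t *\<^sub>R b + x) - f (0 *\<^sub>R b + x)) / (t - 0)) \<longlongrightarrow> grad f x \<bullet> b) (at 0)"
        by (simp add: has_field_derivative_iff)
      then have "((\<lambda>n. (f (h n *\<^sub>R b + x) - f (0 *\<^sub>R b + x)) / (h n - 0)) \<longlongrightarrow> grad f x \<bullet> b) sequentially"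
        by (rule filterlim_compose) (use h0 h in \<open>auto simp: filterlim_at less_imp_neq[symmetric]\<close>)
      then show "(\<lambda>n. s n x) \<longlonglongrightarrow> grad f x \<bullet> b" by (simp add: s_def)
    qed
  qed (auto simp: s_def)
  then show ?thesis unfolding s0 by (simp add: LIMSEQ_const_iff)
qed

section \<open>Compactness, weak gradients and truncation in the energy space\<close>

context sobolev_setting
begin

text \<open>Nearby test functions inherit a uniform gradient bound, which gives L^1 compactness and
  a uniform L^q bound; \<open>powr_truncation_bound\<close> upgrades the L^1 Cauchy property to the
  modular. Only the function component converges.\<close>

lemma rellich:
  assumes U: "\<And>n. U n \<in> E" and B: "\<And>n. gmod (U n) \<le> B"
  obtains k u where "strict_mono (k::nat\<Rightarrow>nat)" "mconv (\<lambda>n x. fst (U (k n) x)) u"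
proof -
  have "\<exists>\<phi>. test_fun \<Omega> \<phi> \<and> pmod (\<lambda>x. jet \<phi> x - U n x) < 1 / real (Suc n)" for n
    using E_approx[OF U, of "1 / real (Suc n)" n] by auto
  then obtain \<phi> where \<phi>: "\<And>n. test_fun \<Omega> (\<phi> n)" "\<And>n. pmod (\<lambda>x. jet (\<phi> n) x - U n x) < 1 / real (Suc n)"
    by metis
  define B1 where "B1 = 2 powr P * (1 + B)"
  have B1: "pmod (grad (\<phi> n)) \<le> B1" for n
  proof -
    have L: "(\<lambda>x. jet (\<phi> n) x - U n x) \<in> Lp" by (intro Lp_diff test_Lp(3) \<phi> E_Lp U)
    have "pmod (\<lambda>x. snd (jet (\<phi> n) x - U n x)) \<le> 1"
    proof -
      have "1 / real (Suc n) \<le> 1" by simp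
      with Lp_snd(2)[OF L] \<phi>(2)[of n] show ?thesis by linarith
    qed
    moreover have "pmod (\<lambda>x. snd (jet (\<phi> n) x - U n x) + snd (U n x)) \<le> 2 powr P * (pmod (\<lambda>x. snd (jet (\<phi> n) x - U n x)) + pmod (\<lambda>x. snd (U n x)))"
      by (rule Lp_add(2)[OF Lp_snd(1)[OF L] Lp_snd(1)[OF E_Lp[OF U]]])
    ultimately have "pmod (\<lambda>x. snd (jet (\<phi> n) x - U n x) + snd (U n x)) \<le> 2 powr P * (1 + B)"
      using B[of n] unfolding gmod_def by (smt (verit) mult_left_mono powr_ge_zero)
    then show ?thesis by (simp add: B1_def jet_def)
  qed
  have B1_0: "B1 \<ge> 0" using order_trans[OF pmod_nonneg B1] .
  define D where "D = \<mu> + B1"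
  have D: "D > 0" using mu_pos B1_0 by (simp add: D_def)
  have L1: "(\<integral>\<^sup>+x. ennreal (norm (grad (\<phi> n) x)) \<partial>lborel) \<le> ennreal D" for n
  proof -
    have "(\<integral>\<^sup>+x. ennreal (norm (grad (\<phi> n) x)) \<partial>lborel) = (\<integral>\<^sup>+x. ennreal (norm (grad (\<phi> n) x)) \<partial>M)"
      using c1_compact.borel(2)[OF test_c1[OF \<phi>(1)]] test_fun_grad_zero_outside[OF \<phi>(1)]
      by (intro nn_integral_M_eq_lborel[symmetric]) auto
    also have "\<dots> \<le> ennreal (1 * \<mu> + 1 powr (1 - P) * pmod (grad (\<phi> n)))"
      by (rule L1_le_pmod[OF test_Lp(2)[OF \<phi>(1)]]) auto
    also have "\<dots> \<le> ennreal D" using B1[of n] by (intro ennreal_leI) (simp add: D_def)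
    finally show ?thesis .
  qed
  obtain k where k: "strict_mono (k::nat\<Rightarrow>nat)" and
    kC: "\<And>e. e > 0 \<Longrightarrow> \<exists>N. \<forall>i\<ge>N. \<forall>j\<ge>N. (\<integral>\<^sup>+x. ennreal \<bar>\<phi> (k i) x - \<phi> (k j) x\<bar> \<partial>lborel) \<le> ennreal e"
    by (rule rellich_L1[of \<phi> "\<lambda>n. grad (\<phi> n)", OF test_c1[OF \<phi>(1)] L1 less_imp_le[OF D]]) blast
  define \<psi> where "\<psi> = (\<lambda>n. \<phi> (k n))"
  have \<psi>: "test_fun \<Omega> (\<psi> n)" for n unfolding \<psi>_def by (rule \<phi>(1))
  note [measurable] = LpD[OF test_Lp(1)[OF \<psi>]]
  obtain C where C: "C > 0" "\<And>\<phi> D. test_fun \<Omega> \<phi> \<Longrightarrow> D > 0 \<Longrightarrow> (\<integral>\<^sup>+x. ennreal (norm (grad \<phi> x) powr r) \<partial>M) \<le> ennreal D \<Longrightarrow>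
     (\<integral>\<^sup>+x. ennreal (\<bar>\<phi> x\<bar> powr q) \<partial>M) \<le> ennreal (C * D powr (q / r))"
    using sobolev_test[of q] q_less q_pos by auto
  define Q where "Q = C * D powr (q / r)"
  have Q: "Q > 0" using C(1) D by (simp add: Q_def)
  have Lq: "(\<integral>\<^sup>+x. ennreal (\<bar>\<psi> n x\<bar> powr q) \<partial>M) \<le> ennreal Q" for n
    unfolding Q_def
  proof (rule C(2)[OF \<psi> D])
    have "(\<integral>\<^sup>+x. ennreal (norm (grad (\<psi> n) x) powr r) \<partial>M) \<le> ennreal (1 powr r * \<mu> + 1 powr (r - P) * pmod (grad (\<psi> n)))"
      by (rule powr_r_bound[OF test_Lp(2)[OF \<psi>]]) auto
    also have "\<dots> \<le> ennreal D" using B1[of "k n"] by (intro ennreal_leI) (simp add: D_def \<psi>_def)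
    finally show "(\<integral>\<^sup>+x. ennreal (norm (grad (\<psi> n) x) powr r) \<partial>M) \<le> ennreal D" .
  qed
  have cauchy: "\<exists>N. \<forall>i\<ge>N. \<forall>j\<ge>N. pmod (\<lambda>x. \<psi> i x - \<psi> j x) \<le> e" if e: "e > 0" for e
  proof -
    \<comment> \<open>First L is fixed so that the q-th powers contribute at most e / 2; only then
      is the L^1 tolerance \<open>e1\<close> chosen, depending on L.\<close>
    have "((\<lambda>L::real. L powr (P - q)) \<longlongrightarrow> 0) at_top"
      using q_gt by (intro tendsto_neg_powr filterlim_ident) auto
    then have "\<forall>\<^sub>F L in at_top. L powr (P - q) < e / (2 * (2 powr q * (Q + Q)))"
      by (rule order_tendstoD(2)) (use e Q in auto)
    then have "\<forall>\<^sub>F L in at_top. L powr (P - q) < e / (2 * (2 powr q * (Q + Q))) \<and> L \<ge> 1"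
      using eventually_ge_at_top[of "1::real"] by eventually_elim auto
    then obtain L where L: "L powr (P - q) < e / (2 * (2 powr q * (Q + Q)))" "L \<ge> 1"
      using eventually_happens'[OF trivial_limit_at_top_linorder] by blast
    define e1 where "e1 = e / (2 * L powr (P - 1))"
    have e1: "e1 > 0" using e L by (simp add: e1_def)
    obtain N where N: "\<And>i j. i \<ge> N \<Longrightarrow> j \<ge> N \<Longrightarrow> (\<integral>\<^sup>+x. ennreal \<bar>\<psi> i x - \<psi> j x\<bar> \<partial>lborel) \<le> ennreal e1"
      using kC[OF e1] unfolding \<psi>_def by blast
    have "pmod (\<lambda>x. \<psi> i x - \<psi> j x) \<le> e" if ij: "i \<ge> N" "j \<ge> N" for i j
    proof -
      have "(\<integral>\<^sup>+x. ennreal \<bar>\<psi> i x - \<psi> j x\<bar> \<partial>M) = (\<integral>\<^sup>+x. ennreal \<bar>\<psi> i x - \<psi> j x\<bar> \<partial>lborel)"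
        using c1_compact.borel(1)[OF test_c1[OF \<psi>]] test_fun_zero_outside[OF \<psi>]
        by (intro nn_integral_M_eq_lborel) auto
      then have M1: "(\<integral>\<^sup>+x. ennreal \<bar>\<psi> i x - \<psi> j x\<bar> \<partial>M) \<le> ennreal e1" using N[OF ij] by simp
      have "ennreal (pmod (\<lambda>x. \<psi> i x - \<psi> j x)) = (\<integral>\<^sup>+x. ennreal (norm (\<psi> i x - \<psi> j x) powr p x) \<partial>M)"
        by (intro pmod_nn_integral Lp_diff test_Lp(1) \<psi>)
      also have "\<dots> \<le> (\<integral>\<^sup>+x. ennreal (L powr (P - 1)) * ennreal \<bar>\<psi> i x - \<psi> j x\<bar> + 
          ennreal (L powr (P - q) * 2 powr q) * (ennreal (\<bar>\<psi> i x\<bar> powr q) + ennreal (\<bar>\<psi> j x\<bar> powr q)) \<partial>M)"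
      proof (rule nn_integral_mono)
        fix x assume "x \<in> space M"
        then have x: "x \<in> \<Omega>" by simp
        let ?s = "\<bar>\<psi> i x - \<psi> j x\<bar>"
        have "?s powr q \<le> (\<bar>\<psi> i x\<bar> + \<bar>\<psi> j x\<bar>) powr q" using q_pos by (intro powr_mono2) auto
        also have "\<dots> \<le> 2 powr q * (\<bar>\<psi> i x\<bar> powr q + \<bar>\<psi> j x\<bar> powr q)" using q_pos by (intro powr_add_le) auto
        finally have "L powr (P - q) * ?s powr q \<le> L powr (P - q) * (2 powr q * (\<bar>\<psi> i x\<bar> powr q + \<bar>\<psi> j x\<bar> powr q))"
          by (rule mult_left_mono) simp
        moreover have "?s powr p x \<le> L powr (P - 1) * ?s + L powr (P - q) * ?s powr q"
          by (rule powr_truncation_bound) (use L p_ge1[OF x] p_le[OF x] q_gt in auto)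
        ultimately have "norm (\<psi> i x - \<psi> j x) powr p x \<le> L powr (P - 1) * ?s + L powr (P - q) * 2 powr q * (\<bar>\<psi> i x\<bar> powr q + \<bar>\<psi> j x\<bar> powr q)"
          by (simp add: mult.assoc)
        then have "ennreal (norm (\<psi> i x - \<psi> j x) powr p x) \<le> ennreal (L powr (P - 1) * ?s + L powr (P - q) * 2 powr q * (\<bar>\<psi> i x\<bar> powr q + \<bar>\<psi> j x\<bar> powr q))"
          by (rule ennreal_leI)
        also have "\<dots> = ennreal (L powr (P - 1)) * ennreal ?s + ennreal (L powr (P - q) * 2 powr q) * (ennreal (\<bar>\<psi> i x\<bar> powr q) + ennreal (\<bar>\<psi> j x\<bar> powr q))"
          by (simp add: ennreal_mult)
        finally show "ennreal (norm (\<psi> i x - \<psi> j x) powr p x) \<le> ennreal (L powr (P - 1)) * ennreal ?s + ennreal (L powr (P - q) * 2 powr q) * (ennreal (\<bar>\<psi> i x\<bar> powr q) + ennreal (\<bar>\<psi> j x\<bar> powr q))" .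
      qed
      also have "\<dots> = ennreal (L powr (P - 1)) * (\<integral>\<^sup>+x. ennreal \<bar>\<psi> i x - \<psi> j x\<bar> \<partial>M) + 
          ennreal (L powr (P - q) * 2 powr q) * ((\<integral>\<^sup>+x. ennreal (\<bar>\<psi> i x\<bar> powr q) \<partial>M) + (\<integral>\<^sup>+x. ennreal (\<bar>\<psi> j x\<bar> powr q) \<partial>M))"
        by (simp add: nn_integral_add nn_integral_cmult)
      also have "\<dots> \<le> ennreal (L powr (P - 1)) * ennreal e1 + ennreal (L powr (P - q) * 2 powr q) * (ennreal Q + ennreal Q)"
        by (intro add_mono mult_left_mono M1 Lq) auto
      also have "\<dots> = ennreal (L powr (P - 1) * e1 + L powr (P - q) * 2 powr q * (Q + Q))"
      proof -
        have q2: "ennreal Q + ennreal Q = ennreal (Q + Q)" using Q by (intro ennreal_plus[symmetric]) auto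
        show ?thesis unfolding q2 using e1 Q
          by (subst ennreal_plus, simp, simp, subst (1 2) ennreal_mult) auto
      qed
      finally have "pmod (\<lambda>x. \<psi> i x - \<psi> j x) \<le> L powr (P - 1) * e1 + L powr (P - q) * 2 powr q * (Q + Q)"
        using e1 Q by (subst (asm) ennreal_le_iff) auto
      also have "\<dots> \<le> e / 2 + e / 2"
      proof (intro add_mono)
        show "L powr (P - 1) * e1 \<le> e / 2" using L by (simp add: e1_def)
        have "L powr (P - q) * (2 powr q * (Q + Q)) \<le> e / (2 * (2 powr q * (Q + Q))) * (2 powr q * (Q + Q))"
          using L(1) Q by (intro mult_right_mono) auto
        also have "\<dots> = e / 2" using Q by (simp add: times_half_cancel mult.commute[of "e / _"])
        finally show "L powr (P - q) * 2 powr q * (Q + Q) \<le> e / 2" by (simp add: mult.assoc)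
      qed
      finally show ?thesis by simp
    qed
    then show ?thesis by blast
  qed
  obtain u where u: "mconv \<psi> u" by (rule Lp_complete[of \<psi>, OF test_Lp(1)[OF \<psi>] cauchy])
  have L: "(\<lambda>x. fst (U (k n) x)) \<in> Lp" for n by (intro Lp_fst E_Lp U)
  have uL: "u \<in> Lp" using u by (simp add: mconv_def)
  have "(\<lambda>n. pmod (\<lambda>x. fst (U (k n) x) - u x)) \<longlonglongrightarrow> 0"
  proof (rule real_tendsto_sandwich[OF _ _ tendsto_const])
    show "\<forall>\<^sub>F n in sequentially. pmod (\<lambda>x. fst (U (k n) x) - u x) \<le> 2 powr P * (1 / real (Suc n) + pmod (\<lambda>x. \<psi> n x - u x))"
    proof (intro always_eventually allI)
      fix n
      have L2: "(\<lambda>x. jet (\<phi> (k n)) x - U (k n) x) \<in> Lp" by (intro Lp_diff test_Lp(3) \<phi> E_Lp U)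
      have "pmod (\<lambda>x. fst (U (k n) x) - \<psi> n x) = pmod (\<lambda>x. fst (jet (\<phi> (k n)) x - U (k n) x))"
        by (subst pmod_diff_commute) (simp add: jet_def \<psi>_def)
      also have "\<dots> \<le> pmod (\<lambda>x. jet (\<phi> (k n)) x - U (k n) x)" by (rule Lp_fst(2)[OF L2])
      also have "\<dots> \<le> 1 / real (Suc (k n))" using \<phi>(2) less_imp_le by blast
      also have "\<dots> \<le> 1 / real (Suc n)"
        using strict_mono_imp_increasing[OF k, of n] by (simp add: frac_le)
      finally have "pmod (\<lambda>x. fst (U (k n) x) - \<psi> n x) \<le> 1 / real (Suc n)" .
      then have "2 powr P * (pmod (\<lambda>x. fst (U (k n) x) - \<psi> n x) + pmod (\<lambda>x. \<psi> n x - u x)) \<le> 2 powr P * (1 / real (Suc n) + pmod (\<lambda>x. \<psi> n x - u x))"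
        by (intro mult_left_mono add_right_mono) auto
      with pmod_triangle[OF L test_Lp(1)[OF \<psi>] uL]
      show "pmod (\<lambda>x. fst (U (k n) x) - u x) \<le> 2 powr P * (1 / real (Suc n) + pmod (\<lambda>x. \<psi> n x - u x))"
        by (rule order_trans)
    qed
    have "(\<lambda>n. 2 powr P * (1 / real (Suc n) + pmod (\<lambda>x. \<psi> n x - u x))) \<longlonglongrightarrow> 2 powr P * (0 + 0)"
      using u unfolding mconv_def by (intro tendsto_intros LIMSEQ_Suc[OF lim_1_over_n]) auto
    then show "(\<lambda>n. 2 powr P * (1 / real (Suc n) + pmod (\<lambda>x. \<psi> n x - u x))) \<longlonglongrightarrow> 0" by simp
  qed (auto simp: pmod_nonneg)
  then have "mconv (\<lambda>n x. fst (U (k n) x)) u" using L uL by (simp add: mconv_def)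
  with k show thesis by (rule that)
qed

lemma growth_linear:
  fixes f :: "'a \<Rightarrow> 'b::euclidean_space \<Rightarrow> real"
  assumes c: "continuous_on (\<Omega> \<times> UNIV) (\<lambda>(x, y). f x y)" and K: "\<And>x y. x \<in> \<Omega> \<Longrightarrow> \<bar>f x y\<bar> \<le> K * norm y" "K \<ge> 0"
  shows "growth f"
  unfolding growth_def
proof (intro conjI c exI[of _ K] ballI allI)
  fix x and y :: 'b assume x: "x \<in> \<Omega>"
  have "norm y powr 1 \<le> 1 + norm y powr p x" using p_ge1[OF x] by (intro powr_le_one_plus) auto
  then have "K * norm y \<le> K * (1 + norm y powr p x)" using K(2) by (intro mult_left_mono) auto
  then show "\<bar>f x y\<bar> \<le> K * (1 + norm y powr p x)" using K(1)[OF x, of y] by linarith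
qed

lemma integral_M_eq_lborel:
  fixes f :: "'a \<Rightarrow> real"
  assumes f: "f \<in> borel_measurable borel" and z: "\<And>x. x \<notin> \<Omega> \<Longrightarrow> f x = 0"
  shows "integral\<^sup>L M f = integral\<^sup>L lborel f"
proof -
  have "integral\<^sup>L M f = (\<integral>x. indicator \<Omega> x *\<^sub>R f x \<partial>lebesgue)"
    by (rule integral_restrict_space) simp
  also have "\<dots> = integral\<^sup>L lebesgue f"
    by (rule Bochner_Integration.integral_cong) (use z in \<open>auto simp: indicator_def\<close>)
  also have "\<dots> = integral\<^sup>L lborel f"
    by (rule integral_completion) (use f in simp)
  finally show ?thesis .
qed

text \<open>For jets this is the product rule with \<open>test_integral_grad_zero\<close>. Both
  sides are integrals of growth integrands, so the identity survives modular limits.\<close>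

lemma E_weak_grad:
  assumes U: "U \<in> E" shows "weak_grad \<Omega> (\<lambda>x. fst (U x)) (\<lambda>x. snd (U x))"
  unfolding weak_grad_def
proof (intro allI impI ballI)
  fix \<psi> :: "'a \<Rightarrow> real" and b :: 'a assume \<psi>: "test_fun \<Omega> \<psi>" and b: "b \<in> Basis"
  obtain K where K: "\<And>x. norm (\<psi> x) \<le> K" "\<And>x. norm (grad \<psi> x) \<le> K" using test_fun_bounded[OF \<psi>] by blast
  have K0: "K \<ge> 0" using order_trans[OF norm_ge_zero K(1)] .
  have c\<psi>: "continuous_on UNIV \<psi>" "continuous_on UNIV (grad \<psi>)"
    using smooth_continuous smooth_continuous_grad test_fun_smooth[OF \<psi>] by auto
  have g1: "growth (\<lambda>x (y :: real \<times> 'a). fst y * (grad \<psi> x \<bullet> b))"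
  proof (rule growth_linear[OF _ _ K0])
    show "continuous_on (\<Omega> \<times> UNIV) (\<lambda>(x, y::real \<times> 'a). fst y * (grad \<psi> x \<bullet> b))"
      unfolding case_prod_beta' by (intro continuous_intros continuous_on_compose2[OF c\<psi>(2)]) auto
    show "\<bar>fst y * (grad \<psi> x \<bullet> b)\<bar> \<le> K * norm y" for x and y :: "real \<times> 'a"
    proof -
      have "\<bar>grad \<psi> x \<bullet> b\<bar> \<le> K" using Cauchy_Schwarz_ineq2[of "grad \<psi> x" b] b K(2)[of x] by simp
      moreover have "\<bar>fst y\<bar> \<le> norm y" using norm_fst_le[of "fst y" "snd y"] by simp
      ultimately have "\<bar>fst y\<bar> * \<bar>grad \<psi> x \<bullet> b\<bar> \<le> norm y * K" by (intro mult_mono) auto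
      then show ?thesis by (simp add: abs_mult mult.commute)
    qed
  qed
  have g2: "growth (\<lambda>x (y :: real \<times> 'a). (snd y \<bullet> b) * \<psi> x)"
  proof (rule growth_linear[OF _ _ K0])
    show "continuous_on (\<Omega> \<times> UNIV) (\<lambda>(x, y::real \<times> 'a). (snd y \<bullet> b) * \<psi> x)"
      unfolding case_prod_beta' by (intro continuous_intros continuous_on_compose2[OF c\<psi>(1)]) auto
    show "\<bar>(snd y \<bullet> b) * \<psi> x\<bar> \<le> K * norm y" for x and y :: "real \<times> 'a"
    proof -
      have "\<bar>snd y \<bullet> b\<bar> \<le> norm (snd y)" using Cauchy_Schwarz_ineq2[of "snd y" b] b by simp
      also have "\<dots> \<le> norm y" using norm_snd_le[of "snd y" "fst y"] by simp
      finally have "\<bar>snd y \<bullet> b\<bar> * \<bar>\<psi> x\<bar> \<le> norm y * K" using K(1)[of x] by (intro mult_mono) auto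
      then show ?thesis by (simp add: abs_mult mult.commute)
    qed
  qed
  have jets: "(\<integral>x. fst (jet \<phi> x) * (grad \<psi> x \<bullet> b) \<partial>M) = - (\<integral>x. (snd (jet \<phi> x) \<bullet> b) * \<psi> x \<partial>M)" if \<phi>: "test_fun \<Omega> \<phi>" for \<phi>
  proof -
    have sm: "smooth_fun \<phi>" "smooth_fun \<psi>" by (rule test_fun_smooth; fact)+
    have t: "test_fun \<Omega> (\<lambda>x. \<phi> x * \<psi> x)" by (rule test_fun_mult[OF \<phi> \<psi>])
    have "0 = integral\<^sup>L lborel (\<lambda>x. grad (\<lambda>x. \<phi> x * \<psi> x) x \<bullet> b)"
      by (rule test_integral_grad_zero[OF t ballO b, symmetric])
    also have "\<dots> = integral\<^sup>L M (\<lambda>x. grad (\<lambda>x. \<phi> x * \<psi> x) x \<bullet> b)"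
      using c1_compact.borel(2)[OF test_c1[OF t]] test_fun_grad_zero_outside[OF t]
      by (intro integral_M_eq_lborel[symmetric]) auto
    also have "\<dots> = integral\<^sup>L M (\<lambda>x. fst (jet \<phi> x) * (grad \<psi> x \<bullet> b) + (snd (jet \<phi> x) \<bullet> b) * \<psi> x)"
      by (simp add: grad_mult[OF sm] jet_def inner_add_left mult.commute)
    also have "\<dots> = (\<integral>x. fst (jet \<phi> x) * (grad \<psi> x \<bullet> b) \<partial>M) + (\<integral>x. (snd (jet \<phi> x) \<bullet> b) * \<psi> x \<partial>M)"
      by (rule Bochner_Integration.integral_add[OF growth_integrable[OF g1 test_Lp(3)[OF \<phi>]] growth_integrable[OF g2 test_Lp(3)[OF \<phi>]]])
    finally show ?thesis by linarith
  qed
  obtain \<phi> where \<phi>: "\<And>n. test_fun \<Omega> (\<phi> n)" "mconv (\<lambda>n. jet (\<phi> n)) U" using E_obtain[OF U] by blast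
  have "(\<lambda>n. \<integral>x. fst (jet (\<phi> n) x) * (grad \<psi> x \<bullet> b) \<partial>M) \<longlonglongrightarrow> (\<integral>x. fst (U x) * (grad \<psi> x \<bullet> b) \<partial>M)"
    by (rule growth_tendsto[OF g1 \<phi>(2)])
  moreover have "(\<lambda>n. - (\<integral>x. (snd (jet (\<phi> n) x) \<bullet> b) * \<psi> x \<partial>M)) \<longlonglongrightarrow> - (\<integral>x. (snd (U x) \<bullet> b) * \<psi> x \<partial>M)"
    by (rule tendsto_minus[OF growth_tendsto[OF g2 \<phi>(2)]])
  ultimately have "(\<integral>x. fst (U x) * (grad \<psi> x \<bullet> b) \<partial>M) = - (\<integral>x. (snd (U x) \<bullet> b) * \<psi> x \<partial>M)"
    unfolding jets[OF \<phi>(1)] by (rule LIMSEQ_unique)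
  then show "integrable M (\<lambda>x. fst (U x) * frechet_derivative \<psi> (at x) b) \<and>
        integrable M (\<lambda>x. (snd (U x) \<bullet> b) * \<psi> x) \<and>
        integral\<^sup>L M (\<lambda>x. fst (U x) * frechet_derivative \<psi> (at x) b) = - integral\<^sup>L M (\<lambda>x. (snd (U x) \<bullet> b) * \<psi> x)"
    using growth_integrable[OF g1 E_Lp[OF U]] growth_integrable[OF g2 E_Lp[OF U]]
    by (simp add: frechet_derivative_eq_grad[OF test_fun_smooth[OF \<psi>]])
qed

text \<open>The bridge between the stated space, with its Luxemburg norms and weak gradients, and
  limits of jets. In the backward direction the weak gradient comes from
  \<open>E_weak_grad\<close>.\<close>

lemma in_E_iff: "in_E p \<Omega> u G \<longleftrightarrow> (\<lambda>x. (u x, G x)) \<in> E"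
proof
  assume L: "in_E p \<Omega> u G"
  then have u: "u \<in> Lp" and Gm: "G \<in> borel_measurable M" and G: "G \<in> Lp"
    unfolding in_E_def in_Lpx_iff using Lp_norm_iff by auto
  obtain \<phi> where \<phi>: "\<And>k. test_fun \<Omega> (\<phi> k)"
    "(\<lambda>k. lux_norm p \<Omega> (\<lambda>x. norm (grad (\<phi> k) x - G x))) \<longlonglongrightarrow> 0"
    "(\<lambda>k. lux_norm p \<Omega> (\<lambda>x. \<phi> k x - u x)) \<longlonglongrightarrow> 0"
    using L unfolding in_E_def by blast
  have L1: "(\<lambda>x. grad (\<phi> k) x - G x) \<in> Lp" "(\<lambda>x. \<phi> k x - u x) \<in> Lp" for k
    by (intro Lp_diff test_Lp \<phi>(1) G u)+
  have a: "(\<lambda>k. pmod (\<lambda>x. grad (\<phi> k) x - G x)) \<longlonglongrightarrow> 0"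
    using \<phi>(2) L1(1) Lp_norm_iff[OF LpD[OF L1(1)]] by (subst (asm) lux_tendsto_iff) (auto simp: pmod_norm)
  have b: "(\<lambda>k. pmod (\<lambda>x. \<phi> k x - u x)) \<longlonglongrightarrow> 0"
    using \<phi>(3) L1(2) by (subst (asm) lux_tendsto_iff) auto
  have "mconv \<phi> u" "mconv (\<lambda>k. grad (\<phi> k)) G"
    using a b u G test_Lp(1,2)[OF \<phi>(1)] by (auto simp: mconv_def)
  then have "mconv (\<lambda>k. jet (\<phi> k)) (\<lambda>x. (u x, G x))"
    using mconv_Pair[of \<phi> u "\<lambda>k. grad (\<phi> k)" G] by (simp add: jet_def[abs_def])
  then show "(\<lambda>x. (u x, G x)) \<in> E" by (rule E_I[rotated]) (rule \<phi>(1))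
next
  assume L: "(\<lambda>x. (u x, G x)) \<in> E"
  have u: "u \<in> Lp" and G: "G \<in> Lp" using Lp_PairD[OF E_Lp[OF L]] by auto
  obtain \<phi> where \<phi>: "\<And>n. test_fun \<Omega> (\<phi> n)" "mconv (\<lambda>n. jet (\<phi> n)) (\<lambda>x. (u x, G x))"
    using E_obtain[OF L] by blast
  have L1: "(\<lambda>x. grad (\<phi> k) x - G x) \<in> Lp" "(\<lambda>x. \<phi> k x - u x) \<in> Lp" for k
    by (intro Lp_diff test_Lp \<phi>(1) G u)+
  have lim: "(\<lambda>k. pmod (\<lambda>x. jet (\<phi> k) x - (u x, G x))) \<longlonglongrightarrow> 0" using \<phi>(2) by (simp add: mconv_def)
  have J: "(\<lambda>x. jet (\<phi> k) x - (u x, G x)) \<in> Lp" for k by (intro Lp_diff test_Lp(3) \<phi>(1) E_Lp L)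
  have "(\<lambda>k. pmod (\<lambda>x. \<phi> k x - u x)) \<longlonglongrightarrow> 0"
    by (rule real_tendsto_sandwich[OF _ _ tendsto_const lim])
      (use Lp_fst(2)[OF J] in \<open>auto simp: jet_def pmod_nonneg\<close>)
  moreover have "(\<lambda>k. pmod (\<lambda>x. grad (\<phi> k) x - G x)) \<longlonglongrightarrow> 0"
    by (rule real_tendsto_sandwich[OF _ _ tendsto_const lim])
      (use Lp_snd(2)[OF J] in \<open>auto simp: jet_def pmod_nonneg\<close>)
  ultimately have "(\<lambda>k. lux_norm p \<Omega> (\<lambda>x. \<phi> k x - u x)) \<longlonglongrightarrow> 0" "(\<lambda>k. lux_norm p \<Omega> (\<lambda>x. norm (grad (\<phi> k) x - G x))) \<longlonglongrightarrow> 0"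
    using L1 Lp_norm_iff[OF LpD[OF L1(1)]] by (subst lux_tendsto_iff; auto simp: pmod_norm)+
  then show "in_E p \<Omega> u G"
    unfolding in_E_def in_Lpx_iff using u G LpD[OF G] Lp_norm_iff[OF LpD[OF G]] E_weak_grad[OF L] \<phi>(1) by auto
qed

lemma E_neg_cut:
  assumes U: "U \<in> E"
  shows "(\<lambda>x. (neg_cut 0 (fst (U x)), neg_cut 1 (fst (U x)) *\<^sub>R snd (U x))) \<in> E"
proof -
  define Nf where "Nf = (\<lambda>y :: real \<times> 'a. (neg_cut 0 (fst y), neg_cut 1 (fst y) *\<^sub>R snd y))"
  have Nc: "continuous_on UNIV Nf"
    unfolding Nf_def by (intro continuous_intros continuous_on_compose2[OF neg_cut_cont]) auto
  have Nb: "norm (Nf y) \<le> 3 * norm y" for y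
  proof -
    have "norm (Nf y) \<le> norm (neg_cut 0 (fst y)) + norm (neg_cut 1 (fst y) *\<^sub>R snd y)"
      unfolding Nf_def by (rule norm_Pair_le)
    also have "\<dots> \<le> \<bar>fst y\<bar> + 2 * norm (snd y)"
      using neg_cut_bounds(2,4)[of "fst y"] by (auto intro!: add_mono mult_right_mono)
    also have "\<dots> \<le> 3 * norm y"
      using norm_fst_le[of "fst y" "snd y"] norm_snd_le[of "snd y" "fst y"] by simp
    finally show ?thesis .
  qed
  \<comment> \<open>The distance of two truncated jets is viewed as a growth integrand of the pair.
    Continuity of its integral at (U, U), where it vanishes, replaces a Lipschitz estimate for
    \<open>Nf\<close>, whose second component is a product.\<close>
  define F where "F = (\<lambda>x (Y :: (real \<times> 'a) \<times> (real \<times> 'a)). norm (Nf (fst Y) - Nf (snd Y)) powr p x)"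
  have gF: "growth F"
    unfolding growth_def
  proof (intro conjI exI[of _ "6 powr P"] ballI allI)
    show "continuous_on (\<Omega> \<times> UNIV) (\<lambda>(x, y). F x y)"
      unfolding F_def case_prod_beta' using p_ge1
      by (intro continuous_on_powr' continuous_intros continuous_on_compose2[OF p_cont] continuous_on_compose2[OF Nc]) force+
    fix x and Y :: "(real \<times> 'a) \<times> (real \<times> 'a)" assume x: "x \<in> \<Omega>"
    have "norm (Nf (fst Y) - Nf (snd Y)) \<le> norm (Nf (fst Y)) + norm (Nf (snd Y))" by (rule norm_triangle_ineq4)
    also have "\<dots> \<le> 3 * norm (fst Y) + 3 * norm (snd Y)" by (intro add_mono Nb)
    also have "\<dots> \<le> 6 * norm Y"
      using norm_fst_le[of "fst Y" "snd Y"] norm_snd_le[of "snd Y" "fst Y"] by simp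
    finally have "F x Y \<le> (6 * norm Y) powr p x"
      unfolding F_def using p_ge1[OF x] by (intro powr_mono2) auto
    also have "\<dots> = 6 powr p x * norm Y powr p x" by (rule powr_mult)
    also have "\<dots> \<le> 6 powr P * (1 + norm Y powr p x)"
      using p_le[OF x] by (intro mult_mono powr_mono) auto
    finally show "\<bar>F x Y\<bar> \<le> 6 powr P * (1 + norm Y powr p x)" by (simp add: F_def)
  qed
  obtain \<phi> where \<phi>: "\<And>n. test_fun \<Omega> (\<phi> n)" "mconv (\<lambda>n. jet (\<phi> n)) U" using E_obtain[OF U] by blast
  have t: "test_fun \<Omega> (\<lambda>x. neg_cut 0 (\<phi> n x))" for n
    by (rule test_fun_compose[where \<eta>=neg_cut, OF neg_cut_deriv \<phi>(1)]) (rule neg_cut_bounds(5), simp)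
  have j: "jet (\<lambda>x. neg_cut 0 (\<phi> n x)) = (\<lambda>x. Nf (jet (\<phi> n) x))" for n
    using grad_compose[OF neg_cut_deriv[of 0] test_fun_smooth[OF \<phi>(1)[of n]]]
    by (auto simp: jet_def Nf_def fun_eq_iff)
  have NU: "(\<lambda>x. Nf (U x)) \<in> Lp"
  proof (rule Lp_bounded(1)[OF Lp_scale(1)[OF E_Lp[OF U], of 3]])
    show "(\<lambda>x. Nf (U x)) \<in> borel_measurable M"
      using measurable_compose[OF LpD[OF E_Lp[OF U]] borel_measurable_continuous_onI[OF Nc]] .
    show "norm (Nf (U x)) \<le> norm (3 *\<^sub>R U x)" for x using Nb[of "U x"] by simp
  qed
  have "(\<lambda>n. \<integral>x. F x (jet (\<phi> n) x, U x) \<partial>M) \<longlonglongrightarrow> (\<integral>x. F x (U x, U x) \<partial>M)"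
    by (rule growth_tendsto[OF gF mconv_Pair[OF \<phi>(2) mconv_const[OF E_Lp[OF U]]]])
  then have "(\<lambda>n. pmod (\<lambda>x. Nf (jet (\<phi> n) x) - Nf (U x))) \<longlonglongrightarrow> 0"
    by (simp add: F_def pmod_def)
  then have "mconv (\<lambda>n. jet (\<lambda>x. neg_cut 0 (\<phi> n x))) (\<lambda>x. Nf (U x))"
    using NU test_Lp(3)[OF t] unfolding j by (simp add: mconv_def)
  then have "(\<lambda>x. Nf (U x)) \<in> E" by (rule E_I[rotated]) (rule t)
  then show ?thesis by (simp add: Nf_def)
qed

end

section \<open>The convexified functional and its minimisers\<close>

text \<open>The odd power sign(s) |s|^e. For e = \<beta> - 1 it is the derivative of |s|^\<beta> /
  \<beta>, and for s \<ge> 0 it is the power in the equation.\<close>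

definition spow :: "real \<Rightarrow> real \<Rightarrow> real" where
  "spow e s = max s 0 powr e - max (- s) 0 powr e"

lemma spow_cont: "e > 0 \<Longrightarrow> continuous_on UNIV (spow e)"
  unfolding spow_def by (intro continuous_intros continuous_on_powr' continuous_on_max) auto

lemma spow_nonneg: "s \<ge> 0 \<Longrightarrow> spow e s = s powr e"
  and spow_neg: "s \<le> 0 \<Longrightarrow> spow e s = - (\<bar>s\<bar> powr e)"
  by (auto simp: spow_def max_def)

lemma abs_spow: "\<bar>spow e s\<bar> = \<bar>s\<bar> powr e"
  by (cases "s \<ge> 0") (auto simp: spow_nonneg spow_neg)

lemma spow_mult_self: "e > 0 \<Longrightarrow> spow e s * s = \<bar>s\<bar> powr (e + 1)"
  by (cases "s \<ge> 0") (auto simp: spow_nonneg spow_neg powr_add)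

text \<open>Convexity of |s|^e / e in tangent form, which is Young's inequality for the conjugate
  exponents e / (e - 1) and e.\<close>

lemma powr_tangent:
  fixes e s v :: real
  assumes e: "1 < e"
  shows "\<bar>s\<bar> powr e / e + spow (e - 1) s * (v - s) \<le> \<bar>v\<bar> powr e / e"
proof -
  have "\<bar>s\<bar> powr (e - 1) * \<bar>v\<bar> \<le> (\<bar>s\<bar> powr (e - 1)) powr (e / (e - 1)) / (e / (e - 1)) + \<bar>v\<bar> powr e / e"
    by (rule Youngs_inequality) (use e in \<open>auto simp: field_simps\<close>)
  also have "(\<bar>s\<bar> powr (e - 1)) powr (e / (e - 1)) = \<bar>s\<bar> powr e"
    using e by (simp add: powr_powr)
  also have "\<bar>s\<bar> powr e / (e / (e - 1)) = \<bar>s\<bar> powr e - \<bar>s\<bar> powr e / e"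
    using e by (simp add: field_simps)
  finally have "\<bar>s\<bar> powr (e - 1) * \<bar>v\<bar> \<le> \<bar>s\<bar> powr e - \<bar>s\<bar> powr e / e + \<bar>v\<bar> powr e / e" .
  moreover have "spow (e - 1) s * v \<le> \<bar>s\<bar> powr (e - 1) * \<bar>v\<bar>"
    using abs_ge_self[of "spow (e - 1) s * v"] by (simp add: abs_mult abs_spow)
  moreover have "spow (e - 1) s * s = \<bar>s\<bar> powr e" using spow_mult_self[of "e - 1" s] e by simp
  ultimately show ?thesis by (simp add: right_diff_distrib)
qed

text \<open>A Young inequality with non-optimal constants, obtained by comparing a with d b^(g-1).
  The free weight d on the second factor is what gets absorbed into the modular later.\<close>

lemma young_eps:
  fixes a b d g :: real
  assumes "0 \<le> a" "0 \<le> b" "0 < d" "1 < g"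
  shows "a * b \<le> d powr (- 1 / (g - 1)) * a powr (g / (g - 1)) + d * b powr g"
proof (cases "a \<le> d * b powr (g - 1)")
  case True
  have "a * b \<le> d * b powr (g - 1) * b" using True assms by (intro mult_right_mono) auto
  also have "\<dots> = d * b powr g"
    using assms by (cases "b = 0") (simp_all add: powr_diff)
  finally show ?thesis by (smt (verit) mult_nonneg_nonneg powr_ge_zero)
next
  case False
  then have a: "a > 0" using assms by (smt (verit) mult_nonneg_nonneg powr_ge_zero)
  have "b = (b powr (g - 1)) powr (1 / (g - 1))" using assms by (simp add: powr_powr)
  also have "\<dots> \<le> (a / d) powr (1 / (g - 1))"
    using False assms by (intro powr_mono2) (auto simp: field_simps)
  also have "\<dots> = d powr (- 1 / (g - 1)) * a powr (1 / (g - 1))"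
    using a assms by (simp add: powr_divide powr_minus field_simps)
  finally have "a * b \<le> a * (d powr (- 1 / (g - 1)) * a powr (1 / (g - 1)))"
    using a by (intro mult_left_mono) auto
  also have "\<dots> = d powr (- 1 / (g - 1)) * a powr (g / (g - 1))"
  proof -
    have "a powr (g / (g - 1)) = a powr (1 + 1 / (g - 1))" using assms by (simp add: field_simps)
    also have "\<dots> = a * a powr (1 / (g - 1))" using a by (simp add: powr_add)
    finally show ?thesis by simp
  qed
  finally show ?thesis using assms by (smt (verit) mult_nonneg_nonneg powr_ge_zero)
qed

context variable_exponent
begin

lemma growth_add:
  assumes "growth f" "growth g" shows "growth (\<lambda>x y. f x y + g x y)"
proof -
  obtain C D where C: "\<And>x y. x \<in> \<Omega> \<Longrightarrow> \<bar>f x y\<bar> \<le> C * (1 + norm y powr p x)"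
    and D: "\<And>x y. x \<in> \<Omega> \<Longrightarrow> \<bar>g x y\<bar> \<le> D * (1 + norm y powr p x)"
    using assms unfolding growth_def by metis
  have "continuous_on (\<Omega> \<times> UNIV) (\<lambda>(x, y). f x y + g x y)"
    using continuous_on_add[OF assms[unfolded growth_def, THEN conjunct1]] by (simp add: case_prod_beta')
  moreover have "\<bar>f x y + g x y\<bar> \<le> (C + D) * (1 + norm y powr p x)" if "x \<in> \<Omega>" for x y
    using C[OF that, of y] D[OF that, of y] by (simp add: distrib_right) 
  ultimately show ?thesis unfolding growth_def by blast
qed

lemma growth_cmult:
  assumes "growth f" shows "growth (\<lambda>x y. c * f x y)"
proof -
  obtain C where C: "\<And>x y. x \<in> \<Omega> \<Longrightarrow> \<bar>f x y\<bar> \<le> C * (1 + norm y powr p x)"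
    using assms unfolding growth_def by metis
  have "continuous_on (\<Omega> \<times> UNIV) (\<lambda>(x, y). c * f x y)"
    using continuous_on_mult_left[OF assms[unfolded growth_def, THEN conjunct1]] by (simp add: case_prod_beta')
  moreover have "\<bar>c * f x y\<bar> \<le> (\<bar>c\<bar> * C) * (1 + norm y powr p x)" if "x \<in> \<Omega>" for x y
    using mult_left_mono[OF C[OF that, of y], of "\<bar>c\<bar>"] by (simp add: abs_mult mult.assoc)
  ultimately show ?thesis unfolding growth_def by blast
qed

lemma growth_diff: "growth f \<Longrightarrow> growth g \<Longrightarrow> growth (\<lambda>x y. f x y - g x y)"
  using growth_add[of f "\<lambda>x y. (-1) * g x y"] growth_cmult[of g "-1"] by simp

text \<open>Maps that do not increase the norm include the projections from nested tuples, by which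
  the densities below are assembled from their terms.\<close>

lemma growth_comp:
  fixes f :: "'a \<Rightarrow> 'b::euclidean_space \<Rightarrow> real" and h :: "'c::euclidean_space \<Rightarrow> 'b"
  assumes f: "growth f" and h: "continuous_on UNIV h" "\<And>y. norm (h y) \<le> norm y"
  shows "growth (\<lambda>x y. f x (h y))"
proof -
  obtain C where C: "\<And>x y. x \<in> \<Omega> \<Longrightarrow> \<bar>f x y\<bar> \<le> C * (1 + norm y powr p x)"
    using f unfolding growth_def by metis
  have "continuous_on (\<Omega> \<times> UNIV) (\<lambda>z. (\<lambda>(x, y). f x y) (fst z, h (snd z)))"
    by (rule continuous_on_compose2[OF f[unfolded growth_def, THEN conjunct1]])
      (auto intro!: continuous_intros continuous_on_compose2[OF h(1)])
  then have "continuous_on (\<Omega> \<times> UNIV) (\<lambda>(x, y). f x (h y))" by (simp add: case_prod_beta')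
  moreover have "\<bar>f x (h y)\<bar> \<le> \<bar>C\<bar> * (1 + norm y powr p x)" if x: "x \<in> \<Omega>" for x y
  proof -
    have "norm (h y) powr p x \<le> norm y powr p x" using h(2)[of y] p_ge1[OF x] by (intro powr_mono2) auto
    then have "\<bar>C\<bar> * (1 + norm (h y) powr p x) \<le> \<bar>C\<bar> * (1 + norm y powr p x)" by (intro mult_left_mono) auto
    moreover have "C * (1 + norm (h y) powr p x) \<le> \<bar>C\<bar> * (1 + norm (h y) powr p x)" by (intro mult_right_mono) auto
    ultimately show ?thesis using C[OF x, of "h y"] by linarith
  qed
  ultimately show ?thesis unfolding growth_def by blast
qed

end

text \<open>Differentiability and monotonicity appear as the tangent inequality
  \<open>A_tangent\<close>. \<open>A_lower\<close> is (A5) divided by p(x) and weakened to the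
  constant \<open>P\<close>. The parameter \<open>lam\<close> is fixed, since the functional depends
  on it.\<close>

locale leray_lions = sobolev_setting \<Omega> p P r q R
  for \<Omega> :: "'a::euclidean_space set" and p and P r q R :: real +
  fixes A :: "'a \<Rightarrow> 'a \<Rightarrow> real" and a :: "'a \<Rightarrow> 'a \<Rightarrow> 'a" and \<beta> \<gamma> c1 k lam :: real
  assumes exps: "1 < \<beta>" "\<beta> < \<gamma>" "\<gamma> < r"
    and a_cont: "continuous_on (\<Omega> \<times> UNIV) (\<lambda>(x, \<xi>). a x \<xi>)"
    and A_cont: "continuous_on (\<Omega> \<times> UNIV) (\<lambda>(x, \<xi>). A x \<xi>)"
    and A_zero: "\<And>x. x \<in> \<Omega> \<Longrightarrow> A x 0 = 0"
    and a_bound: "\<And>x \<xi>. x \<in> \<Omega> \<Longrightarrow> norm (a x \<xi>) \<le> c1 * (1 + norm \<xi> powr (p x - 1))" and c1: "c1 > 0"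
    and A_tangent: "\<And>x \<xi> \<psi>. x \<in> \<Omega> \<Longrightarrow> A x \<xi> + a x \<xi> \<bullet> (\<psi> - \<xi>) \<le> A x \<psi>"
    and A_mid: "\<And>x \<xi> \<psi>. x \<in> \<Omega> \<Longrightarrow> A x ((1/2) *\<^sub>R (\<xi> + \<psi>)) \<le> A x \<xi> / 2 + A x \<psi> / 2 - k * norm (\<xi> - \<psi>) powr p x"
    and k: "k > 0"
    and a_coercive: "\<And>x \<xi>. x \<in> \<Omega> \<Longrightarrow> norm \<xi> powr p x \<le> a x \<xi> \<bullet> \<xi>"
    and A_lower: "\<And>x \<xi>. x \<in> \<Omega> \<Longrightarrow> norm \<xi> powr p x / P \<le> A x \<xi>"
    and lam: "lam > 0"
begin

lemma exps_p: "x \<in> \<Omega> \<Longrightarrow> \<gamma> \<le> p x" "x \<in> \<Omega> \<Longrightarrow> \<beta> \<le> p x"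
  using exps r_le by fastforce+

lemma A_nonneg: "x \<in> \<Omega> \<Longrightarrow> 0 \<le> A x \<xi>"
  using A_lower[of x \<xi>] P_ge1 by (smt (verit) divide_nonneg_nonneg powr_ge_zero)

lemma powr_prod_bound:
  fixes R' :: real
  assumes x: "x \<in> \<Omega>" and R': "R' \<ge> 0"
  shows "c1 * (1 + R' powr (p x - 1)) * R' \<le> (2 * c1) * (1 + R' powr p x)"
proof -
  have "R' powr (p x - 1) * R' = R' powr p x"
    using R' p_ge1[OF x] by (cases "R' = 0") (simp_all add: powr_diff)
  moreover have "R' \<le> 1 + R' powr p x"
    using powr_le_one_plus[of R' 1 "p x"] p_ge1[OF x] R' by simp
  ultimately have "(1 + R' powr (p x - 1)) * R' \<le> 2 * (1 + R' powr p x)"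
    by (simp add: distrib_right) 
  then show ?thesis using c1 by (simp add: mult.assoc mult.left_commute[of 2])
qed

lemma growth_a: "growth (\<lambda>x (y :: 'a \<times> 'a). a x (fst y) \<bullet> snd y)"
  unfolding growth_def
proof (intro conjI exI[of _ "2 * c1"] ballI allI)
  have "continuous_on (\<Omega> \<times> UNIV) (\<lambda>z. (\<lambda>(x, \<xi>). a x \<xi>) (fst z, fst (snd z :: 'a \<times> 'a)))"
    by (rule continuous_on_compose2[OF a_cont]) (auto intro!: continuous_intros)
  then show "continuous_on (\<Omega> \<times> UNIV) (\<lambda>(x, y :: 'a \<times> 'a). a x (fst y) \<bullet> snd y)"
    by (auto simp: case_prod_beta' intro!: continuous_intros)
  fix x and y :: "'a \<times> 'a" assume x: "x \<in> \<Omega>"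
  have "\<bar>a x (fst y) \<bullet> snd y\<bar> \<le> norm (a x (fst y)) * norm (snd y)" by (rule Cauchy_Schwarz_ineq2)
  also have "\<dots> \<le> c1 * (1 + norm y powr (p x - 1)) * norm y"
  proof (rule mult_mono)
    have "norm (fst y) powr (p x - 1) \<le> norm y powr (p x - 1)"
      using p_ge1[OF x] norm_fst_le[of "fst y" "snd y"] by (intro powr_mono2) auto
    then have "c1 * (1 + norm (fst y) powr (p x - 1)) \<le> c1 * (1 + norm y powr (p x - 1))"
      using c1 by (intro mult_left_mono) auto
    then show "norm (a x (fst y)) \<le> c1 * (1 + norm y powr (p x - 1))"
      using a_bound[OF x, of "fst y"] by linarith
    show "norm (snd y) \<le> norm y" using norm_snd_le[of "snd y" "fst y"] by simp
    show "0 \<le> c1 * (1 + norm y powr (p x - 1))" using c1 by (intro mult_nonneg_nonneg add_nonneg_nonneg) auto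
  qed auto
  also have "\<dots> \<le> (2 * c1) * (1 + norm y powr p x)" by (rule powr_prod_bound[OF x]) simp
  finally show "\<bar>a x (fst y) \<bullet> snd y\<bar> \<le> (2 * c1) * (1 + norm y powr p x)" .
qed

text \<open>The upper bound comes from the tangent at \<xi> evaluated at 0: as A x 0 = 0, it gives A
  x \<xi> \<le> a x \<xi> \<bullet> \<xi>, and the growth of \<open>a\<close> applies.\<close>

lemma growth_A: "growth A"
  unfolding growth_def
proof (intro conjI A_cont exI[of _ "2 * c1"] ballI allI)
  fix x and \<xi> :: 'a assume x: "x \<in> \<Omega>"
  have "A x \<xi> \<le> a x \<xi> \<bullet> \<xi>" using A_tangent[OF x, of \<xi> 0] A_zero[OF x] by (simp add: inner_diff_right)
  also have "\<dots> \<le> norm (a x \<xi>) * norm \<xi>" by (rule norm_cauchy_schwarz)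
  also have "\<dots> \<le> c1 * (1 + norm \<xi> powr (p x - 1)) * norm \<xi>" by (intro mult_right_mono a_bound x) auto
  also have "\<dots> \<le> (2 * c1) * (1 + norm \<xi> powr p x)" by (rule powr_prod_bound[OF x]) simp
  finally show "\<bar>A x \<xi>\<bar> \<le> (2 * c1) * (1 + norm \<xi> powr p x)" using A_nonneg[OF x, of \<xi>] by simp
qed

lemma growth_prod:
  assumes e: "0 < e" "e + 1 \<le> r" and h: "continuous_on UNIV h" "\<And>t. \<bar>h t\<bar> \<le> \<bar>t\<bar> powr e"
  shows "growth (\<lambda>x (y :: real \<times> real). h (fst y) * snd y)"
  unfolding growth_def
proof (intro conjI exI[of _ 1] ballI allI)
  show "continuous_on (\<Omega> \<times> UNIV) (\<lambda>(x, y :: real \<times> real). h (fst y) * snd y)"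
    unfolding case_prod_beta' by (intro continuous_intros continuous_on_compose2[OF h(1)]) auto
  fix x and y :: "real \<times> real" assume x: "x \<in> \<Omega>"
  have n: "\<bar>fst y\<bar> \<le> norm y" "\<bar>snd y\<bar> \<le> norm y"
    using norm_fst_le[of "fst y" "snd y"] norm_snd_le[of "snd y" "fst y"] by auto
  have "\<bar>h (fst y) * snd y\<bar> \<le> norm y powr e * norm y"
    unfolding abs_mult using n e order_trans[OF h(2) powr_mono2[OF _ _ n(1)]] by (intro mult_mono) auto
  also have "\<dots> = norm y powr (e + 1)" by (cases "norm y = 0") (simp_all add: powr_add)
  also have "\<dots> \<le> 1 + norm y powr p x" using e r_le[OF x] by (intro powr_le_one_plus) auto
  finally show "\<bar>h (fst y) * snd y\<bar> \<le> 1 * (1 + norm y powr p x)" by simp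
qed

lemma growth_gamma_prod: "growth (\<lambda>x (y :: real \<times> real). \<bar>fst y\<bar> powr (\<gamma> - 1) * snd y)"
  by (rule growth_prod[of "\<gamma> - 1" "\<lambda>t. \<bar>t\<bar> powr (\<gamma> - 1)"])
    (use exps in \<open>auto intro!: continuous_on_powr' continuous_on_rabs continuous_on_id continuous_on_const\<close>)

lemma growth_spow_prod: "growth (\<lambda>x (y :: real \<times> real). spow (\<beta> - 1) (fst y) * snd y)"
  by (rule growth_prod[of "\<beta> - 1"]) (use exps in \<open>auto intro!: spow_cont simp: abs_spow\<close>)

lemma norm_proj:
  shows "norm (fst y) \<le> norm y" "norm (snd y) \<le> norm y"
    and "norm (fst (fst z)) \<le> norm z" "norm (snd (fst z)) \<le> norm z"
  by (metis norm_fst_le norm_snd_le order_trans prod.collapse)+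

definition I_dens :: "'a \<Rightarrow> (real \<times> 'a) \<times> real \<Rightarrow> real" where
  "I_dens x Y = A x (snd (fst Y)) + lam / \<beta> * \<bar>fst (fst Y)\<bar> powr \<beta> - lam * (\<bar>snd Y\<bar> powr (\<gamma> - 1) * fst (fst Y))"

definition I :: "('a \<Rightarrow> real) \<Rightarrow> ('a \<Rightarrow> real \<times> 'a) \<Rightarrow> real" where
  "I u V = (\<integral>x. I_dens x (V x, u x) \<partial>M)"

definition J_dens :: "'a \<Rightarrow> real \<times> 'a \<Rightarrow> real" where
  "J_dens x y = A x (snd y) + lam / \<beta> * \<bar>fst y\<bar> powr \<beta> - lam / \<gamma> * \<bar>fst y\<bar> powr \<gamma>"

definition J :: "('a \<Rightarrow> real \<times> 'a) \<Rightarrow> real" where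
  "J U = (\<integral>x. J_dens x (U x) \<partial>M)"

text \<open>The directional derivative of \<open>I_dens\<close>, laid out as ((base point,
  direction), frozen function). No derivative of \<open>I\<close> is computed; the link between the
  two is the inequality \<open>I_tangent\<close>.\<close>

definition dI_dens :: "'a \<Rightarrow> ((real \<times> 'a) \<times> (real \<times> 'a)) \<times> real \<Rightarrow> real" where
  "dI_dens x Y = a x (snd (fst (fst Y))) \<bullet> snd (snd (fst Y)) + lam * (spow (\<beta> - 1) (fst (fst (fst Y))) * fst (snd (fst Y)))
     - lam * (\<bar>snd Y\<bar> powr (\<gamma> - 1) * fst (snd (fst Y)))"

definition dI :: "('a \<Rightarrow> real) \<Rightarrow> ('a \<Rightarrow> real \<times> 'a) \<Rightarrow> ('a \<Rightarrow> real \<times> 'a) \<Rightarrow> real" where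
  "dI u V H = (\<integral>x. dI_dens x ((V x, H x), u x) \<partial>M)"

lemma growth_beta: "growth (\<lambda>x (y :: real \<times> 'a). \<bar>fst y\<bar> powr \<beta>)"
  and growth_gamma: "growth (\<lambda>x (y :: real \<times> 'a). \<bar>fst y\<bar> powr \<gamma>)"
  by (rule growth_fst_powr; use exps exps_p in simp)+

lemma growth_A_snd: "growth (\<lambda>x (y :: real \<times> 'a). A x (snd y))"
  by (rule growth_comp[OF growth_A]) (auto intro!: norm_proj continuous_intros)

lemma growth_I: "growth I_dens"
  unfolding I_dens_def[abs_def]
proof (intro growth_diff growth_add growth_cmult)
  show "growth (\<lambda>x (Y :: (real \<times> 'a) \<times> real). A x (snd (fst Y)))"
    by (rule growth_comp[OF growth_A]) (auto intro!: norm_proj continuous_intros)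
  show "growth (\<lambda>x (Y :: (real \<times> 'a) \<times> real). \<bar>fst (fst Y)\<bar> powr \<beta>)"
    by (rule growth_comp[OF growth_beta]) (auto intro!: norm_proj continuous_intros)
  have n: "norm (snd Y, fst (fst Y)) \<le> norm Y" for Y :: "(real \<times> 'a) \<times> real"
    by (cases Y) (auto simp: norm_Pair intro!: real_sqrt_le_mono)
  show "growth (\<lambda>x (Y :: (real \<times> 'a) \<times> real). \<bar>snd Y\<bar> powr (\<gamma> - 1) * fst (fst Y))"
    by (rule growth_comp[OF growth_gamma_prod, of "\<lambda>Y :: (real \<times> 'a) \<times> real. (snd Y, fst (fst Y))", unfolded fst_conv snd_conv])
      (intro continuous_intros, rule n)
qed

lemma growth_J: "growth J_dens"
  unfolding J_dens_def[abs_def]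
  by (intro growth_diff growth_add growth_cmult growth_A_snd growth_beta growth_gamma)

lemma growth_dI: "growth dI_dens"
  unfolding dI_dens_def[abs_def]
proof (intro growth_diff growth_add growth_cmult)
  have n: "norm (snd (fst (fst Y)), snd (snd (fst Y))) \<le> norm Y"
    "norm (fst (fst (fst Y)), fst (snd (fst Y))) \<le> norm Y"
    "norm (snd Y, fst (snd (fst Y))) \<le> norm Y" for Y :: "((real \<times> 'a) \<times> (real \<times> 'a)) \<times> real"
    by (cases Y; auto simp: norm_Pair intro!: real_sqrt_le_mono)+
  show "growth (\<lambda>x (Y :: ((real \<times> 'a) \<times> (real \<times> 'a)) \<times> real). a x (snd (fst (fst Y))) \<bullet> snd (snd (fst Y)))"
    by (rule growth_comp[OF growth_a, of "\<lambda>Y :: ((real \<times> 'a) \<times> (real \<times> 'a)) \<times> real. (snd (fst (fst Y)), snd (snd (fst Y)))", unfolded fst_conv snd_conv])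
      (intro continuous_intros, rule n(1))
  show "growth (\<lambda>x (Y :: ((real \<times> 'a) \<times> (real \<times> 'a)) \<times> real). spow (\<beta> - 1) (fst (fst (fst Y))) * fst (snd (fst Y)))"
    by (rule growth_comp[OF growth_spow_prod, of "\<lambda>Y :: ((real \<times> 'a) \<times> (real \<times> 'a)) \<times> real. (fst (fst (fst Y)), fst (snd (fst Y)))", unfolded fst_conv snd_conv])
      (intro continuous_intros, rule n(2))
  show "growth (\<lambda>x (Y :: ((real \<times> 'a) \<times> (real \<times> 'a)) \<times> real). \<bar>snd Y\<bar> powr (\<gamma> - 1) * fst (snd (fst Y)))"
    by (rule growth_comp[OF growth_gamma_prod, of "\<lambda>Y :: ((real \<times> 'a) \<times> (real \<times> 'a)) \<times> real. (snd Y, fst (snd (fst Y)))", unfolded fst_conv snd_conv])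
      (intro continuous_intros, rule n(3))
qed

lemma I_integrable: "V \<in> Lp \<Longrightarrow> u \<in> Lp \<Longrightarrow> integrable M (\<lambda>x. I_dens x (V x, u x))"
  by (rule growth_integrable[OF growth_I Lp_Pair(1)])

lemma J_integrable: "U \<in> Lp \<Longrightarrow> integrable M (\<lambda>x. J_dens x (U x))"
  by (rule growth_integrable[OF growth_J])

lemma dI_integrable: "V \<in> Lp \<Longrightarrow> H \<in> Lp \<Longrightarrow> u \<in> Lp \<Longrightarrow> integrable M (\<lambda>x. dI_dens x ((V x, H x), u x))"
  by (intro growth_integrable[OF growth_dI] Lp_Pair(1))

lemma I_tendsto: "mconv V V' \<Longrightarrow> mconv u u' \<Longrightarrow> (\<lambda>n. I (u n) (V n)) \<longlonglongrightarrow> I u' V'"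
  unfolding I_def by (rule growth_tendsto[OF growth_I mconv_Pair])

lemma J_tendsto: "mconv U U' \<Longrightarrow> (\<lambda>n. J (U n)) \<longlonglongrightarrow> J U'"
  unfolding J_def by (rule growth_tendsto[OF growth_J])

lemma I_tangent:
  assumes "V \<in> Lp" "W \<in> Lp" "u \<in> Lp"
  shows "I u V + dI u V (\<lambda>x. W x - V x) \<le> I u W"
proof -
  have H: "(\<lambda>x. W x - V x) \<in> Lp" by (rule Lp_diff[OF assms(2,1)])
  have "I u V + dI u V (\<lambda>x. W x - V x) = (\<integral>x. I_dens x (V x, u x) + dI_dens x ((V x, W x - V x), u x) \<partial>M)"
    unfolding I_def dI_def
    by (rule Bochner_Integration.integral_add[symmetric, OF I_integrable[OF assms(1,3)] dI_integrable[OF assms(1) H assms(3)]])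
  also have "\<dots> \<le> I u W"
    unfolding I_def
  proof (rule integral_mono[OF Bochner_Integration.integrable_add[OF I_integrable[OF assms(1,3)] dI_integrable[OF assms(1) H assms(3)]] I_integrable[OF assms(2,3)]])
    fix x assume "x \<in> space M"
    then have x: "x \<in> \<Omega>" by simp
    obtain s \<xi> where V: "V x = (s, \<xi>)" by (cases "V x")
    obtain t \<psi> where W: "W x = (t, \<psi>)" by (cases "W x")
    have "lam * (\<bar>s\<bar> powr \<beta> / \<beta> + spow (\<beta> - 1) s * (t - s)) \<le> lam * (\<bar>t\<bar> powr \<beta> / \<beta>)"
      using powr_tangent[OF exps(1), of s t] lam by (intro mult_left_mono) auto
    with A_tangent[OF x, of \<xi> \<psi>]
    show "I_dens x (V x, u x) + dI_dens x ((V x, W x - V x), u x) \<le> I_dens x (W x, u x)"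
      by (simp add: V W I_dens_def dI_dens_def algebra_simps)
  qed
  finally show ?thesis .
qed

text \<open>(A4) supplies the gain, the coupling is linear, and the \<beta>-term is midpoint convex:
  adding its two tangents at the midpoint cancels the slopes.\<close>

lemma I_mid:
  assumes "V \<in> Lp" "W \<in> Lp" "u \<in> Lp"
  shows "I u (\<lambda>x. (1/2) *\<^sub>R (V x + W x)) + k * gmod (\<lambda>x. V x - W x) \<le> I u V / 2 + I u W / 2"
proof -
  have mid: "(\<lambda>x. (1/2) *\<^sub>R (V x + W x)) \<in> Lp" by (intro Lp_scale Lp_add assms)
  have D0: "(\<lambda>x. snd (V x - W x)) \<in> Lp" by (intro Lp_snd Lp_diff assms)
  then have D: "(\<lambda>x. snd (V x) - snd (W x)) \<in> Lp" by simp
  have "I u (\<lambda>x. (1/2) *\<^sub>R (V x + W x)) + k * gmod (\<lambda>x. V x - W x)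
    = (\<integral>x. I_dens x ((1/2) *\<^sub>R (V x + W x), u x) + k * norm (snd (V x - W x)) powr p x \<partial>M)"
    unfolding I_def gmod_def pmod_def
    by (subst Bochner_Integration.integral_add) (auto intro!: I_integrable mid assms integrable_mult_right Lp_integrable D)
  also have "\<dots> \<le> (\<integral>x. I_dens x (V x, u x) / 2 + I_dens x (W x, u x) / 2 \<partial>M)"
  proof (rule integral_mono)
    fix x assume "x \<in> space M"
    then have x: "x \<in> \<Omega>" by simp
    obtain s \<xi> where V: "V x = (s, \<xi>)" by (cases "V x")
    obtain t \<psi> where W: "W x = (t, \<psi>)" by (cases "W x")
    let ?m = "(1/2) * (s + t)"
    have "\<bar>?m\<bar> powr \<beta> / \<beta> + spow (\<beta> - 1) ?m * (s - ?m) \<le> \<bar>s\<bar> powr \<beta> / \<beta>"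
      "\<bar>?m\<bar> powr \<beta> / \<beta> + spow (\<beta> - 1) ?m * (t - ?m) \<le> \<bar>t\<bar> powr \<beta> / \<beta>"
      by (rule powr_tangent[OF exps(1)])+
    then have "2 * (\<bar>?m\<bar> powr \<beta> / \<beta>) + spow (\<beta> - 1) ?m * ((s - ?m) + (t - ?m)) \<le> \<bar>s\<bar> powr \<beta> / \<beta> + \<bar>t\<bar> powr \<beta> / \<beta>"
      by (simp only: distrib_left)
    moreover have "(s - ?m) + (t - ?m) = 0" by simp
    moreover have "X \<le> Y / 2" if "2 * X + Z * d \<le> Y" "d = 0" for X Y Z d :: real using that by simp
    ultimately have "\<bar>?m\<bar> powr \<beta> / \<beta> \<le> (\<bar>s\<bar> powr \<beta> / \<beta> + \<bar>t\<bar> powr \<beta> / \<beta>) / 2" by blast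
    then have "lam * (\<bar>?m\<bar> powr \<beta> / \<beta>) \<le> lam * ((\<bar>s\<bar> powr \<beta> / \<beta> + \<bar>t\<bar> powr \<beta> / \<beta>) / 2)"
      using lam by (intro mult_left_mono) auto
    also have "\<dots> = lam * (\<bar>s\<bar> powr \<beta> / \<beta>) / 2 + lam * (\<bar>t\<bar> powr \<beta> / \<beta>) / 2"
      by (simp add: distrib_left add_divide_distrib)
    finally have b: "lam * (\<bar>?m\<bar> powr \<beta> / \<beta>) \<le> lam * (\<bar>s\<bar> powr \<beta> / \<beta>) / 2 + lam * (\<bar>t\<bar> powr \<beta> / \<beta>) / 2" .
    define g where "g = lam * \<bar>u x\<bar> powr (\<gamma> - 1)"
    have I: "I_dens x ((\<sigma>, \<zeta>), u x) = A x \<zeta> + lam * (\<bar>\<sigma>\<bar> powr \<beta> / \<beta>) - g * \<sigma>" for \<sigma> \<zeta>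
      by (simp add: I_dens_def g_def)
    have m: "(1/2) *\<^sub>R ((s, \<xi>) + (t, \<psi>)) = (?m, (1/2) *\<^sub>R (\<xi> + \<psi>))" by simp
    have sn: "snd ((s, \<xi>) - (t, \<psi>)) = \<xi> - \<psi>" by simp
    have gm: "g * ?m = g * s / 2 + g * t / 2" by (simp add: distrib_left add_divide_distrib)
    have "a' + l' - (g1 / 2 + g2 / 2) + kk \<le> (a1 + l1 - g1) / 2 + (a2 + l2 - g2) / 2"
      if "a' \<le> a1 / 2 + a2 / 2 - kk" "l' \<le> l1 / 2 + l2 / 2" for a' l' a1 a2 l1 l2 g1 g2 kk :: real
      using that by (simp add: diff_divide_distrib add_divide_distrib)
    from this[OF A_mid[OF x, of \<xi> \<psi>] b, of "g * s" "g * t"]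
    show "I_dens x ((1/2) *\<^sub>R (V x + W x), u x) + k * norm (snd (V x - W x)) powr p x \<le> I_dens x (V x, u x) / 2 + I_dens x (W x, u x) / 2"
      unfolding V W m sn I gm .
  qed (auto intro!: I_integrable mid assms integrable_mult_right Lp_integrable D Bochner_Integration.integrable_add)
  also have "\<dots> = I u V / 2 + I u W / 2"
    unfolding I_def
    by (subst Bochner_Integration.integral_add) (auto intro!: I_integrable assms)
  finally show ?thesis .
qed

lemma gamma_bound:
  obtains K where "K > 0" "\<And>U. U \<in> E \<Longrightarrow> (\<integral>x. \<bar>fst (U x)\<bar> powr \<gamma> \<partial>M) \<le> K * (1 + gmod U)"
proof -
  obtain K where K: "K > 0" "\<And>U. U \<in> E \<Longrightarrow> (\<integral>x. \<bar>fst (U x)\<bar> powr r \<partial>M) \<le> K * (1 + gmod U)"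
    using poincare by blast
  have gr: "growth (\<lambda>x (y :: real \<times> 'a). \<bar>fst y\<bar> powr r)"
    using r_ge1 r_le by (intro growth_fst_powr) auto
  have "(\<integral>x. \<bar>fst (U x)\<bar> powr \<gamma> \<partial>M) \<le> (\<mu> + K) * (1 + gmod U)" if U: "U \<in> E" for U
  proof -
    have "(\<integral>x. \<bar>fst (U x)\<bar> powr \<gamma> \<partial>M) \<le> (\<integral>x. 1 + \<bar>fst (U x)\<bar> powr r \<partial>M)"
    proof (rule integral_mono)
      show "\<bar>fst (U x)\<bar> powr \<gamma> \<le> 1 + \<bar>fst (U x)\<bar> powr r" for x
        using exps by (intro powr_le_one_plus) auto
    qed (auto intro!: growth_integrable[OF growth_gamma E_Lp[OF U]] growth_integrable[OF gr E_Lp[OF U]])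
    also have "\<dots> = \<mu> + (\<integral>x. \<bar>fst (U x)\<bar> powr r \<partial>M)"
      by (subst Bochner_Integration.integral_add) (auto intro!: growth_integrable[OF gr E_Lp[OF U]])
    also have "\<dots> \<le> \<mu> * (1 + gmod U) + K * (1 + gmod U)"
      using K(2)[OF U] mult_nonneg_nonneg[OF less_imp_le[OF mu_pos] gmod_nonneg[of U]] by (simp add: distrib_left)
    finally show ?thesis by (simp add: distrib_right)
  qed
  moreover have "\<mu> + K > 0" using K(1) mu_pos by linarith
  ultimately show thesis using that by blast
qed

lemma A_integral_lower:
  assumes "U \<in> Lp" shows "gmod U / P \<le> (\<integral>x. A x (snd (U x)) \<partial>M)"
proof -
  have "gmod U / P = (\<integral>x. norm (snd (U x)) powr p x / P \<partial>M)" by (simp add: gmod_def pmod_def)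
  also have "\<dots> \<le> (\<integral>x. A x (snd (U x)) \<partial>M)"
    by (rule integral_mono)
      (auto intro!: growth_integrable[OF growth_A_snd assms] A_lower Lp_integrable Lp_snd assms)
  finally show ?thesis .
qed

text \<open>The weight \<open>d\<close> satisfies lam * d * K = 1 / P, so the coupling consumes
  exactly the lower bound gmod V / P for the integral of A. A bare lower bound is enough, because
  minimising sequences converge by uniform convexity and not by boundedness.\<close>

lemma I_lower:
  assumes u: "u \<in> Lp"
  obtains C where "\<And>V. V \<in> E \<Longrightarrow> C \<le> I u V"
proof -
  obtain K where K: "K > 0" "\<And>U. U \<in> E \<Longrightarrow> (\<integral>x. \<bar>fst (U x)\<bar> powr \<gamma> \<partial>M) \<le> K * (1 + gmod U)"
    using gamma_bound by blast
  define d where "d = 1 / (P * lam * K)"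
  have d: "d > 0" using K(1) P_ge1 lam by (simp add: d_def)
  define Cd where "Cd = d powr (- 1 / (\<gamma> - 1))"
  have gu: "integrable M (\<lambda>x. \<bar>u x\<bar> powr \<gamma>)"
    using growth_integrable[OF growth_gamma Lp_Pair(1)[OF u, of "\<lambda>x. 0"]] p_ge1
    by (auto simp: Lp_def)
  have "- (lam * Cd * (\<integral>x. \<bar>u x\<bar> powr \<gamma> \<partial>M) + 1 / P) \<le> I u V" if V: "V \<in> E" for V
  proof -
    note VL = E_Lp[OF V]
    have iv: "integrable M (\<lambda>x. \<bar>fst (V x)\<bar> powr \<gamma>)" by (rule growth_integrable[OF growth_gamma VL])
    have iA: "integrable M (\<lambda>x. A x (snd (V x)))" by (rule growth_integrable[OF growth_A_snd VL])
    have "(\<integral>x. A x (snd (V x)) - lam * (Cd * \<bar>u x\<bar> powr \<gamma> + d * \<bar>fst (V x)\<bar> powr \<gamma>) \<partial>M) \<le> I u V"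
      unfolding I_def
    proof (rule integral_mono[OF _ I_integrable[OF VL u]])
      show "integrable M (\<lambda>x. A x (snd (V x)) - lam * (Cd * \<bar>u x\<bar> powr \<gamma> + d * \<bar>fst (V x)\<bar> powr \<gamma>))"
        using iv iA gu by auto
      fix x
      have "\<bar>u x\<bar> powr (\<gamma> - 1) * fst (V x) \<le> \<bar>u x\<bar> powr (\<gamma> - 1) * \<bar>fst (V x)\<bar>"
        by (intro mult_left_mono) auto
      also have "\<dots> \<le> Cd * (\<bar>u x\<bar> powr (\<gamma> - 1)) powr (\<gamma> / (\<gamma> - 1)) + d * \<bar>fst (V x)\<bar> powr \<gamma>"
        unfolding Cd_def by (rule young_eps) (use d exps in auto)
      also have "(\<bar>u x\<bar> powr (\<gamma> - 1)) powr (\<gamma> / (\<gamma> - 1)) = \<bar>u x\<bar> powr \<gamma>"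
        using exps by (simp add: powr_powr)
      finally have "lam * (\<bar>u x\<bar> powr (\<gamma> - 1) * fst (V x)) \<le> lam * (Cd * \<bar>u x\<bar> powr \<gamma> + d * \<bar>fst (V x)\<bar> powr \<gamma>)"
        using lam by (intro mult_left_mono) auto
      moreover have "0 \<le> lam / \<beta> * \<bar>fst (V x)\<bar> powr \<beta>" using lam exps by simp
      ultimately show "A x (snd (V x)) - lam * (Cd * \<bar>u x\<bar> powr \<gamma> + d * \<bar>fst (V x)\<bar> powr \<gamma>) \<le> I_dens x (V x, u x)"
        unfolding I_dens_def fst_conv snd_conv by linarith
    qed
    also have "(\<integral>x. A x (snd (V x)) - lam * (Cd * \<bar>u x\<bar> powr \<gamma> + d * \<bar>fst (V x)\<bar> powr \<gamma>) \<partial>M)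
      = (\<integral>x. A x (snd (V x)) \<partial>M) - lam * (Cd * (\<integral>x. \<bar>u x\<bar> powr \<gamma> \<partial>M) + d * (\<integral>x. \<bar>fst (V x)\<bar> powr \<gamma> \<partial>M))"
      using iv iA gu by simp
    finally have 1: "(\<integral>x. A x (snd (V x)) \<partial>M) - lam * (Cd * (\<integral>x. \<bar>u x\<bar> powr \<gamma> \<partial>M) + d * (\<integral>x. \<bar>fst (V x)\<bar> powr \<gamma> \<partial>M)) \<le> I u V" .
    have "lam * d * (\<integral>x. \<bar>fst (V x)\<bar> powr \<gamma> \<partial>M) \<le> lam * d * (K * (1 + gmod V))"
      using K(2)[OF V] lam d by (intro mult_left_mono) auto
    also have "\<dots> = (1 + gmod V) / P" using K(1) lam P_ge1 by (simp add: d_def)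
    finally have "lam * d * (\<integral>x. \<bar>fst (V x)\<bar> powr \<gamma> \<partial>M) \<le> 1 / P + gmod V / P" by (simp add: add_divide_distrib)
    with 1 A_integral_lower[OF VL] show ?thesis by (simp add: algebra_simps)
  qed
  then show thesis by (rule that)
qed

end

section \<open>Existence, sign and stability of the minimisers\<close>

context leray_lions
begin

definition is_min :: "('a \<Rightarrow> real) \<Rightarrow> ('a \<Rightarrow> real \<times> 'a) \<Rightarrow> bool" where
  "is_min u V \<longleftrightarrow> V \<in> E \<and> (\<forall>W\<in>E. I u V \<le> I u W)"

lemma min_exists:
  assumes u: "u \<in> Lp"
  obtains V where "is_min u V"
proof -
  obtain C where C: "\<And>V. V \<in> E \<Longrightarrow> C \<le> I u V" using I_lower[OF u] by blast
  define m where "m = Inf (I u ` E)"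
  have bdd: "bdd_below (I u ` E)" using C by (intro bdd_belowI[of _ C]) auto
  have m: "m \<le> I u V" if "V \<in> E" for V unfolding m_def using bdd that by (intro cInf_lower) auto
  have "\<exists>V\<in>E. I u V < m + 1 / real (Suc n)" for n
    using cInf_lessD[of "I u ` E" "m + 1 / real (Suc n)"] E_zero by (auto simp: m_def)
  then obtain V where V: "\<And>n. V n \<in> E" "\<And>n. I u (V n) < m + 1 / real (Suc n)" by metis
  have gm: "k * gmod (\<lambda>x. V i x - V j x) \<le> 1 / real (Suc N)" if "i \<ge> N" "j \<ge> N" for i j N
  proof -
    have "m \<le> I u (\<lambda>x. (1/2) *\<^sub>R (V i x + V j x))" by (intro m E_scale E_add V)
    moreover have "1 / real (Suc i) \<le> 1 / real (Suc N)" "1 / real (Suc j) \<le> 1 / real (Suc N)"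
      using that by (auto simp: frac_le)
    ultimately show ?thesis
      using I_mid[OF E_Lp[OF V(1)] E_Lp[OF V(1)] u, of i j] V(2)[of i] V(2)[of j] by linarith
  qed
  obtain W where W: "W \<in> E" "mconv V W"
  proof (rule E_complete[of V, OF V(1)])
    fix e :: real assume e: "e > 0"
    obtain N where N: "1 / real (Suc N) < k * e"
      using reals_Archimedean[of "k * e"] e k by (auto simp: inverse_eq_divide)
    have "gmod (\<lambda>x. V i x - V j x) < e" if "i \<ge> N" "j \<ge> N" for i j
    proof -
      have "k * gmod (\<lambda>x. V i x - V j x) < k * e" using gm[OF that] N by linarith
      then show ?thesis using k by simp
    qed
    then show "\<exists>N. \<forall>i\<ge>N. \<forall>j\<ge>N. gmod (\<lambda>x. V i x - V j x) < e" by blast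
  qed blast
  have "(\<lambda>n. I u (V n)) \<longlonglongrightarrow> I u W" by (rule I_tendsto[OF W(2) mconv_const[OF u]])
  moreover have "(\<lambda>n. m + 1 / real (Suc n)) \<longlonglongrightarrow> m + 0"
    by (intro tendsto_intros LIMSEQ_Suc[OF lim_1_over_n])
  ultimately have "I u W \<le> m + 0"
    by (rule LIMSEQ_le) (use V(2) less_imp_le in blast)
  then have "is_min u W" using W(1) m by (fastforce simp: is_min_def)
  then show thesis by (rule that)
qed

text \<open>By minimality the midpoint cannot do better than V, so the gain in \<open>I_mid\<close>
  is a quantitative excess of any competitor. This gives uniqueness up to zero gradient distance and
  drives \<open>T_continuous\<close>.\<close>

lemma strong_min:
  assumes u: "u \<in> Lp" and V: "is_min u V" and W: "W \<in> E"
  shows "I u V + 2 * k * gmod (\<lambda>x. W x - V x) \<le> I u W"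
proof -
  have VE: "V \<in> E" using V by (simp add: is_min_def)
  have "I u V \<le> I u (\<lambda>x. (1/2) *\<^sub>R (W x + V x))"
    using V E_scale[OF E_add[OF W VE], of "1/2"] unfolding is_min_def by blast
  with I_mid[OF E_Lp[OF W] E_Lp[OF VE] u] show ?thesis by (simp add: field_simps)
qed

lemma dI_scale: "dI u V (\<lambda>x. c *\<^sub>R H x) = c * dI u V H"
proof -
  have "dI_dens x ((V x, c *\<^sub>R H x), u x) = c * dI_dens x ((V x, H x), u x)" for x
    by (simp add: dI_dens_def algebra_simps)
  then show ?thesis unfolding dI_def by simp
qed

lemma mconv_perturb:
  assumes V: "V \<in> Lp" and H: "H \<in> Lp" and t: "t \<longlonglongrightarrow> s"
  shows "mconv (\<lambda>n x. V x + t n *\<^sub>R H x) (\<lambda>x. V x + s *\<^sub>R H x)"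
proof -
  have L: "(\<lambda>x. V x + c *\<^sub>R H x) \<in> Lp" for c by (intro Lp_add Lp_scale V H)
  have lim: "(\<lambda>n. \<bar>t n - s\<bar>) \<longlonglongrightarrow> 0" using t by (simp add: LIM_zero_iff tendsto_rabs_zero_iff)
  then have ev: "\<forall>\<^sub>F n in sequentially. \<bar>t n - s\<bar> < 1" by (rule order_tendstoD(2)) simp
  have "(\<lambda>n. pmod (\<lambda>x. (V x + t n *\<^sub>R H x) - (V x + s *\<^sub>R H x))) \<longlonglongrightarrow> 0"
  proof (rule real_tendsto_sandwich[OF _ _ tendsto_const])
    show "\<forall>\<^sub>F n in sequentially. pmod (\<lambda>x. (V x + t n *\<^sub>R H x) - (V x + s *\<^sub>R H x)) \<le> \<bar>t n - s\<bar> * pmod H"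
      using ev
    proof eventually_elim
      case (elim n)
      have "(\<lambda>x. (V x + t n *\<^sub>R H x) - (V x + s *\<^sub>R H x)) = (\<lambda>x. (t n - s) *\<^sub>R H x)"
        by (simp add: scaleR_diff_left)
      with Lp_scale(2)[OF H, of "t n - s"] elim show ?case by simp
    qed
    show "(\<lambda>n. \<bar>t n - s\<bar> * pmod H) \<longlonglongrightarrow> 0" using tendsto_mult_right[OF lim, of "pmod H"] by simp
  qed (auto simp: pmod_nonneg)
  then show ?thesis using L by (simp add: mconv_def)
qed

text \<open>Instead of differentiating under the integral, the tangent at W = V + t H is evaluated
  at V: with minimality it gives t * dI u W H \<ge> I u W - I u V \<ge> 0. Division by t and the
  continuity of \<open>dI\<close> finish the argument.\<close>

lemma euler_lagrange_le:
  assumes u: "u \<in> Lp" and V: "is_min u V" and H: "H \<in> E"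
  shows "0 \<le> dI u V H"
proof -
  have VE: "V \<in> E" using V by (simp add: is_min_def)
  note VL = E_Lp[OF VE] and HL = E_Lp[OF H]
  define t where "t = (\<lambda>n::nat. 1 / real (Suc n))"
  have t: "t n > 0" for n by (simp add: t_def)
  have t0: "t \<longlonglongrightarrow> 0" unfolding t_def by (rule LIMSEQ_Suc[OF lim_1_over_n])
  have mc: "mconv (\<lambda>n x. V x + t n *\<^sub>R H x) V" using mconv_perturb[OF VL HL t0] by simp
  have "0 \<le> dI u (\<lambda>x. V x + t n *\<^sub>R H x) H" for n
  proof -
    let ?W = "\<lambda>x. V x + t n *\<^sub>R H x"
    have WE: "?W \<in> E" by (intro E_add E_scale VE H)
    have "I u ?W + dI u ?W (\<lambda>x. V x - ?W x) \<le> I u V" by (rule I_tangent[OF E_Lp[OF WE] VL u])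
    moreover have "(\<lambda>x. V x - ?W x) = (\<lambda>x. (- t n) *\<^sub>R H x)" by auto
    moreover have "I u V \<le> I u ?W" using V WE by (simp add: is_min_def)
    ultimately have "0 \<le> t n * dI u ?W H" using dI_scale[of u ?W "- t n" H] by simp
    then show ?thesis using t[of n] by (simp add: zero_le_mult_iff)
  qed
  moreover have "(\<lambda>n. dI u (\<lambda>x. V x + t n *\<^sub>R H x) H) \<longlonglongrightarrow> dI u V H"
    unfolding dI_def
    by (rule growth_tendsto[OF growth_dI mconv_Pair[OF mconv_Pair[OF mc mconv_const[OF HL]] mconv_const[OF u]]])
  ultimately show ?thesis by (intro LIMSEQ_le_const) auto
qed

lemma euler_lagrange:
  assumes "u \<in> Lp" "is_min u V" "H \<in> E"
  shows "dI u V H = 0"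
  using euler_lagrange_le[OF assms] euler_lagrange_le[OF assms(1,2) E_scale[OF assms(3), of "-1"]]
    dI_scale[of u V "-1" H] by simp

text \<open>Tested with the truncated negative part, the Euler-Lagrange density is a sum of three
  nonnegative terms with integral zero. Its \<beta>-term is strictly positive wherever the minimiser
  is negative.\<close>

lemma min_nonneg:
  assumes u: "u \<in> Lp" and V: "is_min u V"
  shows "AE x in M. 0 \<le> fst (V x)"
proof -
  have VE: "V \<in> E" using V by (simp add: is_min_def)
  define H where "H = (\<lambda>x. (neg_cut 0 (fst (V x)), neg_cut 1 (fst (V x)) *\<^sub>R snd (V x)))"
  have H: "H \<in> E" unfolding H_def by (rule E_neg_cut[OF VE])
  have int: "integrable M (\<lambda>x. dI_dens x ((V x, H x), u x))"
    by (rule dI_integrable[OF E_Lp[OF VE] E_Lp[OF H] u])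
  have parts: "0 \<le> a x (snd (V x)) \<bullet> snd (H x)" "0 \<le> spow (\<beta> - 1) (fst (V x)) * fst (H x)"
    "0 \<le> - (\<bar>u x\<bar> powr (\<gamma> - 1) * fst (H x))" if x: "x \<in> \<Omega>" for x
  proof -
    have "0 \<le> a x (snd (V x)) \<bullet> snd (V x)" using a_coercive[OF x, of "snd (V x)"] by (smt (verit) powr_ge_zero)
    then show "0 \<le> a x (snd (V x)) \<bullet> snd (H x)"
      using neg_cut_bounds(3)[of "fst (V x)"] by (simp add: H_def)
    show "0 \<le> spow (\<beta> - 1) (fst (V x)) * fst (H x)"
      using neg_cut_bounds(1,5)[of "fst (V x)"]
      by (cases "fst (V x) \<ge> 0") (auto simp: H_def spow_neg mult_nonneg_nonpos)
    show "0 \<le> - (\<bar>u x\<bar> powr (\<gamma> - 1) * fst (H x))"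
      using neg_cut_bounds(1)[of "fst (V x)"] by (simp add: H_def mult_nonneg_nonpos)
  qed
  have nn: "0 \<le> dI_dens x ((V x, H x), u x)" if x: "x \<in> \<Omega>" for x
  proof -
    have "0 \<le> lam * (spow (\<beta> - 1) (fst (V x)) * fst (H x))" "0 \<le> lam * - (\<bar>u x\<bar> powr (\<gamma> - 1) * fst (H x))"
      by (rule mult_nonneg_nonneg[OF less_imp_le[OF lam] parts(2)[OF x]],
          rule mult_nonneg_nonneg[OF less_imp_le[OF lam] parts(3)[OF x]])
    then show ?thesis using parts(1)[OF x] by (simp add: dI_dens_def)
  qed
  have "AE x in M. dI_dens x ((V x, H x), u x) = 0"
    using euler_lagrange[OF u V H] int nn unfolding dI_def
    by (subst (asm) integral_nonneg_eq_0_iff_AE) auto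
  then show ?thesis using AE_space
  proof eventually_elim
    case (elim x)
    then have x: "x \<in> \<Omega>" by simp
    show ?case
    proof (rule ccontr)
      assume "\<not> 0 \<le> fst (V x)"
      then have neg: "fst (V x) < 0" by simp
      have "spow (\<beta> - 1) (fst (V x)) < 0" using neg by (simp add: spow_neg)
      moreover have "fst (H x) < 0" using neg_cut_bounds(6)[OF neg] by (simp add: H_def)
      ultimately have "0 < lam * (spow (\<beta> - 1) (fst (V x)) * fst (H x))" using lam by (simp add: mult_neg_neg)
      moreover have "0 \<le> lam * - (\<bar>u x\<bar> powr (\<gamma> - 1) * fst (H x))"
        by (rule mult_nonneg_nonneg[OF less_imp_le[OF lam] parts(3)[OF x]])
      ultimately have "0 < dI_dens x ((V x, H x), u x)" using parts(1)[OF x] by (simp add: dI_dens_def)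
      then show False using elim(1) by simp
    qed
  qed
qed

text \<open>The choice is immaterial: by \<open>strong_min\<close> two minimisers for the same
  \<open>u\<close> have gradient distance zero.\<close>

definition T :: "('a \<Rightarrow> real) \<Rightarrow> 'a \<Rightarrow> real \<times> 'a" where
  "T u = (SOME V. is_min u V)"

lemma T_min: "u \<in> Lp \<Longrightarrow> is_min u (T u)"
  unfolding T_def using min_exists by (metis someI_ex)

lemma T_E: "u \<in> Lp \<Longrightarrow> T u \<in> E" using T_min by (simp add: is_min_def)

lemma I_diff:
  assumes "V \<in> Lp" "W \<in> Lp" "u \<in> Lp" "v \<in> Lp"
  shows "(I u V - I u W) + (I v W - I v V) = lam * (\<integral>x. (\<bar>v x\<bar> powr (\<gamma> - 1) - \<bar>u x\<bar> powr (\<gamma> - 1)) * fst (V x - W x) \<partial>M)"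
proof -
  have "(I u V - I u W) + (I v W - I v V)
    = (\<integral>x. (I_dens x (V x, u x) - I_dens x (W x, u x)) + (I_dens x (W x, v x) - I_dens x (V x, v x)) \<partial>M)"
    unfolding I_def using I_integrable assms by simp
  also have "\<dots> = (\<integral>x. lam * ((\<bar>v x\<bar> powr (\<gamma> - 1) - \<bar>u x\<bar> powr (\<gamma> - 1)) * fst (V x - W x)) \<partial>M)"
    by (rule Bochner_Integration.integral_cong) (auto simp: I_dens_def algebra_simps)
  finally show ?thesis by simp
qed

text \<open>The outer exponent is conjugate to \<gamma>, as Young's inequality in
  \<open>T_continuous\<close> demands; the total growth is then of order \<gamma>, which does not
  exceed p(x).\<close>

lemma growth_nemytskii_gamma:
  "growth (\<lambda>x (y :: real \<times> real). \<bar>\<bar>fst y\<bar> powr (\<gamma> - 1) - \<bar>snd y\<bar> powr (\<gamma> - 1)\<bar> powr (\<gamma> / (\<gamma> - 1)))"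
  unfolding growth_def
proof (intro conjI exI[of _ 1] ballI allI)
  show "continuous_on (\<Omega> \<times> UNIV) (\<lambda>(x, y::real\<times>real). \<bar>\<bar>fst y\<bar> powr (\<gamma> - 1) - \<bar>snd y\<bar> powr (\<gamma> - 1)\<bar> powr (\<gamma> / (\<gamma> - 1)))"
    unfolding case_prod_beta' using exps
    by (intro continuous_on_powr' continuous_on_rabs continuous_on_diff continuous_on_const continuous_on_fst continuous_on_snd continuous_on_id) auto
  fix x and y :: "real \<times> real" assume x: "x \<in> \<Omega>"
  have "\<bar>fst y\<bar> powr (\<gamma> - 1) \<le> norm y powr (\<gamma> - 1)" "\<bar>snd y\<bar> powr (\<gamma> - 1) \<le> norm y powr (\<gamma> - 1)"
    using norm_proj(1,2)[of y] exps by (auto intro!: powr_mono2)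
  then have "\<bar>\<bar>fst y\<bar> powr (\<gamma> - 1) - \<bar>snd y\<bar> powr (\<gamma> - 1)\<bar> \<le> norm y powr (\<gamma> - 1)"
    by (smt (verit) powr_ge_zero)
  then have "\<bar>\<bar>fst y\<bar> powr (\<gamma> - 1) - \<bar>snd y\<bar> powr (\<gamma> - 1)\<bar> powr (\<gamma> / (\<gamma> - 1)) \<le> (norm y powr (\<gamma> - 1)) powr (\<gamma> / (\<gamma> - 1))"
    using exps by (intro powr_mono2) auto
  also have "\<dots> = norm y powr \<gamma>" using exps by (simp add: powr_powr)
  also have "\<dots> \<le> 1 + norm y powr p x" using exps exps_p[OF x] by (intro powr_le_one_plus) auto
  finally show "\<bar>\<bar>\<bar>fst y\<bar> powr (\<gamma> - 1) - \<bar>snd y\<bar> powr (\<gamma> - 1)\<bar> powr (\<gamma> / (\<gamma> - 1))\<bar> \<le> 1 * (1 + norm y powr p x)"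
    by simp
qed

lemma T_continuous:
  assumes c: "mconv u v"
  shows "mconv (\<lambda>n. T (u n)) (T v)"
proof (rule mconv_if_gmod)
  have uL: "u n \<in> Lp" and vL: "v \<in> Lp" for n using c by (auto simp: mconv_def)
  show "T (u n) \<in> E" "T v \<in> E" for n by (auto intro: T_E uL vL)
  note VE = T_E[OF uL] T_E[OF vL]
  note VL = VE[THEN E_Lp]
  define g where "g = (\<lambda>n. gmod (\<lambda>x. T (u n) x - T v x))"
  define e where "e = (\<lambda>n. \<integral>x. \<bar>\<bar>u n x\<bar> powr (\<gamma> - 1) - \<bar>v x\<bar> powr (\<gamma> - 1)\<bar> powr (\<gamma> / (\<gamma> - 1)) \<partial>M)"
  have e0: "e \<longlonglongrightarrow> 0"
    using growth_tendsto[OF growth_nemytskii_gamma mconv_Pair[OF c mconv_const[OF vL]]] by (simp add: e_def)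
  have eint: "integrable M (\<lambda>x. \<bar>\<bar>u n x\<bar> powr (\<gamma> - 1) - \<bar>v x\<bar> powr (\<gamma> - 1)\<bar> powr (\<gamma> / (\<gamma> - 1)))" for n
    using growth_integrable[OF growth_nemytskii_gamma Lp_Pair(1)[OF uL vL]] by simp
  obtain K where K: "K > 0" "\<And>U. U \<in> E \<Longrightarrow> (\<integral>x. \<bar>fst (U x)\<bar> powr \<gamma> \<partial>M) \<le> K * (1 + gmod U)"
    using gamma_bound by blast
  have key: "4 * k * g n \<le> lam * (d powr (- 1 / (\<gamma> - 1)) * e n + d * (K * (1 + g n)))" if d: "d > 0" for d n
  proof -
    let ?V = "T (u n)" and ?W = "T v"
    have DE: "(\<lambda>x. ?V x - ?W x) \<in> E" by (rule E_diff[OF VE])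
    have gc: "gmod (\<lambda>x. ?W x - ?V x) = g n"
      unfolding g_def gmod_def pmod_def by (simp add: norm_minus_commute)
    have "I v ?W + 2 * k * g n \<le> I v ?V" unfolding g_def by (rule strong_min[OF vL T_min[OF vL] VE(1)])
    moreover have "I (u n) ?V + 2 * k * g n \<le> I (u n) ?W"
      using strong_min[OF uL T_min[OF uL] VE(2), of n] unfolding gc .
    ultimately have "4 * k * g n \<le> (I v ?V - I v ?W) + (I (u n) ?W - I (u n) ?V)" by linarith
    also have "\<dots> = lam * (\<integral>x. (\<bar>u n x\<bar> powr (\<gamma> - 1) - \<bar>v x\<bar> powr (\<gamma> - 1)) * fst (?V x - ?W x) \<partial>M)"
      by (rule I_diff[OF VL vL uL])
    also have "\<dots> \<le> lam * (\<integral>x. d powr (- 1 / (\<gamma> - 1)) * \<bar>\<bar>u n x\<bar> powr (\<gamma> - 1) - \<bar>v x\<bar> powr (\<gamma> - 1)\<bar> powr (\<gamma> / (\<gamma> - 1)) + d * \<bar>fst (?V x - ?W x)\<bar> powr \<gamma> \<partial>M)"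
    proof (intro mult_left_mono integral_mono')
      show "integrable M (\<lambda>x. d powr (- 1 / (\<gamma> - 1)) * \<bar>\<bar>u n x\<bar> powr (\<gamma> - 1) - \<bar>v x\<bar> powr (\<gamma> - 1)\<bar> powr (\<gamma> / (\<gamma> - 1)) + d * \<bar>fst (?V x - ?W x)\<bar> powr \<gamma>)"
        by (intro Bochner_Integration.integrable_add integrable_mult_right eint growth_integrable[OF growth_gamma E_Lp[OF DE]])
      fix x
      have "(\<bar>u n x\<bar> powr (\<gamma> - 1) - \<bar>v x\<bar> powr (\<gamma> - 1)) * fst (?V x - ?W x) \<le> \<bar>\<bar>u n x\<bar> powr (\<gamma> - 1) - \<bar>v x\<bar> powr (\<gamma> - 1)\<bar> * \<bar>fst (?V x - ?W x)\<bar>"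
        by (metis abs_ge_self abs_mult)
      also have "\<dots> \<le> d powr (- 1 / (\<gamma> - 1)) * \<bar>\<bar>u n x\<bar> powr (\<gamma> - 1) - \<bar>v x\<bar> powr (\<gamma> - 1)\<bar> powr (\<gamma> / (\<gamma> - 1)) + d * \<bar>fst (?V x - ?W x)\<bar> powr \<gamma>"
        by (rule young_eps) (use d exps in auto)
      finally show "(\<bar>u n x\<bar> powr (\<gamma> - 1) - \<bar>v x\<bar> powr (\<gamma> - 1)) * fst (?V x - ?W x) \<le> d powr (- 1 / (\<gamma> - 1)) * \<bar>\<bar>u n x\<bar> powr (\<gamma> - 1) - \<bar>v x\<bar> powr (\<gamma> - 1)\<bar> powr (\<gamma> / (\<gamma> - 1)) + d * \<bar>fst (?V x - ?W x)\<bar> powr \<gamma>" .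
      show "0 \<le> d powr (- 1 / (\<gamma> - 1)) * \<bar>\<bar>u n x\<bar> powr (\<gamma> - 1) - \<bar>v x\<bar> powr (\<gamma> - 1)\<bar> powr (\<gamma> / (\<gamma> - 1)) + d * \<bar>fst (?V x - ?W x)\<bar> powr \<gamma>"
        using d by (intro add_nonneg_nonneg mult_nonneg_nonneg) auto
    qed (use lam in auto)
    also have "(\<integral>x. d powr (- 1 / (\<gamma> - 1)) * \<bar>\<bar>u n x\<bar> powr (\<gamma> - 1) - \<bar>v x\<bar> powr (\<gamma> - 1)\<bar> powr (\<gamma> / (\<gamma> - 1)) + d * \<bar>fst (?V x - ?W x)\<bar> powr \<gamma> \<partial>M)
      = d powr (- 1 / (\<gamma> - 1)) * e n + d * (\<integral>x. \<bar>fst (?V x - ?W x)\<bar> powr \<gamma> \<partial>M)"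
      unfolding e_def
      using eint[of n] growth_integrable[OF growth_gamma E_Lp[OF DE]] by (simp del: fst_diff)
    also have "lam * (d powr (- 1 / (\<gamma> - 1)) * e n + d * (\<integral>x. \<bar>fst (?V x - ?W x)\<bar> powr \<gamma> \<partial>M))
       \<le> lam * (d powr (- 1 / (\<gamma> - 1)) * e n + d * (K * (1 + g n)))"
      using K(2)[OF DE] d lam unfolding g_def by (intro mult_left_mono add_left_mono) auto
    finally show ?thesis .
  qed
  show "(\<lambda>n. gmod (\<lambda>x. T (u n) x - T v x)) \<longlonglongrightarrow> 0"
    unfolding g_def[symmetric]
  proof (rule order_tendstoI)
    fix \<epsilon> :: real assume \<epsilon>: "0 < \<epsilon>"
    \<comment> \<open>\<open>gamma_bound\<close> yields 1 + g, so the weight has two duties: s \<le>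
      2 k absorbs the g part into 4 k g, and s \<le> k \<epsilon> keeps the constant part
      small.\<close>
    define s where "s = min (2 * k) (k * \<epsilon>)"
    have s: "s > 0" "s \<le> 2 * k" "s \<le> k * \<epsilon>" using k \<epsilon> by (auto simp: s_def)
    define d where "d = s / (lam * K)"
    have d: "d > 0" using s lam K(1) by (simp add: d_def)
    have ds: "lam * (d * (K * y)) = s * y" for y using lam K(1) by (simp add: d_def)
    define Cd where "Cd = lam * d powr (- 1 / (\<gamma> - 1))"
    have "(\<lambda>n. Cd * e n) \<longlonglongrightarrow> Cd * 0" by (intro tendsto_intros e0)
    then have "\<forall>\<^sub>F n in sequentially. Cd * e n < k * \<epsilon>"
      using k \<epsilon> by (intro order_tendstoD(2)[where y="Cd * 0"]) auto
    then show "\<forall>\<^sub>F n in sequentially. g n < \<epsilon>"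
    proof eventually_elim
      case (elim n)
      have "4 * k * g n \<le> Cd * e n + s * (1 + g n)"
        using key[OF d, of n] ds[of "1 + g n"] by (simp add: Cd_def distrib_left mult.assoc)
      also have "s * (1 + g n) \<le> k * \<epsilon> + 2 * k * g n"
        using s mult_right_mono[OF s(2) gmod_nonneg[of "\<lambda>x. T (u n) x - T v x"]] by (simp add: g_def distrib_left)
      finally have "2 * k * g n < 2 * k * \<epsilon>" using elim by linarith
      then show ?case using k by simp
    qed
  next
    fix \<epsilon> :: real assume "\<epsilon> < 0"
    then show "\<forall>\<^sub>F n in sequentially. \<epsilon> < g n"
      unfolding g_def by (intro always_eventually allI) (use gmod_nonneg less_le_trans in blast)
  qed
qed

section \<open>The descent map, energy decrease and the barrier\<close>

definition Ep :: "('a \<Rightarrow> real \<times> 'a) set" where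
  "Ep = {U \<in> E. AE x in M. 0 \<le> fst (U x)}"

definition S :: "('a \<Rightarrow> real \<times> 'a) \<Rightarrow> 'a \<Rightarrow> real \<times> 'a" where
  "S U = T (\<lambda>x. fst (U x))"

lemma Ep_AE: "U \<in> Ep \<Longrightarrow> AE x in M. 0 \<le> fst (U x)" by (simp add: Ep_def)

lemma Ep_E: "U \<in> Ep \<Longrightarrow> U \<in> E" by (simp add: Ep_def)

lemma fst_Lp: "U \<in> E \<Longrightarrow> (\<lambda>x. fst (U x)) \<in> Lp" by (intro Lp_fst E_Lp)

lemma S_Ep: "U \<in> E \<Longrightarrow> S U \<in> Ep"
  unfolding Ep_def S_def using T_E[OF fst_Lp] min_nonneg[OF fst_Lp T_min[OF fst_Lp]] by blast

lemma S_continuous: "mconv U V \<Longrightarrow> mconv (\<lambda>n. S (U n)) (S V)"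
  unfolding S_def by (intro T_continuous mconv_fst)

text \<open>The constant term of the tangent to -lam s^\<gamma> / \<gamma> at u, so that
  \<open>I u V + kap u\<close> is the full majorant.\<close>

definition kap :: "('a \<Rightarrow> real) \<Rightarrow> real" where
  "kap u = lam * (1 - 1 / \<gamma>) * (\<integral>x. \<bar>u x\<bar> powr \<gamma> \<partial>M)"

lemma J_eq_I:
  assumes U: "U \<in> Ep" shows "J U = I (\<lambda>x. fst (U x)) U + kap (\<lambda>x. fst (U x))"
proof -
  have UL: "U \<in> Lp" using U Ep_E E_Lp by blast
  have "I (\<lambda>x. fst (U x)) U + kap (\<lambda>x. fst (U x))
    = (\<integral>x. I_dens x (U x, fst (U x)) + lam * (1 - 1 / \<gamma>) * \<bar>fst (U x)\<bar> powr \<gamma> \<partial>M)"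
    unfolding I_def kap_def
    by (subst Bochner_Integration.integral_add)
      (auto intro!: I_integrable UL Lp_fst growth_integrable[OF growth_gamma UL])
  also have "\<dots> = J U"
    unfolding J_def
  proof (rule integral_cong_AE)
    show "AE x in M. I_dens x (U x, fst (U x)) + lam * (1 - 1 / \<gamma>) * \<bar>fst (U x)\<bar> powr \<gamma> = J_dens x (U x)"
      using Ep_AE[OF U]
    proof eventually_elim
      case (elim x)
      have "\<bar>fst (U x)\<bar> powr (\<gamma> - 1) * fst (U x) = \<bar>fst (U x)\<bar> powr \<gamma>"
        using spow_mult_self[of "\<gamma> - 1" "fst (U x)"] elim exps by (simp add: spow_nonneg)
      then show ?case by (simp add: I_dens_def J_dens_def algebra_simps)
    qed
  qed (use I_integrable[OF UL Lp_fst(1)[OF UL]] growth_integrable[OF growth_gamma UL] J_integrable[OF UL] in auto)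
  finally show ?thesis ..
qed

text \<open>Since equality holds for \<open>V = U\<close>, minimising the convex majorant can only decrease \<open>J\<close>.\<close>

lemma J_le_I:
  assumes U: "U \<in> Ep" and V: "V \<in> Lp"
  shows "J V \<le> I (\<lambda>x. fst (U x)) V + kap (\<lambda>x. fst (U x))"
proof -
  have UL: "U \<in> Lp" using U Ep_E E_Lp by blast
  have "J V \<le> (\<integral>x. I_dens x (V x, fst (U x)) + lam * (1 - 1 / \<gamma>) * \<bar>fst (U x)\<bar> powr \<gamma> \<partial>M)"
    unfolding J_def
  proof (rule integral_mono_AE[OF J_integrable[OF V]])
    show "AE x in M. J_dens x (V x) \<le> I_dens x (V x, fst (U x)) + lam * (1 - 1 / \<gamma>) * \<bar>fst (U x)\<bar> powr \<gamma>"
      using Ep_AE[OF U]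
    proof eventually_elim
      case (elim x)
      let ?s = "fst (U x)" and ?v = "fst (V x)"
      have g1: "1 < \<gamma>" using exps by linarith
      have e: "?s powr (\<gamma> - 1) * ?s = ?s powr \<gamma>"
        using spow_mult_self[of "\<gamma> - 1" ?s] elim exps by (simp add: spow_nonneg)
      have "?s powr \<gamma> / \<gamma> + ?s powr (\<gamma> - 1) * (?v - ?s) \<le> \<bar>?v\<bar> powr \<gamma> / \<gamma>"
        using powr_tangent[OF g1, of ?s ?v] elim by (simp add: spow_nonneg)
      then have "lam * (?s powr \<gamma> / \<gamma> + ?s powr (\<gamma> - 1) * ?v - ?s powr \<gamma>) \<le> lam * (\<bar>?v\<bar> powr \<gamma> / \<gamma>)"
        using lam e by (intro mult_left_mono) (auto simp: right_diff_distrib)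
      then show ?case using elim by (simp add: I_dens_def J_dens_def algebra_simps)
    qed
  qed (use I_integrable[OF V Lp_fst(1)[OF UL]] growth_integrable[OF growth_gamma UL] in auto)
  also have "\<dots> = I (\<lambda>x. fst (U x)) V + kap (\<lambda>x. fst (U x))"
    unfolding I_def kap_def
    by (subst Bochner_Integration.integral_add)
      (auto intro!: I_integrable V UL Lp_fst growth_integrable[OF growth_gamma UL])
  finally show ?thesis .
qed

text \<open>Tangents at the intermediate point towards both ends, weighted by 1 - t and t, cancel
  each other's slopes.\<close>

lemma I_segment:
  assumes "V \<in> Lp" "W \<in> Lp" "u \<in> Lp" and t: "0 \<le> t" "t \<le> 1"
  shows "I u (\<lambda>x. V x + t *\<^sub>R (W x - V x)) \<le> (1 - t) * I u V + t * I u W"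
proof -
  let ?Z = "\<lambda>x. V x + t *\<^sub>R (W x - V x)"
  let ?H = "\<lambda>x. W x - V x"
  have ZL: "?Z \<in> Lp" by (intro Lp_add Lp_scale Lp_diff assms)
  have 1: "I u ?Z + (- t) * dI u ?Z ?H \<le> I u V"
  proof -
    have "(\<lambda>x. V x - ?Z x) = (\<lambda>x. (- t) *\<^sub>R ?H x)" by auto
    then show ?thesis using I_tangent[OF ZL assms(1,3)] dI_scale[of u ?Z "- t" ?H] by simp
  qed
  have 2: "I u ?Z + (1 - t) * dI u ?Z ?H \<le> I u W"
  proof -
    have "(\<lambda>x. W x - ?Z x) = (\<lambda>x. (1 - t) *\<^sub>R ?H x)" by (auto simp: algebra_simps)
    then show ?thesis using I_tangent[OF ZL assms(2,3)] dI_scale[of u ?Z "1 - t" ?H] by simp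
  qed
  have "(1 - t) * (I u ?Z + (- t) * dI u ?Z ?H) + t * (I u ?Z + (1 - t) * dI u ?Z ?H) \<le> (1 - t) * I u V + t * I u W"
    using 1 2 t by (intro add_mono mult_left_mono) auto
  then show ?thesis by (simp add: algebra_simps)
qed

text \<open>The majorant is convex and at S U no larger than at U, so on the segment it stays below
  its value at U, where it coincides with J.\<close>

lemma J_segment:
  assumes U: "U \<in> Ep" and t: "0 \<le> t" "t \<le> 1"
  shows "J (\<lambda>x. U x + t *\<^sub>R (S U x - U x)) \<le> J U"
proof -
  have UE: "U \<in> E" by (rule Ep_E[OF U])
  have SE: "S U \<in> E" by (rule Ep_E[OF S_Ep[OF UE]])
  let ?u = "\<lambda>x. fst (U x)"
  have ZL: "(\<lambda>x. U x + t *\<^sub>R (S U x - U x)) \<in> Lp" by (intro Lp_add Lp_scale Lp_diff E_Lp UE SE)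
  have "I ?u (S U) \<le> I ?u U" using T_min[OF fst_Lp[OF UE]] UE by (simp add: is_min_def S_def)
  then have "(1 - t) * I ?u U + t * I ?u (S U) \<le> (1 - t) * I ?u U + t * I ?u U"
    using t by (intro add_left_mono mult_left_mono) auto
  then have "I ?u (\<lambda>x. U x + t *\<^sub>R (S U x - U x)) \<le> I ?u U"
    using I_segment[OF E_Lp[OF UE] E_Lp[OF SE] fst_Lp[OF UE] t] by (simp add: algebra_simps)
  then show ?thesis using J_le_I[OF U ZL] J_eq_I[OF U] by linarith
qed

lemma J_S_le: "U \<in> Ep \<Longrightarrow> J (S U) \<le> J U"
  using J_segment[of U 1] by simp

lemma segment_continuous:
  assumes U: "U \<in> Lp" and H: "H \<in> Lp"
  shows "continuous_on X (\<lambda>t. gmod (\<lambda>x. U x + t *\<^sub>R H x))"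
  unfolding continuous_on_sequentially comp_def
  using gmod_tendsto[OF mconv_perturb[OF U H]] by blast

text \<open>Because \<gamma> < r, the \<gamma>-power is at most a constant plus s times the r-power
  for any s > 0; the value of s below spends exactly half of gmod U / P.\<close>

lemma J_coercive:
  obtains C where "\<And>U. U \<in> E \<Longrightarrow> gmod U / (2 * P) - C \<le> J U"
proof -
  obtain K where K: "K > 0" "\<And>U. U \<in> E \<Longrightarrow> (\<integral>x. \<bar>fst (U x)\<bar> powr r \<partial>M) \<le> K * (1 + gmod U)"
    using poincare by blast
  have gr: "growth (\<lambda>x (y :: real \<times> 'a). \<bar>fst y\<bar> powr r)"
    using r_ge1 r_le by (intro growth_fst_powr) auto
  define s where "s = 1 / (2 * P * lam * K)"
  have s: "s > 0" using K(1) P_ge1 lam by (simp add: s_def)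
  \<comment> \<open>From L on, the \<gamma>-power is at most s times the r-power, since L powr
    (\<gamma> - r) = s.\<close>
  define L where "L = s powr (1 / (\<gamma> - r))"
  have L: "L > 0" using s by (simp add: L_def)
  have Ls: "L powr (\<gamma> - r) = s" using s exps by (simp add: L_def powr_powr)
  define C where "C = lam * L powr \<gamma> * \<mu> + 1 / (2 * P)"
  have "gmod U / (2 * P) - C \<le> J U" if U: "U \<in> E" for U
  proof -
    note UL = E_Lp[OF U]
    have ir: "integrable M (\<lambda>x. \<bar>fst (U x)\<bar> powr r)" by (rule growth_integrable[OF gr UL])
    have iA: "integrable M (\<lambda>x. A x (snd (U x)))" by (rule growth_integrable[OF growth_A_snd UL])
    have "(\<integral>x. A x (snd (U x)) - lam * (L powr \<gamma> + s * \<bar>fst (U x)\<bar> powr r) \<partial>M) \<le> J U"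
      unfolding J_def
    proof (rule integral_mono[OF _ J_integrable[OF UL]])
      show "integrable M (\<lambda>x. A x (snd (U x)) - lam * (L powr \<gamma> + s * \<bar>fst (U x)\<bar> powr r))"
        using ir iA by auto
      fix x
      let ?v = "\<bar>fst (U x)\<bar>"
      have "?v powr \<gamma> \<le> L powr \<gamma> + s * ?v powr r"
      proof (cases "?v \<le> L")
        case True
        then have "?v powr \<gamma> \<le> L powr \<gamma>" using exps by (intro powr_mono2) auto
        then show ?thesis using s by (smt (verit) mult_nonneg_nonneg powr_ge_zero)
      next
        case False
        then have "?v > 0" using L by linarith
        then have "?v powr \<gamma> = ?v powr (\<gamma> - r) * ?v powr r" by (simp flip: powr_add)
        also have "\<dots> \<le> L powr (\<gamma> - r) * ?v powr r"
          using False L exps by (intro mult_right_mono powr_mono2') auto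
        finally show ?thesis unfolding Ls by (smt (verit) powr_ge_zero)
      qed
      then have "lam * (?v powr \<gamma> / \<gamma>) \<le> lam * (L powr \<gamma> + s * ?v powr r)"
      proof (intro mult_left_mono)
        assume "?v powr \<gamma> \<le> L powr \<gamma> + s * ?v powr r"
        moreover have "?v powr \<gamma> / \<gamma> \<le> ?v powr \<gamma> / 1" using exps by (intro divide_left_mono) auto
        ultimately show "?v powr \<gamma> / \<gamma> \<le> L powr \<gamma> + s * ?v powr r" by simp
      qed (use lam in auto)
      moreover have "0 \<le> lam / \<beta> * ?v powr \<beta>" using lam exps by simp
      ultimately show "A x (snd (U x)) - lam * (L powr \<gamma> + s * ?v powr r) \<le> J_dens x (U x)"
        unfolding J_dens_def by (simp only: times_divide_eq_left times_divide_eq_right)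
    qed
    also have "(\<integral>x. A x (snd (U x)) - lam * (L powr \<gamma> + s * \<bar>fst (U x)\<bar> powr r) \<partial>M)
      = (\<integral>x. A x (snd (U x)) \<partial>M) - lam * (L powr \<gamma> * \<mu> + s * (\<integral>x. \<bar>fst (U x)\<bar> powr r \<partial>M))"
      using ir iA by (simp add: mult.commute)
    finally have 1: "(\<integral>x. A x (snd (U x)) \<partial>M) - lam * (L powr \<gamma> * \<mu> + s * (\<integral>x. \<bar>fst (U x)\<bar> powr r \<partial>M)) \<le> J U" .
    have "lam * s * (\<integral>x. \<bar>fst (U x)\<bar> powr r \<partial>M) \<le> lam * s * (K * (1 + gmod U))"
      using K(2)[OF U] lam s by (intro mult_left_mono) auto
    also have "\<dots> = 1 / (2 * P) + gmod U / (2 * P)" using K(1) lam P_ge1 by (simp add: s_def add_divide_distrib)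
    finally have 2: "lam * s * (\<integral>x. \<bar>fst (U x)\<bar> powr r \<partial>M) \<le> 1 / (2 * P) + gmod U / (2 * P)" .
    have 3: "gmod U / P = gmod U / (2 * P) + gmod U / (2 * P)" by (simp add: field_simps)
    show ?thesis using 1 2 3 A_integral_lower[OF UL] by (simp add: C_def distrib_left mult.assoc)
  qed
  then show thesis by (rule that)
qed

lemma J_zero: "J (\<lambda>x. 0) = 0"
proof -
  have "J (\<lambda>x. 0) = (\<integral>x. 0 \<partial>M)"
    unfolding J_def by (rule Bochner_Integration.integral_cong) (auto simp: J_dens_def A_zero)
  then show ?thesis by simp
qed

text \<open>The difference s^\<gamma> / \<gamma> - s^\<beta> / \<beta> is nonpositive for s \<le> 1
  and at most s^q beyond, so the terms with \<open>lam\<close> cost only lam C m^(q/P), which is of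
  higher order than m.\<close>

lemma barrier:
  obtains \<rho> c0 where "0 < \<rho>" "0 < c0" "\<And>U. U \<in> E \<Longrightarrow> gmod U = \<rho> \<Longrightarrow> c0 \<le> J U" "\<And>U. U \<in> E \<Longrightarrow> gmod U \<le> \<rho> \<Longrightarrow> 0 \<le> J U"
proof -
  obtain C where C: "C > 0" "\<And>\<phi> m. test_fun \<Omega> \<phi> \<Longrightarrow> 0 < m \<Longrightarrow> m \<le> 1 \<Longrightarrow> gmod (jet \<phi>) \<le> m \<Longrightarrow>
    (\<integral>\<^sup>+x. ennreal (\<bar>\<phi> x\<bar> powr q) \<partial>M) \<le> ennreal (C * m powr (q / P))"
    using superlinear_test by blast
  have test: "gmod (jet \<phi>) / P - lam * (C * m powr (q / P)) \<le> J (jet \<phi>)"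
    if \<phi>: "test_fun \<Omega> \<phi>" and m: "0 < m" "m \<le> 1" "gmod (jet \<phi>) \<le> m" for \<phi> m
  proof -
    note L = test_Lp(3)[OF \<phi>]
    have [measurable]: "\<phi> \<in> borel_measurable M" by (rule LpD[OF test_Lp(1)[OF \<phi>]])
    have iA: "integrable M (\<lambda>x. A x (grad \<phi> x))"
      using growth_integrable[OF growth_A_snd L] by (simp add: jet_def)
    have iq: "integrable M (\<lambda>x. \<bar>\<phi> x\<bar> powr q)"
      by (rule integrableI_bounded) (use C(2)[OF \<phi> m] in \<open>auto simp: order_le_less_trans\<close>)
    have "ennreal (\<integral>x. \<bar>\<phi> x\<bar> powr q \<partial>M) \<le> ennreal (C * m powr (q / P))"
      using C(2)[OF \<phi> m] iq by (subst (asm) nn_integral_eq_integral) auto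
    then have q: "(\<integral>x. \<bar>\<phi> x\<bar> powr q \<partial>M) \<le> C * m powr (q / P)"
      using C(1) by (subst (asm) ennreal_le_iff) auto
    have "(\<integral>x. A x (grad \<phi> x) - lam * \<bar>\<phi> x\<bar> powr q \<partial>M) \<le> J (jet \<phi>)"
      unfolding J_def
    proof (rule integral_mono[OF _ J_integrable[OF L]])
      show "integrable M (\<lambda>x. A x (grad \<phi> x) - lam * \<bar>\<phi> x\<bar> powr q)" using iA iq by auto
      fix x
      let ?s = "\<bar>\<phi> x\<bar>"
      have "?s powr \<gamma> / \<gamma> - ?s powr \<beta> / \<beta> \<le> ?s powr q"
      proof (cases "?s \<le> 1")
        case True
        have "?s powr \<gamma> / \<gamma> \<le> ?s powr \<beta> / \<beta>"
          using exps True by (intro frac_le powr_mono') auto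
        then show ?thesis by (smt (verit) powr_ge_zero)
      next
        case False
        obtain y where "y \<in> \<Omega>" using O_ne by blast
        then have "\<gamma> \<le> q" using exps_p p_le[of y] q_gt by fastforce
        have "?s powr \<gamma> / \<gamma> \<le> ?s powr \<gamma> / 1" using exps by (intro divide_left_mono) auto
        also have "\<dots> \<le> ?s powr q" using False \<open>\<gamma> \<le> q\<close> by (simp add: powr_mono)
        finally show ?thesis using exps by (smt (verit) divide_nonneg_nonneg powr_ge_zero)
      qed
      then have "lam * (?s powr \<gamma> / \<gamma> - ?s powr \<beta> / \<beta>) \<le> lam * ?s powr q" using lam by (intro mult_left_mono) auto
      then show "A x (grad \<phi> x) - lam * ?s powr q \<le> J_dens x (jet \<phi> x)"
        by (simp add: J_dens_def jet_def right_diff_distrib)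
    qed
    also have "(\<integral>x. A x (grad \<phi> x) - lam * \<bar>\<phi> x\<bar> powr q \<partial>M) = (\<integral>x. A x (grad \<phi> x) \<partial>M) - lam * (\<integral>x. \<bar>\<phi> x\<bar> powr q \<partial>M)"
      using iA iq by simp
    finally have 1: "(\<integral>x. A x (grad \<phi> x) \<partial>M) - lam * (\<integral>x. \<bar>\<phi> x\<bar> powr q \<partial>M) \<le> J (jet \<phi>)" .
    have "lam * (\<integral>x. \<bar>\<phi> x\<bar> powr q \<partial>M) \<le> lam * (C * m powr (q / P))" using q lam by (intro mult_left_mono) auto
    moreover have "gmod (jet \<phi>) / P \<le> (\<integral>x. A x (grad \<phi> x) \<partial>M)"
      using A_integral_lower[OF L] by (simp add: jet_def)
    ultimately show ?thesis using 1 by linarith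
  qed
  \<comment> \<open>A strict bound gmod U < m passes to the approximating jets, whereas gmod U
    itself need not bound theirs; hence the auxiliary m.\<close>
  have gen: "gmod U / P - lam * (C * m powr (q / P)) \<le> J U" if U: "U \<in> E" and m: "gmod U < m" "m \<le> 1" for U m
  proof -
    have m0: "0 < m" using m(1) gmod_nonneg[of U] by linarith
    obtain \<phi> where \<phi>: "\<And>n. test_fun \<Omega> (\<phi> n)" "mconv (\<lambda>n. jet (\<phi> n)) U" using E_obtain[OF U] by blast
    have ev: "\<forall>\<^sub>F n in sequentially. gmod (jet (\<phi> n)) < m"
      by (rule order_tendstoD(2)[OF gmod_tendsto[OF \<phi>(2)] m(1)])
    show ?thesis
    proof (rule tendsto_le[OF sequentially_bot J_tendsto[OF \<phi>(2)]])
      show "(\<lambda>n. gmod (jet (\<phi> n)) / P - lam * (C * m powr (q / P))) \<longlonglongrightarrow> gmod U / P - lam * (C * m powr (q / P))"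
        using P_ge1 by (intro tendsto_intros gmod_tendsto \<phi>(2)) auto
      show "\<forall>\<^sub>F n in sequentially. gmod (jet (\<phi> n)) / P - lam * (C * m powr (q / P)) \<le> J (jet (\<phi> n))"
        using ev by eventually_elim (intro test \<phi>(1) m0 m(2), simp)
    qed
  qed
  define s where "s = q / P - 1"
  have s: "s > 0" using q_gt P_ge1 by (simp add: s_def)
  \<comment> \<open>Up to \<open>m0\<close> the superlinear term is at most m / (4 P). With m = 2 *
    gmod U this leaves half of gmod U / P, so the sphere is taken at m0 / 2.\<close>
  define m0 where "m0 = min 1 ((1 / (4 * P * lam * C)) powr (1 / s))"
  have m0: "0 < m0" "m0 \<le> 1" using P_ge1 lam C(1) by (auto simp: m0_def)
  have small: "lam * (C * m powr (q / P)) \<le> m / (4 * P)" if m: "0 < m" "m \<le> m0" for m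
  proof -
    have "m powr s \<le> ((1 / (4 * P * lam * C)) powr (1 / s)) powr s"
      using m s by (intro powr_mono2) (auto simp: m0_def)
    also have "\<dots> = 1 / (4 * P * lam * C)" using s P_ge1 lam C(1) by (simp add: powr_powr)
    finally have "lam * C * (m * m powr s) \<le> lam * C * (m * (1 / (4 * P * lam * C)))"
      using m lam C(1) by (intro mult_left_mono) auto
    also have "\<dots> = m / (4 * P)" using lam C(1) P_ge1 by simp
    also have "m * m powr s = m powr (q / P)" using m by (simp add: s_def powr_diff)
    finally show ?thesis by (simp add: mult.assoc)
  qed
  have low: "gmod U / P - m / (4 * P) \<le> J U" if "U \<in> E" "gmod U < m" "m \<le> m0" for U m
    using gen[OF that(1,2)] small[of m] that m0 gmod_nonneg[of U] by linarith
  have half: "gmod U / (2 * P) \<le> J U" if U: "U \<in> E" "gmod U \<le> m0 / 2" for U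
  proof (cases "gmod U = 0")
    case False
    then have "0 < gmod U" using gmod_nonneg[of U] by linarith
    then have "gmod U / P - (2 * gmod U) / (4 * P) \<le> J U" using U by (intro low) auto
    then show ?thesis by (simp add: field_simps)
  next
    case True
    have "0 \<le> J U"
    proof (rule ccontr)
      assume "\<not> 0 \<le> J U"
      \<comment> \<open>For gmod U = 0 the choice m = 2 * gmod U degenerates; an m of the size of -J
        U gives J U \<ge> J U / 4, which is impossible for negative J U.\<close>
      define m where "m = min m0 (- J U * P)"
      have m: "0 < m" "m \<le> m0" "m \<le> - J U * P" using \<open>\<not> 0 \<le> J U\<close> m0 P_ge1 by (auto simp: m_def mult_less_0_iff)
      have "- (m / (4 * P)) \<le> J U" using low[OF U(1), of m] True m by simp
      moreover have "m / (4 * P) \<le> - J U / 4" using m(3) P_ge1 by (simp add: field_simps)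
      ultimately show False using \<open>\<not> 0 \<le> J U\<close> by linarith
    qed
    then show ?thesis using True by simp
  qed
  show thesis
  proof (rule that[of "m0 / 2" "m0 / (4 * P)"])
    show "0 < m0 / 2" "0 < m0 / (4 * P)" using m0 P_ge1 by auto
    show "m0 / (4 * P) \<le> J U" if "U \<in> E" "gmod U = m0 / 2" for U using half[of U] that by simp
    show "0 \<le> J U" if "U \<in> E" "gmod U \<le> m0 / 2" for U
    proof -
      have "0 \<le> gmod U / (2 * P)" using gmod_nonneg[of U] P_ge1 by simp
      then show ?thesis using half[OF that] by linarith
    qed
  qed
qed

end

section \<open>Orbits of the descent map and critical points\<close>

context leray_lions
begin

text \<open>Compactness gives convergence of the functions only; one more application of
  \<open>S\<close> turns it into convergence of the pairs. J takes the limit value at Y and at S Y,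
  so Y already minimises its own majorant. The conclusion is this minimality and not S Y = Y, since
  \<open>S\<close> involves a choice.\<close>

lemma orbit_limit:
  assumes X: "\<And>n. X n \<in> Ep" and step: "\<And>n. X (Suc n) = S (X n)"
  obtains Y where "Y \<in> Ep" "is_min (\<lambda>x. fst (Y x)) Y" "(\<lambda>n. J (X n)) \<longlonglongrightarrow> J Y"
proof -
  obtain C where C: "\<And>U. U \<in> E \<Longrightarrow> gmod U / (2 * P) - C \<le> J U" using J_coercive by blast
  have XE: "X n \<in> E" for n by (rule Ep_E[OF X])
  have dec: "J (X (Suc n)) \<le> J (X n)" for n unfolding step by (rule J_S_le[OF X])
  have decs: "decseq (\<lambda>n. J (X n))" using dec by (rule decseq_SucI)
  have J0: "J (X n) \<le> J (X 0)" for n using decs by (simp add: decseq_def)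
  have gm: "gmod (X n) \<le> 2 * P * (J (X 0) + C)" for n
  proof -
    have "gmod (X n) / (2 * P) \<le> J (X 0) + C" using C[OF XE[of n]] J0[of n] by linarith
    then show ?thesis using P_ge1 by (simp add: field_simps)
  qed
  have "- C \<le> J (X n)" for n
  proof -
    have "0 \<le> gmod (X n) / (2 * P)" using gmod_nonneg[of "X n"] P_ge1 by simp
    then show ?thesis using C[OF XE[of n]] by linarith
  qed
  then obtain c where c: "(\<lambda>n. J (X n)) \<longlonglongrightarrow> c"
    using decseq_convergent[OF decs, of "- C"] by blast
  obtain s u where s: "strict_mono (s::nat\<Rightarrow>nat)" and u: "mconv (\<lambda>n x. fst (X (s n) x)) u"
    using rellich[of X, OF XE gm] by blast
  have uL: "u \<in> Lp" using u by (simp add: mconv_def)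
  define Y where "Y = T u"
  have Y_min: "is_min u Y" unfolding Y_def by (rule T_min[OF uL])
  have YE: "Y \<in> E" using Y_min by (simp add: is_min_def)
  have Y: "Y \<in> Ep" unfolding Ep_def using YE min_nonneg[OF uL Y_min] by simp
  have m1: "mconv (\<lambda>n. X (Suc (s n))) Y"
    unfolding step S_def Y_def by (rule T_continuous[OF u])
  have m2: "mconv (\<lambda>n. X (Suc (Suc (s n)))) (S Y)"
    unfolding step[of "Suc _"] by (rule S_continuous[OF m1])
  have sub: "strict_mono (\<lambda>n. Suc (s n))" "strict_mono (\<lambda>n. Suc (Suc (s n)))"
    using s by (auto simp: strict_mono_def)
  have JY: "J Y = c"
    using LIMSEQ_unique[OF J_tendsto[OF m1]] LIMSEQ_subseq_LIMSEQ[OF c sub(1)] by (simp add: o_def)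
  have JSY: "J (S Y) = c"
    using LIMSEQ_unique[OF J_tendsto[OF m2]] LIMSEQ_subseq_LIMSEQ[OF c sub(2)] by (simp add: o_def)
  have SYL: "S Y \<in> Lp" by (intro E_Lp Ep_E S_Ep YE)
  have SY: "is_min (\<lambda>x. fst (Y x)) (S Y)" unfolding S_def by (rule T_min[OF fst_Lp[OF YE]])
  have "I (\<lambda>x. fst (Y x)) Y \<le> I (\<lambda>x. fst (Y x)) (S Y)"
    using J_le_I[OF Y SYL] J_eq_I[OF Y] JY JSY by linarith
  then have "is_min (\<lambda>x. fst (Y x)) Y"
    using SY YE unfolding is_min_def by (meson order_trans)
  with Y c show thesis using that JY by blast
qed

lemma S_iter_Ep: "U \<in> Ep \<Longrightarrow> (S ^^ n) U \<in> Ep"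
  by (induction n) (auto intro: S_Ep Ep_E)

text \<open>The whole segment from U to S U has energy below c0 and therefore misses the sphere,
  while a change of side would force it to meet the sphere by the intermediate value
  theorem.\<close>

lemma below_invariant:
  assumes barrier: "\<And>U. U \<in> E \<Longrightarrow> gmod U = \<rho> \<Longrightarrow> c0 \<le> J U"
    and U: "U \<in> Ep" "J U < c0"
  shows "gmod U < \<rho> \<longleftrightarrow> gmod (S U) < \<rho>"
proof (rule ccontr)
  assume neq: "\<not> (gmod U < \<rho> \<longleftrightarrow> gmod (S U) < \<rho>)"
  have UE: "U \<in> E" and SE: "S U \<in> E" using U(1) Ep_E S_Ep by auto
  let ?g = "\<lambda>t. gmod (\<lambda>x. U x + t *\<^sub>R (S U x - U x))"
  have c: "continuous_on {0..1} ?g" by (rule segment_continuous) (intro E_Lp E_diff UE SE)+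
  have "\<exists>t. 0 \<le> t \<and> t \<le> 1 \<and> ?g t = \<rho>"
  proof (cases "gmod U < \<rho>")
    case True
    then show ?thesis using neq IVT'[of ?g 0 \<rho> 1, OF _ _ _ c] by auto
  next
    case False
    then show ?thesis using neq IVT2'[of ?g 1 \<rho> 0, OF _ _ _ c] by auto
  qed
  then obtain t where t: "0 \<le> t" "t \<le> 1" "?g t = \<rho>" by blast
  have "c0 \<le> J (\<lambda>x. U x + t *\<^sub>R (S U x - U x))"
    by (rule barrier[OF _ t(3)]) (intro E_add E_scale E_diff UE SE)
  also have "\<dots> \<le> J U" by (rule J_segment[OF U(1) t(1,2)])
  finally show False using U(2) by simp
qed

text \<open>A path from \<open>0\<close> to a point of negative energy cannot be covered by the two disjoint
  relatively open sets of parameters whose orbits fall below the level \<open>c0\<close> inside,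
  respectively outside, the barrier sphere.\<close>

lemma mountain_pass:
  assumes w: "w \<in> Ep" "J w < 0"
  obtains Y where "Y \<in> Ep" "is_min (\<lambda>x. fst (Y x)) Y" "0 < J Y"
proof -
  obtain \<rho> c0 where \<rho>: "0 < \<rho>" and c0: "0 < c0"
    and barrier: "\<And>U. U \<in> E \<Longrightarrow> gmod U = \<rho> \<Longrightarrow> c0 \<le> J U"
    and inside: "\<And>U. U \<in> E \<Longrightarrow> gmod U \<le> \<rho> \<Longrightarrow> 0 \<le> J U"
    using barrier by metis
  have wE: "w \<in> E" by (rule Ep_E[OF w(1)])
  define X where "X = (\<lambda>t n. (S ^^ n) (\<lambda>x. t *\<^sub>R w x))"
  have X0: "(\<lambda>x. t *\<^sub>R w x) \<in> Ep" if "t \<in> {0..1}" for t :: real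
    unfolding Ep_def using E_scale[OF wE, of t] Ep_AE[OF w(1)] that by auto
  have XEp: "X t n \<in> Ep" if "t \<in> {0..1}" for t n
    unfolding X_def by (rule S_iter_Ep[OF X0[OF that]])
  have Xstep: "X t (Suc n) = S (X t n)" for t n by (simp add: X_def)
  \<comment> \<open>For each fixed n the iterate depends continuously on the parameter. Uniformity
    in n does not matter, because the two open sets are unions over n.\<close>
  have Xc: "mconv (\<lambda>j. X (f j) n) (X t n)" if "f \<longlonglongrightarrow> t" for f t n
  proof (induction n)
    case 0
    have z: "(\<lambda>x. 0 :: real \<times> 'a) \<in> Lp" by (rule E_Lp[OF E_zero])
    show ?case using mconv_perturb[OF z E_Lp[OF wE] that] by (simp add: X_def)
  next
    case (Suc n)
    then show ?case unfolding Xstep by (rule S_continuous)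
  qed
  have Jc: "continuous_on {0..1} (\<lambda>t. J (X t n))" and gc: "continuous_on {0..1} (\<lambda>t. gmod (X t n))" for n
    unfolding continuous_on_sequentially comp_def using J_tendsto[OF Xc] gmod_tendsto[OF Xc] by auto
  define Bi where "Bi = (\<lambda>n. {0..1} \<inter> (\<lambda>t. J (X t n)) -` {..<c0} \<inter> ({0..1} \<inter> (\<lambda>t. gmod (X t n)) -` {..<\<rho>}))"
  define Bo where "Bo = (\<lambda>n. {0..1} \<inter> (\<lambda>t. J (X t n)) -` {..<c0} \<inter> ({0..1} \<inter> (\<lambda>t. gmod (X t n)) -` {\<rho><..}))"
  have op: "openin (top_of_set {0..1}) (\<Union>n. Bi n)" "openin (top_of_set {0..1}) (\<Union>n. Bo n)"
    unfolding Bi_def Bo_def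
    by (intro openin_Union ballI; auto intro!: openin_Int continuous_openin_preimage_gen Jc gc)+
  have Jdec: "J (X t n) \<le> J (X t m)" if t: "t \<in> {0..1}" and "m \<le> n" for t m n
  proof -
    have "decseq (\<lambda>n. J (X t n))" by (rule decseq_SucI) (simp add: Xstep J_S_le[OF XEp[OF t]])
    then show ?thesis using that(2) by (simp add: decseq_def)
  qed
  have stay: "gmod (X t n) < \<rho> \<longleftrightarrow> gmod (X t m) < \<rho>"
    if t: "t \<in> {0..1}" and m: "J (X t m) < c0" and mn: "m \<le> n" for t m n
    using mn
  proof (induction n rule: dec_induct)
    case (step n)
    have "J (X t n) < c0" using Jdec[OF t step.hyps(1)] m by linarith
    then have "gmod (X t n) < \<rho> \<longleftrightarrow> gmod (X t (Suc n)) < \<rho>"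
      unfolding Xstep using below_invariant[OF barrier XEp[OF t]] by blast
    then show ?case using step.IH by blast
  qed simp
  have disj: "(\<Union>n. Bi n) \<inter> (\<Union>n. Bo n) = {}"
  proof (rule ccontr)
    assume "(\<Union>n. Bi n) \<inter> (\<Union>n. Bo n) \<noteq> {}"
    then obtain t m n where "t \<in> Bi m" "t \<in> Bo n" by blast
    then have t: "t \<in> {0..1}" "J (X t m) < c0" "gmod (X t m) < \<rho>" "J (X t n) < c0" "\<rho> < gmod (X t n)"
      by (auto simp: Bi_def Bo_def)
    show False
    proof (cases "m \<le> n")
      case True
      then have "gmod (X t n) < \<rho>" using stay[OF t(1,2)] t(3) by blast
      then show False using t(5) by linarith
    next
      case False
      then have "gmod (X t n) < \<rho>" using stay[OF t(1,4), of m] t(3) by auto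
      then show False using t(5) by linarith
    qed
  qed
  have "0 \<in> Bi 0"
    using c0 \<rho> J_zero p_ge1 by (auto simp: Bi_def X_def gmod_def pmod_def)
  moreover have "1 \<in> Bo 0"
  proof -
    \<comment> \<open>Within the closed barrier ball the energy is nonnegative, so negative energy
      places w outside.\<close>
    have "\<not> gmod w \<le> \<rho>" using inside[OF wE] w(2) by linarith
    then show ?thesis using w(2) c0 by (simp add: Bo_def X_def)
  qed
  ultimately have ne: "(\<Union>n. Bi n) \<noteq> {}" "(\<Union>n. Bo n) \<noteq> {}" by blast+
  have "\<not> {0..1} \<subseteq> (\<Union>n. Bi n) \<union> (\<Union>n. Bo n)"
  proof
    assume "{0..1} \<subseteq> (\<Union>n. Bi n) \<union> (\<Union>n. Bo n)"
    then have "\<exists>E1 E2. openin (top_of_set {0..1::real}) E1 \<and> openin (top_of_set {0..1}) E2 \<and>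
        {0..1} \<subseteq> E1 \<union> E2 \<and> E1 \<inter> E2 = {} \<and> E1 \<noteq> {} \<and> E2 \<noteq> {}"
      using op disj ne by (intro exI conjI)
    with connected_Icc[of "0::real" 1] show False unfolding connected_openin by (rule notE)
  qed
  then obtain t where "t \<in> {0..1}" "t \<notin> (\<Union>n. Bi n) \<union> (\<Union>n. Bo n)" by (meson subsetI)
  then have t: "t \<in> {0..1}" "t \<notin> Bi n" "t \<notin> Bo n" for n by auto
  \<comment> \<open>For the uncovered parameter, an iterate with energy below c0 would have to lie
    exactly on the sphere, where the barrier forbids it.\<close>
  have high: "c0 \<le> J (X t n)" for n
  proof (rule ccontr)
    assume "\<not> c0 \<le> J (X t n)"
    then have J: "J (X t n) < c0" by simp
    then have "\<not> gmod (X t n) < \<rho>" "\<not> \<rho> < gmod (X t n)"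
      using t(1) t(2)[of n] t(3)[of n] by (auto simp: Bi_def Bo_def)
    then have "gmod (X t n) = \<rho>" by linarith
    then show False using barrier[OF Ep_E[OF XEp[OF t(1)]]] J by fastforce
  qed
  obtain Y where Y: "Y \<in> Ep" "is_min (\<lambda>x. fst (Y x)) Y" "(\<lambda>n. J (X t n)) \<longlonglongrightarrow> J Y"
    using orbit_limit[of "X t", OF XEp[OF t(1)] Xstep] by blast
  have "c0 \<le> J Y" using Y(3) high by (intro LIMSEQ_le_const) auto
  then show thesis using Y(1,2) c0 by (intro that) auto
qed

lemma weak_solution_of_min:
  assumes Y: "Y \<in> Ep" and m: "is_min (\<lambda>x. fst (Y x)) Y"
  shows "weak_solution p \<Omega> a lam \<gamma> \<beta> (\<lambda>x. fst (Y x))"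
proof -
  let ?u = "\<lambda>x. fst (Y x)" and ?G = "\<lambda>x. snd (Y x)"
  have YE: "Y \<in> E" by (rule Ep_E[OF Y])
  note uL = fst_Lp[OF YE]
  note [measurable] = LpD[OF uL]
  have "integrable M (\<lambda>x. a x (?G x) \<bullet> H x) \<and>
          integrable M (\<lambda>x. ?u x powr (\<gamma> - 1) * \<phi> x) \<and>
          integrable M (\<lambda>x. ?u x powr (\<beta> - 1) * \<phi> x) \<and>
          integral\<^sup>L M (\<lambda>x. a x (?G x) \<bullet> H x)
           - lam * integral\<^sup>L M (\<lambda>x. ?u x powr (\<gamma> - 1) * \<phi> x)
           + lam * integral\<^sup>L M (\<lambda>x. ?u x powr (\<beta> - 1) * \<phi> x) = 0" if "in_E p \<Omega> \<phi> H" for \<phi> H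
  proof -
    have W: "(\<lambda>x. (\<phi> x, H x)) \<in> E" using that by (simp add: in_E_iff)
    have \<phi>: "\<phi> \<in> Lp" and H: "H \<in> Lp" using Lp_PairD[OF E_Lp[OF W]] by auto
    note [measurable] = LpD[OF \<phi>] LpD[OF H]
    have i1: "integrable M (\<lambda>x. a x (?G x) \<bullet> H x)"
      using growth_integrable[OF growth_a Lp_Pair(1)[OF Lp_snd(1)[OF E_Lp[OF YE]] H]] by simp
    have i2': "integrable M (\<lambda>x. \<bar>?u x\<bar> powr (\<gamma> - 1) * \<phi> x)"
      using growth_integrable[OF growth_gamma_prod Lp_Pair(1)[OF uL \<phi>]] by simp
    have i3': "integrable M (\<lambda>x. spow (\<beta> - 1) (?u x) * \<phi> x)"
      using growth_integrable[OF growth_spow_prod Lp_Pair(1)[OF uL \<phi>]] by simp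
    have e2: "AE x in M. \<bar>?u x\<bar> powr (\<gamma> - 1) * \<phi> x = ?u x powr (\<gamma> - 1) * \<phi> x"
      using Ep_AE[OF Y] by eventually_elim simp
    have e3: "AE x in M. spow (\<beta> - 1) (?u x) * \<phi> x = ?u x powr (\<beta> - 1) * \<phi> x"
      using Ep_AE[OF Y] by eventually_elim (simp add: spow_nonneg)
    have m2: "(\<lambda>x. ?u x powr (\<gamma> - 1) * \<phi> x) \<in> borel_measurable M" "(\<lambda>x. ?u x powr (\<beta> - 1) * \<phi> x) \<in> borel_measurable M"
      by measurable
    have i2: "integrable M (\<lambda>x. ?u x powr (\<gamma> - 1) * \<phi> x)"
      by (rule integrable_cong_AE_imp[OF i2' m2(1) e2])
    have i3: "integrable M (\<lambda>x. ?u x powr (\<beta> - 1) * \<phi> x)"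
      by (rule integrable_cong_AE_imp[OF i3' m2(2) e3])
    have q2: "integral\<^sup>L M (\<lambda>x. \<bar>?u x\<bar> powr (\<gamma> - 1) * \<phi> x) = integral\<^sup>L M (\<lambda>x. ?u x powr (\<gamma> - 1) * \<phi> x)"
      by (rule integral_cong_AE[OF borel_measurable_integrable[OF i2'] m2(1) e2])
    have q3: "integral\<^sup>L M (\<lambda>x. spow (\<beta> - 1) (?u x) * \<phi> x) = integral\<^sup>L M (\<lambda>x. ?u x powr (\<beta> - 1) * \<phi> x)"
      by (rule integral_cong_AE[OF borel_measurable_integrable[OF i3'] m2(2) e3])
    have "0 = dI ?u Y (\<lambda>x. (\<phi> x, H x))" by (rule euler_lagrange[OF uL m W, symmetric])
    also have "\<dots> = integral\<^sup>L M (\<lambda>x. a x (?G x) \<bullet> H x) + lam * integral\<^sup>L M (\<lambda>x. spow (\<beta> - 1) (?u x) * \<phi> x)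
        - lam * integral\<^sup>L M (\<lambda>x. \<bar>?u x\<bar> powr (\<gamma> - 1) * \<phi> x)"
      unfolding dI_def dI_dens_def using i1 i2' i3' by simp
    finally show ?thesis using i1 i2 i3 unfolding q2 q3 by linarith
  qed
  moreover have "in_E p \<Omega> ?u ?G" using YE by (simp add: in_E_iff)
  ultimately show ?thesis unfolding weak_solution_def using Ep_AE[OF Y] by blast
qed

lemma I_cong_AE:
  assumes "AE x in M. u x = v x" "u \<in> Lp" "v \<in> Lp" "V \<in> Lp"
  shows "I u V = I v V"
  unfolding I_def
proof (rule integral_cong_AE)
  show "AE x in M. I_dens x (V x, u x) = I_dens x (V x, v x)"
    using assms(1) by eventually_elim simp
qed (use I_integrable assms in auto)

text \<open>Distinctness is obtained without comparing gradients: if the functions agreed, both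
  would define the same majorant, and minimality of Y against the competitor Z would give J Y \<le>
  J Z, contradicting J Z < 0 < J Y.\<close>

lemma two_solutions:
  assumes w: "w \<in> Ep" "J w < 0"
  shows "\<exists>u1 u2. weak_solution p \<Omega> a lam \<gamma> \<beta> u1 \<and> weak_solution p \<Omega> a lam \<gamma> \<beta> u2 \<and>
           \<not> (AE x in M. u1 x = u2 x) \<and> \<not> (AE x in M. u1 x = 0) \<and> \<not> (AE x in M. u2 x = 0)"
proof -
  obtain Y where Y: "Y \<in> Ep" "is_min (\<lambda>x. fst (Y x)) Y" "0 < J Y"
    using mountain_pass[OF w] by blast
  define X where "X = (\<lambda>n. (S ^^ n) w)"
  have X: "X n \<in> Ep" "X (Suc n) = S (X n)" for n unfolding X_def using S_iter_Ep[OF w(1)] by auto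
  obtain Z where Z: "Z \<in> Ep" "is_min (\<lambda>x. fst (Z x)) Z" "(\<lambda>n. J (X n)) \<longlonglongrightarrow> J Z"
    using orbit_limit[of X, OF X] by blast
  have "J (X n) \<le> J w" for n
    by (induction n) (auto simp: X_def intro: order_trans[OF J_S_le[OF S_iter_Ep[OF w(1)]]])
  then have "J Z \<le> J w" using Z(3) by (intro LIMSEQ_le_const2) auto
  then have JZ: "J Z < 0" using w(2) by linarith
  note YE = Ep_E[OF Y(1)] and ZE = Ep_E[OF Z(1)]
  have ne: "\<not> (AE x in M. fst (Z x) = fst (Y x))"
  proof
    assume eq: "AE x in M. fst (Z x) = fst (Y x)"
    have I_eq: "I (\<lambda>x. fst (Z x)) V = I (\<lambda>x. fst (Y x)) V" if "V \<in> E" for V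
      by (rule I_cong_AE[OF eq fst_Lp[OF ZE] fst_Lp[OF YE] E_Lp[OF that]])
    have kap_eq: "kap (\<lambda>x. fst (Z x)) = kap (\<lambda>x. fst (Y x))"
    proof -
      have "(\<integral>x. \<bar>fst (Z x)\<bar> powr \<gamma> \<partial>M) = (\<integral>x. \<bar>fst (Y x)\<bar> powr \<gamma> \<partial>M)"
      proof (rule integral_cong_AE)
        show "AE x in M. \<bar>fst (Z x)\<bar> powr \<gamma> = \<bar>fst (Y x)\<bar> powr \<gamma>" using eq by eventually_elim simp
      qed (use growth_integrable[OF growth_gamma E_Lp[OF ZE]] growth_integrable[OF growth_gamma E_Lp[OF YE]] in auto)
      then show ?thesis by (simp add: kap_def)
    qed
    have "I (\<lambda>x. fst (Y x)) Y \<le> I (\<lambda>x. fst (Y x)) Z" using Y(2) ZE by (simp add: is_min_def)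
    then have "J Y \<le> J Z" using J_eq_I[OF Y(1)] J_eq_I[OF Z(1)] I_eq[OF ZE] kap_eq by linarith
    then show False using Y(3) JZ by linarith
  qed
  have nZ: "\<not> (AE x in M. fst (Z x) = 0)"
  proof
    assume z: "AE x in M. fst (Z x) = 0"
    have "0 \<le> J Z"
      unfolding J_def
    proof (rule integral_nonneg_AE)
      show "AE x in M. 0 \<le> J_dens x (Z x)"
        using z AE_space by eventually_elim (simp add: J_dens_def A_nonneg)
    qed
    then show False using JZ by linarith
  qed
  \<comment> \<open>The gradient component of Y is not known to vanish, so Y is compared with 0 in
    its own majorant, whose constant part is then 0.\<close>
  have nY: "\<not> (AE x in M. fst (Y x) = 0)"
  proof
    assume z: "AE x in M. fst (Y x) = 0"
    have "I (\<lambda>x. fst (Y x)) (\<lambda>x. 0) = (\<integral>x. 0 \<partial>M)"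
      unfolding I_def by (rule Bochner_Integration.integral_cong) (auto simp: I_dens_def A_zero)
    then have "I (\<lambda>x. fst (Y x)) Y \<le> 0" using Y(2) E_zero by (fastforce simp: is_min_def)
    moreover have "kap (\<lambda>x. fst (Y x)) = 0"
    proof -
      have "(\<integral>x. \<bar>fst (Y x)\<bar> powr \<gamma> \<partial>M) = (\<integral>x. 0 \<partial>M)"
      proof (rule integral_cong_AE)
        show "AE x in M. \<bar>fst (Y x)\<bar> powr \<gamma> = 0" using z by eventually_elim simp
      qed (use growth_integrable[OF growth_gamma E_Lp[OF YE]] in auto)
      then show ?thesis by (simp add: kap_def)
    qed
    ultimately show False using J_eq_I[OF Y(1)] Y(3) by linarith
  qed
  show ?thesis
    using weak_solution_of_min[OF Z(1,2)] weak_solution_of_min[OF Y(1,2)] ne nZ nY by blast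
qed

end

section \<open>Structural assumptions derived from the hypotheses on A and a\<close>

lemma monotone_gradient_tangent:
  fixes A :: "'a::euclidean_space \<Rightarrow> real" and a :: "'a \<Rightarrow> 'a"
  assumes d: "\<And>\<xi>. (A has_derivative (\<lambda>h. a \<xi> \<bullet> h)) (at \<xi>)"
    and mono: "\<And>\<xi> \<psi>. 0 \<le> (a \<xi> - a \<psi>) \<bullet> (\<xi> - \<psi>)"
  shows "A \<xi> + a \<xi> \<bullet> (\<psi> - \<xi>) \<le> A \<psi>"
proof -
  define f where "f = (\<lambda>t. A (\<xi> + t *\<^sub>R (\<psi> - \<xi>)))"
  have f: "(f has_real_derivative a (\<xi> + t *\<^sub>R (\<psi> - \<xi>)) \<bullet> (\<psi> - \<xi>)) (at t)" for t
  proof -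
    have "(f has_derivative (\<lambda>k. a (\<xi> + t *\<^sub>R (\<psi> - \<xi>)) \<bullet> (k *\<^sub>R (\<psi> - \<xi>)))) (at t)"
      unfolding f_def
      by (rule has_derivative_compose[where g=A and f="\<lambda>t. \<xi> + t *\<^sub>R (\<psi> - \<xi>)", OF _ d])
        (auto intro!: derivative_eq_intros)
    then show ?thesis by (simp add: has_field_derivative_def mult_commute_abs)
  qed
  obtain t where t: "0 < t" "t < 1" "f 1 - f 0 = (1 - 0) * (a (\<xi> + t *\<^sub>R (\<psi> - \<xi>)) \<bullet> (\<psi> - \<xi>))"
    using MVT2[of 0 1 f "\<lambda>t. a (\<xi> + t *\<^sub>R (\<psi> - \<xi>)) \<bullet> (\<psi> - \<xi>)"] f by auto
  \<comment> \<open>Monotonicity between the intermediate point and \<xi>: their difference is t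
    times the direction, and t > 0 can be divided out.\<close>
  have "0 \<le> t * ((a (\<xi> + t *\<^sub>R (\<psi> - \<xi>)) - a \<xi>) \<bullet> (\<psi> - \<xi>))"
    using mono[of "\<xi> + t *\<^sub>R (\<psi> - \<xi>)" \<xi>] by simp
  then have "0 \<le> (a (\<xi> + t *\<^sub>R (\<psi> - \<xi>)) - a \<xi>) \<bullet> (\<psi> - \<xi>)"
    using t(1) by (simp add: zero_le_mult_iff)
  then show ?thesis using t(3) by (simp add: f_def inner_diff_left)
qed

text \<open>Joint continuity is given for \<open>a\<close> only. It passes to A through the
  representation of A x \<xi> as the integral of a x (t \<xi>) \<bullet> \<xi> over t in [0, 1],
  which uses A x 0 = 0.\<close>

lemma potential_continuous:
  fixes A :: "'a::euclidean_space \<Rightarrow> 'a \<Rightarrow> real" and a :: "'a \<Rightarrow> 'a \<Rightarrow> 'a"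
  assumes d: "\<And>x \<xi>. x \<in> X \<Longrightarrow> (A x has_derivative (\<lambda>h. a x \<xi> \<bullet> h)) (at \<xi>)"
    and z: "\<And>x. x \<in> X \<Longrightarrow> A x 0 = 0"
    and c: "continuous_on (X \<times> UNIV) (\<lambda>(x, \<xi>). a x \<xi>)"
  shows "continuous_on (X \<times> UNIV) (\<lambda>(x, \<xi>). A x \<xi>)"
proof -
  let ?f = "\<lambda>z t. a (fst z) (t *\<^sub>R snd z) \<bullet> snd z"
  have "continuous_on ((X \<times> UNIV) \<times> cbox 0 1) (\<lambda>w :: ('a \<times> 'a) \<times> real. (\<lambda>(x, \<xi>). a x \<xi>) (fst (fst w), snd w *\<^sub>R snd (fst w)))"
    by (rule continuous_on_compose2[OF c]) (auto intro!: continuous_intros)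
  then have "continuous_on ((X \<times> UNIV) \<times> cbox 0 1) (\<lambda>(z, t). ?f z t)"
    by (auto simp: case_prod_beta' intro!: continuous_intros)
  then have 1: "continuous_on (X \<times> UNIV) (\<lambda>z. integral (cbox 0 1) (?f z))"
    by (rule integral_continuous_on_param)
  have 2: "integral (cbox 0 1) (?f z) = A (fst z) (snd z)" if "z \<in> X \<times> UNIV" for z
  proof -
    have x: "fst z \<in> X" using that by auto
    have "((\<lambda>t. A (fst z) (t *\<^sub>R snd z)) has_vector_derivative ?f z t) (at t within {0..1})" for t :: real
    proof -
      have "((\<lambda>t. A (fst z) (t *\<^sub>R snd z)) has_derivative (\<lambda>k. a (fst z) (t *\<^sub>R snd z) \<bullet> (k *\<^sub>R snd z))) (at t)"
        by (rule has_derivative_compose[where g="A (fst z)" and f="\<lambda>t. t *\<^sub>R snd z", OF _ d[OF x]])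
          (auto intro!: derivative_eq_intros)
      then have "((\<lambda>t. A (fst z) (t *\<^sub>R snd z)) has_derivative (\<lambda>k. k *\<^sub>R ?f z t)) (at t)" by simp
      then show ?thesis unfolding has_vector_derivative_def by (rule has_derivative_at_withinI)
    qed
    then have "(?f z has_integral A (fst z) (1 *\<^sub>R snd z) - A (fst z) (0 *\<^sub>R snd z)) {0..1}"
      by (intro fundamental_theorem_of_calculus) auto
    then show ?thesis using z[OF x] by (simp add: integral_unique)
  qed
  have "continuous_on (X \<times> UNIV) (\<lambda>z. A (fst z) (snd z))"
    using 1 by (rule continuous_on_eq) (rule 2)
  then show ?thesis by (simp add: case_prod_beta')
qed

section \<open>A test function of negative energy\<close>

lemma (in leray_lions) J_jet:
  assumes t: "test_fun \<Omega> \<phi>"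
  shows "J (jet \<phi>) = (\<integral>x. A x (grad \<phi> x) \<partial>M) + lam / \<beta> * (\<integral>x. \<bar>\<phi> x\<bar> powr \<beta> \<partial>M) - lam / \<gamma> * (\<integral>x. \<bar>\<phi> x\<bar> powr \<gamma> \<partial>M)"
  using growth_integrable[OF growth_A_snd test_Lp(3)[OF t]] growth_integrable[OF growth_beta test_Lp(3)[OF t]]
    growth_integrable[OF growth_gamma test_Lp(3)[OF t]]
  unfolding J_def J_dens_def by (simp add: jet_def)

lemma (in sobolev_setting) integral_powr_pos:
  assumes b: "test_fun \<Omega> b" "\<And>x. 0 \<le> b x" and e: "e > 0" "ball x0 e \<subseteq> \<Omega>" "\<And>x. x \<in> ball x0 e \<Longrightarrow> 0 < b x"
    and s: "0 < s" "\<And>x. x \<in> \<Omega> \<Longrightarrow> s \<le> p x"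
  shows "0 < (\<integral>x. \<bar>b x\<bar> powr s \<partial>M)"
proof -
  have int: "integrable M (\<lambda>x. \<bar>b x\<bar> powr s)"
    using growth_integrable[OF growth_fst_powr[OF less_imp_le[OF s(1)] s(2) s(1)] test_Lp(3)[OF b(1)]] by (simp add: jet_def)
  have "(\<integral>x. \<bar>b x\<bar> powr s \<partial>M) \<noteq> 0"
  proof
    assume "(\<integral>x. \<bar>b x\<bar> powr s \<partial>M) = 0"
    then have "AE x in M. \<bar>b x\<bar> powr s = 0"
      using int by (subst (asm) integral_nonneg_eq_0_iff_AE) auto
    then have "AE x in lebesgue. x \<in> \<Omega> \<longrightarrow> \<bar>b x\<bar> powr s = 0"
      by (subst (asm) AE_restrict_space_iff) auto
    then have "AE x in lebesgue. x \<notin> ball x0 e"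
      by eventually_elim (use e(2,3) in force)
    then have "ball x0 e \<in> null_sets lebesgue"
      by (subst (asm) AE_iff_null_sets[symmetric]) auto
    then have "measure lebesgue (ball x0 e) = 0" by (auto simp: null_sets_def measure_def)
    then show False using content_ball_pos[OF e(1), of x0] by simp
  qed
  moreover have "0 \<le> (\<integral>x. \<bar>b x\<bar> powr s \<partial>M)" by (rule integral_nonneg_AE) simp
  ultimately show ?thesis by linarith
qed

lemma exists_positive_scale:
  fixes Bb Bg \<beta> \<gamma> :: real
  assumes "0 < \<beta>" "\<beta> < \<gamma>" "0 < Bb" "0 < Bg"
  obtains c where "c > 0" "0 < c powr \<gamma> / \<gamma> * Bg - c powr \<beta> / \<beta> * Bb"
proof -
  \<comment> \<open>At c powr (\<gamma> - \<beta>) = X the two terms are equal; X + 1 leaves the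
    surplus c powr \<beta> * Bg / \<gamma>.\<close>
  define X where "X = \<gamma> * Bb / (\<beta> * Bg)"
  define c where "c = (X + 1) powr (1 / (\<gamma> - \<beta>))"
  have X: "X > 0" using assms by (simp add: X_def)
  have c: "c > 0" using X by (simp add: c_def)
  have "c powr \<gamma> = c powr \<beta> * c powr (\<gamma> - \<beta>)" using c by (simp flip: powr_add)
  also have "c powr (\<gamma> - \<beta>) = X + 1" using X assms by (simp add: c_def powr_powr)
  finally have "c powr \<gamma> / \<gamma> * Bg - c powr \<beta> / \<beta> * Bb = c powr \<beta> * ((X + 1) / \<gamma> * Bg - Bb / \<beta>)"
    by (simp add: algebra_simps)
  also have "(X + 1) / \<gamma> * Bg - Bb / \<beta> = Bg / \<gamma>"
    using assms by (simp add: X_def field_simps)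
  finally show thesis using c assms by (intro that[of c]) auto
qed

theorem theorem1:
  fixes \<Omega> :: "'a::euclidean_space set"
    and p :: "'a \<Rightarrow> real"
    and A :: "'a \<Rightarrow> 'a \<Rightarrow> real"
    and a :: "'a \<Rightarrow> 'a \<Rightarrow> 'a"
    and \<alpha> \<beta> \<gamma> :: real
  assumes dim: "DIM('a) \<ge> 3"
    and dom: "smooth_bounded_domain \<Omega>"
    and alpha: "0 < \<alpha>" "\<alpha> < 1"
    and p_holder: "holder_on \<alpha> (closure \<Omega>) p"
    and p_gt1: "\<forall>x\<in>closure \<Omega>. p x > 1"
    and exps: "1 < \<beta>" "\<beta> < \<gamma>" "\<gamma> < Inf (p ` \<Omega>)"
    and a_deriv: "\<forall>x\<in>closure \<Omega>. \<forall>\<xi>. (A x has_derivative (\<lambda>h. a x \<xi> \<bullet> h)) (at \<xi>)"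
    and a_cont: "continuous_on (closure \<Omega> \<times> UNIV) (\<lambda>(x, \<xi>). a x \<xi>)"
    and A1: "\<forall>x\<in>closure \<Omega>. A x 0 = 0"
    and A2: "\<exists>c1>0. \<forall>x\<in>closure \<Omega>. \<forall>\<xi>. norm (a x \<xi>) \<le> c1 * (1 + norm \<xi> powr (p x - 1))"
    and A3: "\<forall>x\<in>closure \<Omega>. \<forall>\<xi> \<psi>. 0 \<le> (a x \<xi> - a x \<psi>) \<bullet> (\<xi> - \<psi>) \<and>
                 ((a x \<xi> - a x \<psi>) \<bullet> (\<xi> - \<psi>) = 0 \<longleftrightarrow> \<xi> = \<psi>)"
    and A4: "\<exists>k>0. \<forall>x\<in>closure \<Omega>. \<forall>\<xi> \<psi>.
                 A x ((\<xi> + \<psi>) /\<^sub>R 2) \<le> A x \<xi> / 2 + A x \<psi> / 2 - k * norm (\<xi> - \<psi>) powr p x"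
    and A5: "\<forall>x\<in>closure \<Omega>. \<forall>\<xi>. norm \<xi> powr p x \<le> a x \<xi> \<bullet> \<xi> \<and> a x \<xi> \<bullet> \<xi> \<le> p x * A x \<xi>"
    and growth: "Sup (p ` \<Omega>) < min (real DIM('a))
                   (real DIM('a) * Inf (p ` \<Omega>) / (real DIM('a) - Inf (p ` \<Omega>)))"
  shows "\<exists>lam_s>0. \<forall>lam>lam_s. \<exists>u1 u2.
           weak_solution p \<Omega> a lam \<gamma> \<beta> u1 \<and> weak_solution p \<Omega> a lam \<gamma> \<beta> u2 \<and>
           \<not> (AE x in lebesgue_on \<Omega>. u1 x = u2 x) \<and>
           \<not> (AE x in lebesgue_on \<Omega>. u1 x = 0) \<and>
           \<not> (AE x in lebesgue_on \<Omega>. u2 x = 0)"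
proof -
  define r where "r = Inf (p ` \<Omega>)"
  define P where "P = Sup (p ` \<Omega>)"
  define crit where "crit = real DIM('a) * r / (real DIM('a) - r)"
  \<comment> \<open>The midpoint of an interval that is nonempty by the growth assumption; any
    interior point would serve.\<close>
  define q where "q = (P + crit) / 2"
  have O: "open \<Omega>" "bounded \<Omega>" "\<Omega> \<noteq> {}" using dom by (auto simp: smooth_bounded_domain_def)
  have sub: "\<Omega> \<subseteq> closure \<Omega>" by (rule closure_subset)
  \<comment> \<open>Continuity on the compact closure makes p bounded, so that Inf and Sup over the
    domain are genuine bounds for p.\<close>
  have p_cont: "continuous_on (closure \<Omega>) p"
  proof -
    obtain C where C: "\<And>x y. x \<in> closure \<Omega> \<Longrightarrow> y \<in> closure \<Omega> \<Longrightarrow> \<bar>p x - p y\<bar> \<le> C * dist x y powr \<alpha>"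
      using p_holder unfolding holder_on_def by blast
    have "(p \<longlongrightarrow> p x) (at x within closure \<Omega>)" if x: "x \<in> closure \<Omega>" for x
    proof -
      have "((\<lambda>y. C * dist y x powr \<alpha>) \<longlongrightarrow> C * dist x x powr \<alpha>) (at x within closure \<Omega>)"
        using alpha by (intro tendsto_intros tendsto_powr') auto
      then have "((\<lambda>y. C * dist y x powr \<alpha>) \<longlongrightarrow> 0) (at x within closure \<Omega>)" using alpha by simp
      then have "((\<lambda>y. p y - p x) \<longlongrightarrow> 0) (at x within closure \<Omega>)"
        by (rule Lim_null_comparison[rotated])
          (use C[OF _ x] in \<open>auto simp: eventually_at_filter\<close>)
      then show ?thesis by (simp add: LIM_zero_iff)
    qed
    then show ?thesis unfolding continuous_on_def by blast
  qed
  have "bounded (p ` closure \<Omega>)"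
    using O(2) p_cont by (intro compact_imp_bounded compact_continuous_image) auto
  then have bd: "bounded (p ` \<Omega>)" by (rule bounded_subset) (use sub in auto)
  have p_bounds: "r \<le> p x" "p x \<le> P" if "x \<in> \<Omega>" for x
    unfolding r_def P_def using that bd
    by (auto intro!: cInf_lower cSup_upper bounded_imp_bdd_below bounded_imp_bdd_above)
  obtain x1 where x1: "x1 \<in> \<Omega>" using O(3) by blast
  have r: "1 \<le> r" "\<gamma> < r" "r \<le> P" using exps p_bounds[OF x1] by (auto simp: r_def)
  have PN: "P < DIM('a)" "P < crit" using growth by (auto simp: P_def r_def crit_def)
  have q: "P < q" "q < crit" using PN(2) by (auto simp: q_def)
  obtain R where R: "R > 0" "\<Omega> \<subseteq> ball 0 R"
    using O(2) bounded_subset_ballD by blast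
  obtain c1 where c1: "c1 > 0" "\<And>x \<xi>. x \<in> closure \<Omega> \<Longrightarrow> norm (a x \<xi>) \<le> c1 * (1 + norm \<xi> powr (p x - 1))"
    using A2 by blast
  obtain k where k: "k > 0" "\<And>x \<xi> \<psi>. x \<in> closure \<Omega> \<Longrightarrow>
      A x ((\<xi> + \<psi>) /\<^sub>R 2) \<le> A x \<xi> / 2 + A x \<psi> / 2 - k * norm (\<xi> - \<psi>) powr p x"
    using A4 by blast
  have A_cont: "continuous_on (closure \<Omega> \<times> UNIV) (\<lambda>(x, \<xi>). A x \<xi>)"
    by (rule potential_continuous[OF _ _ a_cont]) (use a_deriv A1 in auto)
  interpret sobolev_setting \<Omega> p P r q R
  proof
    show "continuous_on \<Omega> p" by (rule continuous_on_subset[OF p_cont sub])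
    show "1 \<le> p x" if "x \<in> \<Omega>" for x using p_bounds[OF that] r by linarith
    show "1 \<le> P" using r by linarith
    show "r < real DIM('a)" using r PN by linarith
    show "q < real DIM('a) * r / (real DIM('a) - r)" using q by (simp add: crit_def)
  qed (use O R r q p_bounds in auto)
  \<comment> \<open>No parameter other than \<open>lam\<close> depends on \<open>lam\<close>, so the
    test function and the threshold below can be fixed before \<open>lam\<close> is chosen.\<close>
  have LL: "leray_lions \<Omega> p P r q R A a \<beta> \<gamma> c1 k lam" if lam: "lam > 0" for lam
  proof
    show "1 < \<beta>" "\<beta> < \<gamma>" "\<gamma> < r" using exps by (auto simp: r_def)
    show "continuous_on (\<Omega> \<times> UNIV) (\<lambda>(x, \<xi>). a x \<xi>)" "continuous_on (\<Omega> \<times> UNIV) (\<lambda>(x, \<xi>). A x \<xi>)"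
      by (rule continuous_on_subset[OF a_cont] continuous_on_subset[OF A_cont], use sub in auto)+
    fix x assume x: "x \<in> \<Omega>"
    then have xc: "x \<in> closure \<Omega>" using sub by blast
    show "A x 0 = 0" using A1 xc by blast
    show "norm (a x \<xi>) \<le> c1 * (1 + norm \<xi> powr (p x - 1))" for \<xi> by (rule c1(2)[OF xc])
    show "A x \<xi> + a x \<xi> \<bullet> (\<psi> - \<xi>) \<le> A x \<psi>" for \<xi> \<psi>
      by (rule monotone_gradient_tangent) (use a_deriv A3 xc in blast)+
    show "A x ((1/2) *\<^sub>R (\<xi> + \<psi>)) \<le> A x \<xi> / 2 + A x \<psi> / 2 - k * norm (\<xi> - \<psi>) powr p x" for \<xi> \<psi>
      using k(2)[OF xc, of \<xi> \<psi>] by (simp add: inverse_eq_divide)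
    show "norm \<xi> powr p x \<le> a x \<xi> \<bullet> \<xi>" for \<xi> using A5 xc by blast
    show "norm \<xi> powr p x / P \<le> A x \<xi>" for \<xi>
    proof -
      have p0: "0 < p x" using p_bounds[OF x] r by linarith
      have "norm \<xi> powr p x \<le> p x * A x \<xi>" using A5 xc by (meson order_trans)
      then have "norm \<xi> powr p x / p x \<le> A x \<xi>" using p0 by (simp add: field_simps)
      moreover have "norm \<xi> powr p x / P \<le> norm \<xi> powr p x / p x"
        using p0 p_bounds[OF x] by (intro divide_left_mono) auto
      ultimately show ?thesis by linarith
    qed
  qed (use c1 k lam in auto)
  obtain b x0 e where b: "test_fun \<Omega> b" "\<And>x. b x \<ge> 0" "e > 0" "ball x0 e \<subseteq> \<Omega>" "\<And>x. x \<in> ball x0 e \<Longrightarrow> b x > 0"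
    by (rule exists_bump[OF O(1,3)]) blast
  define Bb where "Bb = (\<integral>x. \<bar>b x\<bar> powr \<beta> \<partial>lebesgue_on \<Omega>)"
  define Bg where "Bg = (\<integral>x. \<bar>b x\<bar> powr \<gamma> \<partial>lebesgue_on \<Omega>)"
  have le_p: "\<beta> \<le> p x" "\<gamma> \<le> p x" if "x \<in> \<Omega>" for x using p_bounds(1)[OF that] exps r by linarith+
  have "Bb > 0" "Bg > 0"
    unfolding Bb_def Bg_def by (rule integral_powr_pos[OF b]; use exps le_p in auto)+
  then obtain c where c: "c > 0" "0 < c powr \<gamma> / \<gamma> * Bg - c powr \<beta> / \<beta> * Bb"
    using exists_positive_scale[of \<beta> \<gamma> Bb Bg] exps by auto
  define w where "w = (\<lambda>x. c * b x)"
  have w: "test_fun \<Omega> w" unfolding w_def by (rule test_fun_cmult[OF b(1)])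
  define F where "F = c powr \<gamma> / \<gamma> * Bg - c powr \<beta> / \<beta> * Bb"
  define H where "H = (\<integral>x. A x (grad w x) \<partial>lebesgue_on \<Omega>)"
  have wg: "(\<integral>x. \<bar>w x\<bar> powr \<gamma> \<partial>lebesgue_on \<Omega>) = c powr \<gamma> * Bg"
    and wb: "(\<integral>x. \<bar>w x\<bar> powr \<beta> \<partial>lebesgue_on \<Omega>) = c powr \<beta> * Bb"
    using c(1) by (simp_all add: w_def Bg_def Bb_def abs_mult powr_mult)
  \<comment> \<open>The energy of \<open>jet w\<close> is H - lam * F with H and F > 0 independent
    of \<open>lam\<close>; it is negative beyond |H| / F, and the added 1 keeps the threshold
    positive.\<close>
  define lam_s where "lam_s = \<bar>H\<bar> / F + 1"
  have F: "F > 0" using c(2) by (simp add: F_def)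
  have "lam_s > 0" using F by (simp add: lam_s_def add_nonneg_pos)
  moreover have "\<exists>u1 u2. weak_solution p \<Omega> a lam \<gamma> \<beta> u1 \<and> weak_solution p \<Omega> a lam \<gamma> \<beta> u2 \<and>
           \<not> (AE x in lebesgue_on \<Omega>. u1 x = u2 x) \<and>
           \<not> (AE x in lebesgue_on \<Omega>. u1 x = 0) \<and>
           \<not> (AE x in lebesgue_on \<Omega>. u2 x = 0)" if lam: "lam > lam_s" for lam
  proof -
    interpret ll: leray_lions \<Omega> p P r q R A a \<beta> \<gamma> c1 k lam
      by (rule LL) (use lam \<open>lam_s > 0\<close> in linarith)
    have "ll.J (jet w) = H - lam * F"
      unfolding ll.J_jet[OF w] wg wb H_def[symmetric] F_def by (simp add: algebra_simps)
    also have "H < lam * F"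
    proof -
      have "H \<le> \<bar>H\<bar> / F * F" using F by simp
      also have "\<dots> < lam * F" using lam F by (intro mult_strict_right_mono) (auto simp: lam_s_def)
      finally show ?thesis .
    qed
    finally have "ll.J (jet w) < 0" by simp
    moreover have "jet w \<in> ll.Ep"
      unfolding ll.Ep_def using E_jet[OF w] b(2) c(1) by (simp add: jet_def w_def)
    ultimately show ?thesis by (rule ll.two_solutions[rotated])
  qed
  ultimately show ?thesis by blast
qed

end
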